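(* There exist a compact $4$-dimensional manifold $M$ and a $C^\infty$-diffeomorphism $f\colon M\to M$ such that $f$ admits a global SRB measure $\mu$, but the special ergodic theorem does not hold for $(f,\mu)$; that is, there exist a continuous function $\varphi\in C(M)$ and a number $\alpha>0$ such that the Hausdorff dimension of the set $K_{\varphi,\alpha}$ of $(\varphi,\alpha)$-nontypical points is not strictly less than $\dim M=4$.
   Context: Let $M$ be a compact Riemannian manifold equipped with the Lebesgue (Riemannian volume) measure, and let $f\colon M\to M$ be a transformation with an invariant probability measure $\mu$. For $\varphi\colon M\to\mathbb{R}$ and $x\in M$ denote the $n$-th time average by $\varphi_n(x):=\frac1n\sum_{k=0}^{n-1}\varphi(f^k(x))$ and the space average by $\bar\varphi:=\int_M\varphi\,d\mu$. An invariant probability measure $\mu$ is called a (global) SRB measure for $f$ if for every continuous function $\varphi$ on $M$ and for Lebesgue-almost every $x\in M$ one has $\lim_{n\to\infty}\varphi_n(x)=\bar\varphi$. For $\varphi\in C(M)$ and $\alpha\ge 0$, the set of $(\varphi,\alpha)$-nontypical points is $K_{\varphi,\alpha}:=\{x\in M : \limsup_{n\to\infty}|\varphi_n(x)-\bar\varphi|>\alpha\}$. Let $\mu$ be a global SRB measure of $f$. The special ergodic theorem is said to hold for $(f,\mu)$ if for every $\varphi\in C(M)$ and every $\alpha>0$ one has $\dim_H K_{\varphi,\alpha}<\dim M$, where $\dim_H$ denotes Hausdorff dimension. *)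

theory Defs
  imports "HOL-Analysis.Analysis" "HOL-Probability.Probability"
begin

section \<open>Smooth maps between open subsets of Euclidean spaces\<close>

text \<open>The predicates below are meant for open sets \<open>S\<close>. All first directional derivatives are
  required to be \<open>C\<^sup>k\<close>, which on open sets is the usual inductive definition of \<open>C\<^sup>k\<^sup>+\<^sup>1\<close>.\<close>

primrec Ck_on ::
  "nat \<Rightarrow> ('a::euclidean_space \<Rightarrow> 'b::euclidean_space) \<Rightarrow> 'a set \<Rightarrow> bool" where
  "Ck_on 0 f S \<longleftrightarrow> continuous_on S f"
| "Ck_on (Suc k) f S \<longleftrightarrow>
     (\<forall>x\<in>S. f differentiable (at x)) \<and> (\<forall>v. Ck_on k (\<lambda>x. frechet_derivative f (at x) v) S)"

definition smooth_on :: "('a::euclidean_space \<Rightarrow> 'b::euclidean_space) \<Rightarrow> 'a set \<Rightarrow> bool" where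
  "smooth_on f S \<longleftrightarrow> (\<forall>k. Ck_on k f S)"


section \<open>Smooth manifolds\<close>

text \<open>A chart is a pair \<open>(U, \<phi>)\<close>; the values of \<open>\<phi>\<close> outside \<open>U\<close> are irrelevant. The dimension of a
  manifold modelled on \<open>real ^ 'n\<close> is \<open>CARD('n)\<close>. Manifolds have no boundary. The atlas
  is not assumed to be maximal: any atlas determines the smooth structure.\<close>

type_synonym ('a, 'n) chart = "'a set \<times> ('a \<Rightarrow> real ^ 'n)"

definition is_chart :: "'a topology \<Rightarrow> ('a, 'n::finite) chart \<Rightarrow> bool" where
  "is_chart X c \<longleftrightarrow> (case c of (U, \<phi>) \<Rightarrow>
     openin X U \<and> open (\<phi> ` U) \<and>
     homeomorphic_map (subtopology X U) (top_of_set (\<phi> ` U)) \<phi>)"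

definition transition :: "('a, 'n::finite) chart \<Rightarrow> ('a, 'n) chart \<Rightarrow> real ^ 'n \<Rightarrow> real ^ 'n" where
  "transition c c' = snd c' \<circ> inv_into (fst c) (snd c)"

definition smooth_manifold :: "'a topology \<Rightarrow> ('a, 'n::finite) chart set \<Rightarrow> bool" where
  "smooth_manifold X \<A> \<longleftrightarrow>
     Hausdorff_space X \<and> second_countable X \<and>
     (\<forall>c\<in>\<A>. is_chart X c) \<and>
     (\<Union>c\<in>\<A>. fst c) = topspace X \<and>
     (\<forall>c\<in>\<A>. \<forall>c'\<in>\<A>. smooth_on (transition c c') (snd c ` (fst c \<inter> fst c')))"

definition smooth_self_map :: "'a topology \<Rightarrow> ('a, 'n::finite) chart set \<Rightarrow> ('a \<Rightarrow> 'a) \<Rightarrow> bool" where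
  "smooth_self_map X \<A> f \<longleftrightarrow>
     continuous_map X X f \<and>
     (\<forall>(U, \<phi>)\<in>\<A>. \<forall>(V, \<psi>)\<in>\<A>. smooth_on (\<psi> \<circ> f \<circ> inv_into U \<phi>) (\<phi> ` (U \<inter> f -` V)))"

definition smooth_diffeomorphism ::
  "'a topology \<Rightarrow> ('a, 'n::finite) chart set \<Rightarrow> ('a \<Rightarrow> 'a) \<Rightarrow> bool" where
  "smooth_diffeomorphism X \<A> f \<longleftrightarrow>
     bij_betw f (topspace X) (topspace X) \<and>
     smooth_self_map X \<A> f \<and> smooth_self_map X \<A> (inv_into (topspace X) f)"


section \<open>Riemannian metrics\<close>

text \<open>A Riemannian metric is given by its matrices \<open>(g\<^sub>i\<^sub>j)\<close> in local coordinates: \<open>g c p\<close> is the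
  Gram matrix of the coordinate vector fields of the chart \<open>c\<close> at the point with coordinates \<open>p\<close>.
  The last condition is the transformation law of a covariant 2-tensor.\<close>

type_synonym ('a, 'n) metric_coeffs = "('a, 'n) chart \<Rightarrow> real ^ 'n \<Rightarrow> real ^ 'n ^ 'n"

definition riemannian_metric :: "('a, 'n::finite) chart set \<Rightarrow> ('a, 'n) metric_coeffs \<Rightarrow> bool" where
  "riemannian_metric \<A> g \<longleftrightarrow>
     (\<forall>c\<in>\<A>. smooth_on (g c) (snd c ` fst c) \<and>
        (\<forall>p \<in> snd c ` fst c. transpose (g c p) = g c p \<and> (\<forall>v. v \<noteq> 0 \<longrightarrow> 0 < v \<bullet> (g c p *v v)))) \<and>
     (\<forall>c\<in>\<A>. \<forall>c'\<in>\<A>. \<forall>p \<in> snd c ` (fst c \<inter> fst c').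
        g c p = transpose (jacobian (transition c c') (at p)) ** g c' (transition c c' p)
                  ** jacobian (transition c c') (at p))"

definition compact_riemannian_manifold ::
  "'a topology \<Rightarrow> ('a, 'n::finite) chart set \<Rightarrow> ('a, 'n) metric_coeffs \<Rightarrow> bool" where
  "compact_riemannian_manifold X \<A> g \<longleftrightarrow>
     smooth_manifold X \<A> \<and> compact_space X \<and> riemannian_metric \<A> g"

subsection \<open>Riemannian distance\<close>

definition piecewise_C1_curve ::
  "'a topology \<Rightarrow> ('a, 'n::finite) chart set \<Rightarrow> (real \<Rightarrow> 'a) \<Rightarrow> bool" where
  "piecewise_C1_curve X \<A> \<gamma> \<longleftrightarrow>
     pathin X \<gamma> \<and>
     (\<forall>(U, \<phi>)\<in>\<A>. \<forall>a b. 0 \<le> a \<and> a \<le> b \<and> b \<le> 1 \<and> \<gamma> ` {a..b} \<subseteq> U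
        \<longrightarrow> (\<phi> \<circ> \<gamma>) piecewise_C1_differentiable_on {a..b})"

text \<open>The speed of a curve may be computed in any chart around \<open>\<gamma> t\<close>, by the transformation law.
  At the finitely many break points it has no meaning, which does not affect the length.\<close>

definition curve_speed ::
  "('a, 'n::finite) chart set \<Rightarrow> ('a, 'n) metric_coeffs \<Rightarrow> (real \<Rightarrow> 'a) \<Rightarrow> real \<Rightarrow> real" where
  "curve_speed \<A> g \<gamma> t =
     (let c = (SOME c. c \<in> \<A> \<and> \<gamma> t \<in> fst c);
          v = vector_derivative (snd c \<circ> \<gamma>) (at t)
      in sqrt (v \<bullet> (g c (snd c (\<gamma> t)) *v v)))"

definition curve_length ::
  "('a, 'n::finite) chart set \<Rightarrow> ('a, 'n) metric_coeffs \<Rightarrow> (real \<Rightarrow> 'a) \<Rightarrow> ennreal" where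
  "curve_length \<A> g \<gamma> = (\<integral>\<^sup>+t\<in>{0..1}. ennreal (curve_speed \<A> g \<gamma> t) \<partial>lborel)"

text \<open>The distance is \<open>\<infinity>\<close> between points in different components of the manifold.\<close>

definition riemannian_dist ::
  "'a topology \<Rightarrow> ('a, 'n::finite) chart set \<Rightarrow> ('a, 'n) metric_coeffs \<Rightarrow> 'a \<Rightarrow> 'a \<Rightarrow> ennreal" where
  "riemannian_dist X \<A> g x y =
     Inf {curve_length \<A> g \<gamma> | \<gamma>. piecewise_C1_curve X \<A> \<gamma> \<and> \<gamma> 0 = x \<and> \<gamma> 1 = y}"

subsection \<open>Riemannian volume\<close>

definition borel_of_topology :: "'a topology \<Rightarrow> 'a measure" where
  "borel_of_topology X = sigma (topspace X) {U. openin X U}"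

text \<open>The condition determines the measure \<open>vol\<close> uniquely, since countably many chart domains cover
  the manifold.\<close>

definition is_riemannian_volume ::
  "'a topology \<Rightarrow> ('a, 'n::finite) chart set \<Rightarrow> ('a, 'n) metric_coeffs \<Rightarrow> 'a measure \<Rightarrow> bool" where
  "is_riemannian_volume X \<A> g vol \<longleftrightarrow>
     space vol = topspace X \<and> sets vol = sets (borel_of_topology X) \<and>
     (\<forall>c\<in>\<A>. \<forall>E\<in>sets vol. E \<subseteq> fst c \<longrightarrow>
        emeasure vol E = (\<integral>\<^sup>+p \<in> snd c ` E. ennreal (sqrt (det (g c p))) \<partial>lborel))"


section \<open>Hausdorff dimension\<close>

text \<open>These are the usual definitions for an extended-valued distance \<open>d\<close>. Only exponents \<open>s > 0\<close>
  are used, so that sets of diameter 0 contribute 0 to the sum.\<close>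

definition ediameter :: "('a \<Rightarrow> 'a \<Rightarrow> ennreal) \<Rightarrow> 'a set \<Rightarrow> ennreal" where
  "ediameter d S = (SUP (x, y) \<in> S \<times> S. d x y)"

definition hausdorff_premeasure ::
  "('a \<Rightarrow> 'a \<Rightarrow> ennreal) \<Rightarrow> real \<Rightarrow> real \<Rightarrow> 'a set \<Rightarrow> ennreal" where
  "hausdorff_premeasure d s \<delta> K =
     Inf {(\<Sum>i. ennreal (enn2real (ediameter d (C i)) powr s)) | C :: nat \<Rightarrow> 'a set.
            K \<subseteq> (\<Union>i. C i) \<and> (\<forall>i. ediameter d (C i) \<le> ennreal \<delta>)}"

definition hausdorff_measure :: "('a \<Rightarrow> 'a \<Rightarrow> ennreal) \<Rightarrow> real \<Rightarrow> 'a set \<Rightarrow> ennreal" where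
  "hausdorff_measure d s K = (SUP \<delta>\<in>{0<..}. hausdorff_premeasure d s \<delta> K)"

definition hausdorff_dim :: "('a \<Rightarrow> 'a \<Rightarrow> ennreal) \<Rightarrow> 'a set \<Rightarrow> ennreal" where
  "hausdorff_dim d K = Inf {ennreal s | s. 0 < s \<and> hausdorff_measure d s K = 0}"


section \<open>Time averages, SRB measures and the special ergodic theorem\<close>

definition time_average :: "('a \<Rightarrow> 'a) \<Rightarrow> ('a \<Rightarrow> real) \<Rightarrow> nat \<Rightarrow> 'a \<Rightarrow> real" where
  "time_average f \<phi> n x = (1 / real n) * (\<Sum>k<n. \<phi> ((f ^^ k) x))"

definition invariant_prob_measure :: "'a topology \<Rightarrow> ('a \<Rightarrow> 'a) \<Rightarrow> 'a measure \<Rightarrow> bool" where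
  "invariant_prob_measure X f \<mu> \<longleftrightarrow>
     prob_space \<mu> \<and> space \<mu> = topspace X \<and> sets \<mu> = sets (borel_of_topology X) \<and>
     f \<in> \<mu> \<rightarrow>\<^sub>M \<mu> \<and> distr \<mu> \<mu> f = \<mu>"

text \<open>Here \<open>vol\<close> is the reference (Lebesgue) measure.\<close>

definition global_SRB_measure ::
  "'a topology \<Rightarrow> 'a measure \<Rightarrow> ('a \<Rightarrow> 'a) \<Rightarrow> 'a measure \<Rightarrow> bool" where
  "global_SRB_measure X vol f \<mu> \<longleftrightarrow>
     invariant_prob_measure X f \<mu> \<and>
     (\<forall>\<phi>. continuous_map X euclideanreal \<phi> \<longrightarrow>
        (AE x in vol. (\<lambda>n. time_average f \<phi> n x) \<longlonglongrightarrow> (LINT y|\<mu>. \<phi> y)))"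

definition nontypical_points ::
  "'a topology \<Rightarrow> ('a \<Rightarrow> 'a) \<Rightarrow> 'a measure \<Rightarrow> ('a \<Rightarrow> real) \<Rightarrow> real \<Rightarrow> 'a set" where
  "nontypical_points X f \<mu> \<phi> \<alpha> =
     {x \<in> topspace X.
        limsup (\<lambda>n. ereal \<bar>time_average f \<phi> n x - (LINT y|\<mu>. \<phi> y)\<bar>) > ereal \<alpha>}"

definition special_ergodic_theorem ::
  "'a topology \<Rightarrow> ('a, 'n::finite) chart set \<Rightarrow> ('a, 'n) metric_coeffs \<Rightarrow> ('a \<Rightarrow> 'a) \<Rightarrow> 'a measure
     \<Rightarrow> bool" where
  "special_ergodic_theorem X \<A> g f \<mu> \<longleftrightarrow>
     (\<forall>\<phi> \<alpha>. continuous_map X euclideanreal \<phi> \<and> 0 < \<alpha> \<longrightarrow>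
        hausdorff_dim (riemannian_dist X \<A> g) (nontypical_points X f \<mu> \<phi> \<alpha>) < of_nat CARD('n))"

end

theory Submission
  imports Defs "HOL-Computational_Algebra.Polynomial"
begin

text \<open>Let \<open>C\<close> be a compact null set of reals whose power \<open>C\<^sup>n\<close> has Hausdorff dimension \<open>n\<close>, and let
  \<open>\<rho> \<ge> 0\<close> be a smooth function on \<open>\<real>\<^sup>n\<close> that vanishes exactly on \<open>C\<^sup>n\<close> and is constant far out. For a
  unit vector \<open>e\<close> along an axis and small \<open>\<epsilon>\<close>, the slowed translation
  \<open>F u = u + \<epsilon> \<rho>(u) e\<close> is a diffeomorphism of \<open>\<real>\<^sup>n\<close>. It is a translation far out, so it extends
  smoothly to the sphere, with the point at infinity fixed. An orbit can fail to tend to infinity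
  only if all coordinates of its starting point transversal to \<open>e\<close> lie in \<open>C\<close>, and for \<open>n \<ge> 2\<close>
  this is a null set. Hence the Dirac measure at infinity is a global SRB measure, while all points of
  \<open>C\<^sup>n\<close> are fixed. The theorem uses \<open>n = 4\<close>.

  The set \<open>C\<close> is the closure of the range of the pure jump function
  \<open>u \<mapsto> \<Sum>k. 2\<^sup>-\<^sup>k (k + 1)\<^sup>-\<^sup>2 \<lfloor>2\<^sup>k u\<rfloor>\<close> on \<open>[0, 1)\<close>. Its inverse is \<open>s\<close>-Hoelder for every \<open>s < 1\<close>, which
  bounds the Hausdorff dimension of \<open>C\<^sup>n\<close> from below by comparison with the Lebesgue measure of a cube.
  The sphere carries the metric induced by an embedding, so Riemannian distances dominate Euclidean
  ones.\<close>

section \<open>Calculus of smooth maps\<close>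

text \<open>The weights of the jump function balance two demands. Level k has about 2^k jumps of
  height 2^-k (k+1)^-2, so the jumps from level m on add up to the tail of a convergent series; this
  tail bounds the measure of C. But (k+1)^2 is subexponential: points about 2^-k apart are sent at
  least 2^-k (k+1)^-2 apart, up to constants more than (2^-k)^t for every t > 1, so no dimension is
  lost. A faster geometric decay of the jumps would lose some.

  The zero set is a product because the motion is along one axis: a transversal coordinate outside C
  is constant in time and keeps the speed of the whole orbit bounded below. Almost every orbit thus
  escapes by a direct estimate, with no ergodic argument.

  In the coordinate u / |u|^2 around infinity a translation is a rational map whose denominator has
  no zero. This is why F is made an exact translation outside a ball.

  Nontypical points are detected by the function 1 - height, which vanishes at the point at
  infinity, hence has space average 0, and is bounded below by a positive constant on the bounded
  set C^n.\<close>

lemma Ck_on_cong: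
  fixes f g :: "'a::euclidean_space \<Rightarrow> 'b::euclidean_space"
  assumes "open S" "\<And>x. x \<in> S \<Longrightarrow> f x = g x" "Ck_on k f S"
  shows "Ck_on k g S"
  using assms(2,3)
proof (induction k arbitrary: f g)
  case 0
  then show ?case by (simp cong: continuous_on_cong)
next
  case (Suc k)
  have d: "(g has_derivative frechet_derivative f (at x)) (at x)" if "x \<in> S" for x
  proof (rule has_derivative_transform_within_open[OF _ assms(1) that])
    show "(f has_derivative frechet_derivative f (at x)) (at x)"
      using Suc.prems that by (auto simp: frechet_derivative_works)
  qed (use Suc.prems in auto)
  have "frechet_derivative f (at x) = frechet_derivative g (at x)" if "x \<in> S" for x
    using frechet_derivative_at[OF d[OF that]] .
  then have "Ck_on k (\<lambda>x. frechet_derivative g (at x) v) S" for v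
    using Suc.IH[of "\<lambda>x. frechet_derivative f (at x) v" "\<lambda>x. frechet_derivative g (at x) v"]
      Suc.prems by simp
  then show ?case using d by (auto simp: differentiable_def)
qed

lemma Ck_on_subset: "Ck_on k f S \<Longrightarrow> T \<subseteq> S \<Longrightarrow> Ck_on k f T"
  by (induction k arbitrary: f) (auto intro: continuous_on_subset)

lemma Ck_on_pred: "Ck_on (Suc k) f S \<Longrightarrow> Ck_on k f S"
proof (induction k arbitrary: f)
  case 0
  then show ?case
    by (auto intro!: continuous_at_imp_continuous_on differentiable_imp_continuous_within)
next
  case (Suc k)
  have "Ck_on k (\<lambda>x. frechet_derivative f (at x) v) S" for v
    using Suc.prems[unfolded Ck_on.simps(2)[of "Suc k"]] by (intro Suc.IH) blast
  then show ?case using Suc.prems by simp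
qed

lemma Ck_on_Un: "open S \<Longrightarrow> open T \<Longrightarrow> Ck_on k f S \<Longrightarrow> Ck_on k f T \<Longrightarrow> Ck_on k f (S \<union> T)"
  by (induction k arbitrary: f) (auto intro: continuous_on_open_Un)

lemma Ck_on_SucI:
  assumes "open S" "\<And>x. x \<in> S \<Longrightarrow> (f has_derivative D x) (at x)"
    "\<And>v. Ck_on k (\<lambda>x. D x v) S"
  shows "Ck_on (Suc k) f S"
proof -
  have "D x = frechet_derivative f (at x)" if "x \<in> S" for x
    using frechet_derivative_at[OF assms(2)[OF that]] .
  then have "Ck_on k (\<lambda>x. frechet_derivative f (at x) v) S" for v
    by (intro Ck_on_cong[OF assms(1) _ assms(3)[of v]]) simp
  then show ?thesis using assms(2) by (auto simp: differentiable_def)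
qed

lemma Ck_on_has_derivative:
  assumes "Ck_on (Suc k) f S" "x \<in> S"
  shows "(f has_derivative frechet_derivative f (at x)) (at x)"
  using assms by (auto simp: frechet_derivative_works)

lemma Ck_on_const: "Ck_on k (\<lambda>x. c) S"
  by (induction k arbitrary: c) auto

lemma Ck_on_linear:
  assumes "bounded_linear f" "open S" shows "Ck_on k f S"
proof (cases k)
  case 0 then show ?thesis using assms(1) by (auto intro: linear_continuous_on)
next
  case (Suc n)
  show ?thesis unfolding Suc
    by (rule Ck_on_SucI[OF assms(2), where D="\<lambda>x. f"])
       (auto intro: bounded_linear_imp_has_derivative assms(1) Ck_on_const)
qed

lemma Ck_on_add:
  assumes "open S" "Ck_on k f S" "Ck_on k g S"
  shows "Ck_on k (\<lambda>x. f x + g x) S"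
  using assms(2,3)
proof (induction k arbitrary: f g)
  case (Suc k)
  show ?case
    by (rule Ck_on_SucI[OF assms(1)])
      (use Suc in \<open>auto intro!: has_derivative_add simp: frechet_derivative_works\<close>)
qed (auto intro: continuous_on_add)

lemma Ck_on_sum:
  assumes "open S" "\<And>i. i \<in> I \<Longrightarrow> Ck_on k (f i) S"
  shows "Ck_on k (\<lambda>x. \<Sum>i\<in>I. f i x) S"
  using assms(2)
  by (induction I rule: infinite_finite_induct) (auto intro: Ck_on_const Ck_on_add assms(1))

lemma Ck_on_bilinear:
  assumes "bounded_bilinear p" "open S" "Ck_on k f S" "Ck_on k g S"
  shows "Ck_on k (\<lambda>x. p (f x) (g x)) S"
  using assms(3,4)
proof (induction k arbitrary: f g)
  case 0
  then show ?case using bounded_bilinear.continuous_on[OF assms(1)] by auto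
next
  case (Suc k)
  have fg: "Ck_on k f S" "Ck_on k g S" using Suc.prems by (blast intro: Ck_on_pred)+
  show ?case
  proof (rule Ck_on_SucI[OF assms(2)])
    show "((\<lambda>x. p (f x) (g x)) has_derivative
       (\<lambda>v. p (f x) (frechet_derivative g (at x) v) + p (frechet_derivative f (at x) v) (g x))) (at x)"
      if "x \<in> S" for x
      by (rule bounded_bilinear.FDERIV[OF assms(1) Ck_on_has_derivative[OF Suc.prems(1) that]
            Ck_on_has_derivative[OF Suc.prems(2) that]])
    show "Ck_on k (\<lambda>x. p (f x) (frechet_derivative g (at x) v) +
      p (frechet_derivative f (at x) v) (g x)) S" for v
      using Suc fg by (intro Ck_on_add[OF assms(2)]) auto
  qed
qed

text \<open>The chain rule is expanded over \<open>Basis\<close>: the derivative of the composition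
  becomes a sum of products of a component of the derivative of \<open>g\<close> with a partial
  derivative of \<open>f\<close> composed with \<open>g\<close>. The induction hypothesis applies to
  the partial derivatives, while \<open>g\<close> stays fixed.\<close>

lemma Ck_on_compose:
  fixes f :: "'b::euclidean_space \<Rightarrow> 'c::euclidean_space"
    and g :: "'a::euclidean_space \<Rightarrow> 'b"
  assumes "open S" "g ` S \<subseteq> T" "Ck_on k f T" "Ck_on k g S"
  shows "Ck_on k (\<lambda>x. f (g x)) S"
  using assms(3,4)
proof (induction k arbitrary: f)
  case 0
  then show ?case using assms(2) by (auto intro: continuous_on_compose2)
next
  case (Suc k)
  have g: "Ck_on k g S" using Suc.prems by (blast intro: Ck_on_pred)
  let ?D = "\<lambda>x v. \<Sum>b\<in>Basis. (frechet_derivative g (at x) v \<bullet> b) *\<^sub>R frechet_derivative f (at (g x)) b"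
  show ?case
  proof (rule Ck_on_SucI[OF assms(1)])
    fix x assume x: "x \<in> S"
    have df: "(f has_derivative frechet_derivative f (at (g x))) (at (g x))"
      using Ck_on_has_derivative[OF Suc.prems(1)] x assms(2) by auto
    then have lin: "linear (frechet_derivative f (at (g x)))"
      using has_derivative_linear by blast
    have *: "frechet_derivative f (at (g x)) w = (\<Sum>b\<in>Basis. (w \<bullet> b) *\<^sub>R frechet_derivative f (at (g x)) b)" for w
    proof -
      have "frechet_derivative f (at (g x)) w = frechet_derivative f (at (g x)) (\<Sum>b\<in>Basis. (w \<bullet> b) *\<^sub>R b)"
        by (simp add: euclidean_representation)
      also have "\<dots> = (\<Sum>b\<in>Basis. (w \<bullet> b) *\<^sub>R frechet_derivative f (at (g x)) b)"
        by (simp add: linear_sum[OF lin] linear_scale[OF lin])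
      finally show ?thesis .
    qed
    have "((\<lambda>x. f (g x)) has_derivative
        (\<lambda>v. frechet_derivative f (at (g x)) (frechet_derivative g (at x) v))) (at x)"
      using diff_chain_at[OF Ck_on_has_derivative[OF Suc.prems(2) x] df] by (simp add: o_def)
    then show "((\<lambda>x. f (g x)) has_derivative ?D x) (at x)"
      unfolding *[of "frechet_derivative g (at x) v" for v] .
  next
    fix v
    show "Ck_on k (\<lambda>x. ?D x v) S"
    proof (intro Ck_on_sum[OF assms(1)] Ck_on_bilinear[OF bounded_bilinear_scaleR assms(1)])
      fix b :: 'b
      show "Ck_on k (\<lambda>x. frechet_derivative f (at (g x)) b) S"
        using Suc.IH[of "\<lambda>y. frechet_derivative f (at y) b"] Suc.prems g by simp
      show "Ck_on k (\<lambda>x. frechet_derivative g (at x) v \<bullet> b) S"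
        using Suc.prems(2)
        by (intro Ck_on_bilinear[OF bounded_bilinear_inner assms(1)] Ck_on_const) simp
    qed
  qed
qed

text \<open>The derivative is, up to sign, the product of the function with itself, so the induction
  feeds on its own hypothesis.\<close>

lemma Ck_on_inverse: "Ck_on k (inverse :: real \<Rightarrow> real) (-{0})"
proof (induction k)
  case 0
  then show ?case by (auto intro!: continuous_intros)
next
  case (Suc k)
  have o: "open (-{0::real})" by auto
  show ?case
  proof (rule Ck_on_SucI[OF o])
    show "(inverse has_derivative (\<lambda>h. (- (inverse x * inverse x)) * h)) (at x)" if "x \<in> -{0}" for x :: real
      using has_derivative_inverse'[of x UNIV] that by (auto simp: algebra_simps)
    show "Ck_on k (\<lambda>x. - (inverse x * inverse x) * v) (-{0})" for v :: real
      using Ck_on_bilinear[OF bounded_bilinear_mult o Ck_on_bilinear[OF bounded_bilinear_mult o Suc Suc] Ck_on_const[of k "-v"]]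
      by simp
  qed
qed

lemma smooth_on_cong:
  "smooth_on f S \<Longrightarrow> open S \<Longrightarrow> (\<And>x. x \<in> S \<Longrightarrow> f x = g x) \<Longrightarrow> smooth_on g S"
  unfolding smooth_on_def by (intro allI Ck_on_cong[of S f g]) auto

lemma smooth_on_subset: "smooth_on f S \<Longrightarrow> T \<subseteq> S \<Longrightarrow> smooth_on f T"
  unfolding smooth_on_def using Ck_on_subset by blast

lemma smooth_on_Un: "open S \<Longrightarrow> open T \<Longrightarrow> smooth_on f S \<Longrightarrow> smooth_on f T \<Longrightarrow> smooth_on f (S \<union> T)"
  unfolding smooth_on_def using Ck_on_Un by blast

lemma smooth_on_const: "smooth_on (\<lambda>x. c) S"
  unfolding smooth_on_def using Ck_on_const by blast

lemma smooth_on_linear: "bounded_linear f \<Longrightarrow> open S \<Longrightarrow> smooth_on f S"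
  unfolding smooth_on_def using Ck_on_linear by blast

lemma smooth_on_id: "open S \<Longrightarrow> smooth_on (\<lambda>x. x) S"
  by (rule smooth_on_linear) (rule bounded_linear_ident)

lemma smooth_on_add: "open S \<Longrightarrow> smooth_on f S \<Longrightarrow> smooth_on g S \<Longrightarrow> smooth_on (\<lambda>x. f x + g x) S"
  unfolding smooth_on_def using Ck_on_add by blast

lemma smooth_on_sum: "open S \<Longrightarrow> (\<And>i. i \<in> I \<Longrightarrow> smooth_on (f i) S) \<Longrightarrow> smooth_on (\<lambda>x. \<Sum>i\<in>I. f i x) S"
  unfolding smooth_on_def by (simp add: Ck_on_sum)

lemma smooth_on_bilinear:
  "bounded_bilinear p \<Longrightarrow> open S \<Longrightarrow> smooth_on f S \<Longrightarrow> smooth_on g S \<Longrightarrow> smooth_on (\<lambda>x. p (f x) (g x)) S"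
  unfolding smooth_on_def by (simp add: Ck_on_bilinear)

lemmas smooth_on_scaleR = smooth_on_bilinear[OF bounded_bilinear_scaleR]
lemmas smooth_on_inner = smooth_on_bilinear[OF bounded_bilinear_inner]

lemma smooth_on_mult:
  fixes f g :: "'a::euclidean_space \<Rightarrow> real"
  shows "open S \<Longrightarrow> smooth_on f S \<Longrightarrow> smooth_on g S \<Longrightarrow> smooth_on (\<lambda>x. f x * g x) S"
  by (rule smooth_on_bilinear[OF bounded_bilinear_mult])

lemma smooth_on_compose:
  "smooth_on f T \<Longrightarrow> smooth_on g S \<Longrightarrow> open S \<Longrightarrow> g ` S \<subseteq> T \<Longrightarrow> smooth_on (\<lambda>x. f (g x)) S"
  unfolding smooth_on_def by (rule allI, rule Ck_on_compose[of S g T]) auto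

lemma smooth_on_linear_compose:
  "bounded_linear f \<Longrightarrow> open S \<Longrightarrow> smooth_on g S \<Longrightarrow> smooth_on (\<lambda>x. f (g x)) S"
  by (rule smooth_on_compose[OF smooth_on_linear[of f UNIV]]) auto

lemma smooth_on_diff: "open S \<Longrightarrow> smooth_on f S \<Longrightarrow> smooth_on g S \<Longrightarrow> smooth_on (\<lambda>x. f x - g x) S"
  using smooth_on_add[OF _ _ smooth_on_linear_compose[OF bounded_linear_minus[OF bounded_linear_ident]], of S f g] by simp

lemma smooth_on_prod:
  fixes f :: "'i \<Rightarrow> 'a::euclidean_space \<Rightarrow> real"
  assumes "open S" "\<And>i. i \<in> I \<Longrightarrow> smooth_on (f i) S"
  shows "smooth_on (\<lambda>x. \<Prod>i\<in>I. f i x) S"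
  using assms(2)
  by (induction I rule: infinite_finite_induct) (auto intro!: smooth_on_const smooth_on_mult assms(1))

lemma smooth_on_divide:
  fixes f g :: "'a::euclidean_space \<Rightarrow> real"
  assumes "open S" "smooth_on f S" "smooth_on g S" "\<And>x. x \<in> S \<Longrightarrow> g x \<noteq> 0"
  shows "smooth_on (\<lambda>x. f x / g x) S"
proof -
  have "smooth_on (inverse :: real \<Rightarrow> real) (-{0})" unfolding smooth_on_def using Ck_on_inverse by blast
  then have "smooth_on (\<lambda>x. inverse (g x)) S"
    by (rule smooth_on_compose[OF _ assms(3,1)]) (use assms(4) in auto)
  from smooth_on_mult[OF assms(1,2) this] show ?thesis by (simp add: divide_inverse)
qed

lemma smooth_on_Pair:
  fixes f :: "'a::euclidean_space \<Rightarrow> 'b::euclidean_space" and g :: "'a \<Rightarrow> 'c::euclidean_space"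
  assumes "open S" "smooth_on f S" "smooth_on g S"
  shows "smooth_on (\<lambda>x. (f x, g x)) S"
proof -
  have l: "bounded_linear (\<lambda>y::'b. (y, 0::'c))" "bounded_linear (\<lambda>y::'c. (0::'b, y))"
    by (auto intro!: bounded_linear_Pair bounded_linear_ident bounded_linear_zero)
  show ?thesis
    using smooth_on_add[OF assms(1) smooth_on_linear_compose[OF l(1) assms(1,2)]
        smooth_on_linear_compose[OF l(2) assms(1,3)]] by simp
qed

lemma smooth_on_has_derivative:
  assumes "smooth_on f S" "x \<in> S"
  shows "(f has_derivative frechet_derivative f (at x)) (at x)"
  by (rule Ck_on_has_derivative[OF _ assms(2), of 0]) (use assms(1) smooth_on_def in blast)

lemma smooth_on_frechet_derivative:
  assumes "smooth_on f S"
  shows "smooth_on (\<lambda>x. frechet_derivative f (at x) v) S"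
  using assms unfolding smooth_on_def by (metis Ck_on.simps(2))

lemma smooth_on_continuous:
  assumes "smooth_on f S"
  shows "continuous_on S f"
  using assms unfolding smooth_on_def by (metis Ck_on.simps(1))

section \<open>A smooth function with prescribed zero set\<close>

text \<open>Replaces iterated Frechet derivatives by an explicit chain of derivatives, which is what
  is at hand both for \<open>flat_exp\<close> and for series differentiated term by term.\<close>

lemma smooth_on_derivative_sequence:
  fixes D :: "nat \<Rightarrow> real \<Rightarrow> real"
  assumes "open S" "\<And>k x. x \<in> S \<Longrightarrow> (D k has_real_derivative D (Suc k) x) (at x)"
  shows "smooth_on (D 0) S"
proof -
  have "Ck_on n (D k) S" for n k
  proof (induction n arbitrary: k)
    case 0
    show ?case using assms(2) by (auto intro!: continuous_at_imp_continuous_on DERIV_isCont)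
  next
    case (Suc n)
    show ?case
    proof (rule Ck_on_SucI[OF assms(1)])
      show "(D k has_derivative (*) (D (Suc k) x)) (at x)" if "x \<in> S" for x
        using assms(2)[OF that] by (simp add: has_field_derivative_def)
      show "Ck_on n (\<lambda>x. D (Suc k) x * v) S" for v
        by (rule Ck_on_bilinear[OF bounded_bilinear_mult assms(1) Suc Ck_on_const])
    qed
  qed
  then show ?thesis by (simp add: smooth_on_def)
qed

lemma smooth_on_real_deriv:
  fixes f :: "real \<Rightarrow> real"
  assumes "smooth_on f UNIV"
  shows "(f has_real_derivative deriv f x) (at x)" "smooth_on (deriv f) UNIV"
proof -
  have 1: "(f has_real_derivative frechet_derivative f (at x) 1) (at x)" for x
  proof -
    have d: "(f has_derivative frechet_derivative f (at x)) (at x)"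
      using smooth_on_has_derivative[OF assms] by simp
    have "frechet_derivative f (at x) = (*) (frechet_derivative f (at x) 1)"
    proof
      show "frechet_derivative f (at x) c = frechet_derivative f (at x) 1 * c" for c
        using linear_scale[OF has_derivative_linear[OF d], of c 1]
        unfolding real_scaleR_def mult_1_right by (rule trans[OF _ mult.commute])
    qed
    then show ?thesis using d by (simp add: has_field_derivative_def)
  qed
  have 2: "frechet_derivative f (at x) 1 = deriv f x" for x
    using DERIV_imp_deriv[OF 1] by simp
  show "(f has_real_derivative deriv f x) (at x)" using 1 2 by metis
  show "smooth_on (deriv f) UNIV"
    by (rule smooth_on_cong[OF smooth_on_frechet_derivative[OF assms, of 1]]) (simp_all add: 2)
qed

lemma smooth_on_iterated_deriv:
  fixes f :: "real \<Rightarrow> real"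
  assumes "smooth_on f UNIV"
  shows "((deriv ^^ k) f has_real_derivative (deriv ^^ Suc k) f x) (at x)"
proof -
  have "smooth_on ((deriv ^^ k) f) UNIV"
    by (induction k) (auto intro: assms smooth_on_real_deriv(2))
  then show ?thesis using smooth_on_real_deriv(1) by auto
qed

text \<open>For \<open>p = 1\<close> this is the classical flat function exp (-1/x). The polynomial
  factor makes the family closed under differentiation: with y = 1/x, the derivative of p(y) exp
  (-y) is y^2 (p - p')(y) exp (-y).\<close>

definition flat_exp :: "real poly \<Rightarrow> real \<Rightarrow> real" where
  "flat_exp p x = (if x \<le> 0 then 0 else poly p (inverse x) * exp (- inverse x))"

lemma poly_times_exp_neg_tendsto_0:
  fixes p :: "real poly"
  shows "((\<lambda>y. poly p y * exp (- y)) \<longlongrightarrow> 0) at_top"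
proof -
  have "((\<lambda>y. \<Sum>i\<le>degree p. coeff p i * (y ^ i / exp y)) \<longlongrightarrow> (\<Sum>i\<le>degree p. coeff p i * 0)) at_top"
    by (intro tendsto_sum tendsto_mult tendsto_const tendsto_power_div_exp_0)
  then show ?thesis
    by (simp add: poly_altdef exp_minus divide_inverse sum_distrib_right mult.assoc)
qed

lemma flat_exp_has_derivative:
  "(flat_exp p has_real_derivative flat_exp (monom 1 2 * (p - pderiv p)) x) (at x)"
proof -
  consider "x < 0" | "x > 0" | "x = 0" by linarith
  then show ?thesis
  proof cases
    case 1
    have "(flat_exp p has_real_derivative 0) (at x)"
      by (rule has_field_derivative_transform_within_open[of "\<lambda>x. 0" 0 x "{..<0}"])
         (use 1 in \<open>auto simp: flat_exp_def\<close>)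
    then show ?thesis using 1 by (simp add: flat_exp_def)
  next
    case 2
    have "((\<lambda>x. poly p (inverse x) * exp (- inverse x)) has_real_derivative
        flat_exp (monom 1 2 * (p - pderiv p)) x) (at x)"
      using 2
      by (auto intro!: derivative_eq_intros poly_DERIV[THEN DERIV_chain2]
          simp: flat_exp_def poly_monom power2_eq_square algebra_simps)
    then show ?thesis
      by (rule has_field_derivative_transform_within_open[of _ _ x "{0<..}"])
         (use 2 in \<open>auto simp: flat_exp_def\<close>)
  next
    case 3
    \<comment> \<open>The difference quotient at 0 divides by \<open>h\<close>, that is, multiplies
      by y = 1/h; \<open>pCons 0 p\<close> is the polynomial y p(y).\<close>
    have "((\<lambda>h. poly (pCons 0 p) (inverse h) * exp (- inverse h)) \<longlongrightarrow> 0) (at_right 0)"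
      using poly_times_exp_neg_tendsto_0[THEN filterlim_compose, OF filterlim_inverse_at_top_right] .
    moreover have "\<forall>\<^sub>F h in at_right 0. poly (pCons 0 p) (inverse h) * exp (- inverse h) = flat_exp p h / h"
      unfolding eventually_at_right_field
      by (intro exI[of _ 1]) (auto simp: flat_exp_def divide_inverse algebra_simps)
    ultimately have r: "((\<lambda>h. flat_exp p h / h) \<longlongrightarrow> 0) (at_right 0)"
      by (rule Lim_transform_eventually)
    have "\<forall>\<^sub>F h in at_left 0. 0 = flat_exp p h / h"
      unfolding eventually_at_left_field by (intro exI[of _ "-1"]) (auto simp: flat_exp_def)
    then have l: "((\<lambda>h. flat_exp p h / h) \<longlongrightarrow> 0) (at_left 0)"
      by (rule Lim_transform_eventually[OF tendsto_const])
    show ?thesis using filterlim_split_at[OF l r] 3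
      by (simp add: has_field_derivative_iff flat_exp_def)
  qed
qed

lemma smooth_on_flat_exp: "smooth_on (flat_exp p) UNIV"
proof -
  define D where "D k = flat_exp (((\<lambda>p. monom 1 2 * (p - pderiv p)) ^^ k) p)" for k
  have "smooth_on (D 0) UNIV"
    by (rule smooth_on_derivative_sequence) (auto simp: D_def flat_exp_has_derivative)
  then show ?thesis by (simp add: D_def)
qed

lemma ex_smooth_bump:
  fixes a b :: real
  obtains h :: "real \<Rightarrow> real" where "smooth_on h UNIV" "\<And>x. 0 \<le> h x" "\<And>x. 0 < h x \<longleftrightarrow> a < x \<and> x < b"
proof
  let ?h = "\<lambda>x::real. flat_exp 1 (x - a) * flat_exp 1 (b - x)"
  have l: "smooth_on (\<lambda>x. x - a) UNIV" "smooth_on (\<lambda>x. b - x) UNIV"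
    by (rule smooth_on_diff smooth_on_id smooth_on_const open_UNIV)+
  show "smooth_on ?h UNIV"
    by (rule smooth_on_mult[OF open_UNIV smooth_on_compose[OF smooth_on_flat_exp l(1) open_UNIV]
          smooth_on_compose[OF smooth_on_flat_exp l(2) open_UNIV]]) auto
  show "0 \<le> ?h x" for x by (simp add: flat_exp_def)
  show "0 < ?h x \<longleftrightarrow> a < x \<and> x < b" for x by (simp add: flat_exp_def)
qed

text \<open>All derivatives vanish on the open complement of the interval and are continuous on the
  interval itself, which is compact.\<close>

lemma iterated_deriv_bounded:
  fixes h :: "real \<Rightarrow> real"
  assumes "smooth_on h UNIV" "\<And>x. x \<notin> {a..b} \<Longrightarrow> h x = 0"
  shows "\<exists>B. \<forall>x. \<bar>(deriv ^^ k) h x\<bar> \<le> B"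
proof -
  have z: "(deriv ^^ k) h x = 0" if "x \<notin> {a..b}" for k x
    using that
  proof (induction k arbitrary: x)
    case (Suc k)
    have "((deriv ^^ k) h has_real_derivative 0) (at x)"
      by (rule has_field_derivative_transform_within_open[of "\<lambda>x. 0" 0 x "-{a..b}"])
         (use Suc in auto)
    then show ?case using smooth_on_iterated_deriv[OF assms(1)] DERIV_unique by blast
  qed (use assms(2) in auto)
  have "continuous_on {a..b} ((deriv ^^ k) h)"
    by (intro continuous_at_imp_continuous_on ballI DERIV_isCont[OF smooth_on_iterated_deriv[OF assms(1)]])
  then have "bounded ((deriv ^^ k) h ` {a..b})"
    by (intro compact_imp_bounded compact_continuous_image) auto
  then obtain B where B: "\<And>x. x \<in> {a..b} \<Longrightarrow> \<bar>(deriv ^^ k) h x\<bar> \<le> B"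
    unfolding bounded_iff by (metis imageI real_norm_def)
  have "\<bar>(deriv ^^ k) h x\<bar> \<le> max B 0" for x
    using B[of x] z[of x k] by (cases "x \<in> {a..b}") auto
  then show "\<exists>B. \<forall>x. \<bar>(deriv ^^ k) h x\<bar> \<le> B" by blast
qed

text \<open>A diagonal choice of weights: \<open>c j\<close> controls the derivatives of
  \<open>h j\<close> of order at most \<open>j\<close> only. For a fixed order this covers all but
  finitely many \<open>j\<close>, which is enough for the Weierstrass test on each differentiated
  series.\<close>

lemma smooth_weighted_series:
  fixes h :: "nat \<Rightarrow> real \<Rightarrow> real"
  assumes h: "\<And>j. smooth_on (h j) UNIV" and bd: "\<And>j k. \<exists>B. \<forall>x. \<bar>(deriv ^^ k) (h j) x\<bar> \<le> B"
  obtains c where "\<And>j. 0 < c j" "\<And>x. summable (\<lambda>j. c j * h j x)" "smooth_on (\<lambda>x. \<Sum>j. c j * h j x) UNIV"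
proof -
  define B where "B j k = (SOME B. \<forall>x. \<bar>(deriv ^^ k) (h j) x\<bar> \<le> B)" for j k
  have B: "\<bar>(deriv ^^ k) (h j) x\<bar> \<le> B j k" for j k x
    using someI_ex[OF bd[of k j]] unfolding B_def by blast
  then have B0: "0 \<le> B j k" for j k by (meson abs_ge_zero order_trans)
  define c where "c j = (1/2) ^ j / (1 + (\<Sum>k\<le>j. B j k))" for j :: nat
  have s0: "0 \<le> (\<Sum>k\<le>j. B j k)" for j by (auto intro: sum_nonneg B0)
  have c0: "0 < c j" for j
    unfolding c_def using s0[of j] by (intro divide_pos_pos) auto
  define D where "D k x = (\<Sum>j. c j * (deriv ^^ k) (h j) x)" for k x
  have le: "norm (c j * (deriv ^^ k) (h j) x) \<le> (1/2) ^ j" if "k \<le> j" for j k x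
  proof -
    have "B j k \<le> (\<Sum>k\<le>j. B j k)" using that by (intro member_le_sum) (auto intro: B0)
    then have "\<bar>(deriv ^^ k) (h j) x\<bar> \<le> 1 + (\<Sum>k\<le>j. B j k)" using B[where k=k and j=j and x=x] by linarith
    then have "c j * \<bar>(deriv ^^ k) (h j) x\<bar> \<le> c j * (1 + (\<Sum>k\<le>j. B j k))"
      using c0[of j] by (intro mult_left_mono) auto
    also have "\<dots> = (1/2) ^ j" using s0[of j] by (simp add: c_def)
    finally show ?thesis using c0[of j] by (simp add: abs_mult)
  qed
  have sm: "summable (\<lambda>j. (1/2::real) ^ j)" by (rule summable_geometric) simp
  have ev: "\<forall>\<^sub>F j in sequentially. \<forall>x\<in>UNIV. norm (c j * (deriv ^^ k) (h j) x) \<le> (1/2) ^ j" for k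
    unfolding eventually_sequentially using le by blast
  have summ: "summable (\<lambda>j. c j * (deriv ^^ k) (h j) x)" for k x
    by (rule summable_comparison_test_ev[OF _ sm]) (use ev[of k] in \<open>auto elim: eventually_mono\<close>)
  have "(D k has_real_derivative D (Suc k) x) (at x)" for k x
    unfolding D_def
  proof (rule has_field_derivative_series'(2)[where S=UNIV])
    show "((\<lambda>x. c j * (deriv ^^ k) (h j) x) has_real_derivative c j * (deriv ^^ Suc k) (h j) x) (at x)" for j x
      by (rule DERIV_cmult[OF smooth_on_iterated_deriv[OF h]])
    show "uniformly_convergent_on UNIV (\<lambda>n x. \<Sum>i<n. c i * (deriv ^^ Suc k) (h i) x)"
      by (rule Weierstrass_m_test'_ev[OF ev sm])
  qed (use summ in auto)
  then have "smooth_on (D 0) UNIV" by (intro smooth_on_derivative_sequence) auto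
  moreover have "D 0 = (\<lambda>x. \<Sum>j. c j * h j x)" by (simp add: D_def fun_eq_iff)
  ultimately show ?thesis using that[of c] c0 summ[of 0] by simp
qed

lemma ex_smooth_zero_set:
  fixes C :: "real set"
  assumes "closed C"
  obtains s :: "real \<Rightarrow> real" where "smooth_on s UNIV" "\<And>x. 0 \<le> s x" "\<And>x. s x = 0 \<longleftrightarrow> x \<in> C"
proof (cases "C = UNIV")
  case True
  then show ?thesis by (intro that[of "\<lambda>_. 0"] smooth_on_const) auto
next
  case False
  have o: "open (-C)" using assms by blast
  obtain \<D> :: "real set set" where D: "countable \<D>" "\<D> \<subseteq> Pow (-C)"
    "\<And>X. X \<in> \<D> \<Longrightarrow> \<exists>a b. X = box a b" "\<Union>\<D> = -C"
    by (metis (no_types, lifting) open_countable_Union_open_box[OF o])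
  \<comment> \<open>A finite family gets enumerated with repetitions, which is harmless: only the
    union of the sets where the bumps are positive matters.\<close>
  then have "\<D> \<noteq> {}" using False D(4) by auto
  then have r: "range (from_nat_into \<D>) = \<D>" using D(1) by (rule range_from_nat_into)
  then have "\<exists>a b. from_nat_into \<D> j = {a<..<b}" for j using D(3) by (metis box_real(1) rangeI)
  then obtain a b where ab: "\<And>j. from_nat_into \<D> j = {a j<..<b j}" by metis
  have "\<exists>h::real \<Rightarrow> real. smooth_on h UNIV \<and> (\<forall>x. 0 \<le> h x) \<and> (\<forall>x. 0 < h x \<longleftrightarrow> x \<in> from_nat_into \<D> j)" for j
    by (rule ex_smooth_bump[of "a j" "b j"]) (auto simp: ab)
  then obtain h :: "nat \<Rightarrow> real \<Rightarrow> real" where h: "\<And>j. smooth_on (h j) UNIV" "\<And>j x. 0 \<le> h j x"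
    "\<And>j x. 0 < h j x \<longleftrightarrow> x \<in> from_nat_into \<D> j" by metis
  have bd: "\<exists>B. \<forall>x. \<bar>(deriv ^^ k) (h j) x\<bar> \<le> B" for j k
  proof (rule iterated_deriv_bounded[OF h(1)])
    show "h j x = 0" if "x \<notin> {a j..b j}" for x
      using h(2,3)[where j=j and x=x] that by (auto simp: ab order_le_less)
  qed
  have "\<exists>c. (\<forall>j. 0 < c j) \<and> (\<forall>x. summable (\<lambda>j. c j * h j x)) \<and> smooth_on (\<lambda>x. \<Sum>j. c j * h j x) UNIV"
    by (rule smooth_weighted_series[of h, OF h(1) bd]) blast
  then obtain c where c: "\<And>j. 0 < c j" "\<And>x. summable (\<lambda>j. c j * h j x)" "smooth_on (\<lambda>x. \<Sum>j. c j * h j x) UNIV"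
    by blast
  show ?thesis
  proof (rule that[OF c(3)])
    fix x
    have nn: "0 \<le> c j * h j x" for j using c(1)[of j] h(2)[of j x] by simp
    then show "0 \<le> (\<Sum>j. c j * h j x)" using c(2) by (intro suminf_nonneg) auto
    have "(\<Sum>j. c j * h j x) = 0 \<longleftrightarrow> (\<forall>j. c j * h j x = 0)"
      using nn c(2) by (intro suminf_eq_zero_iff) auto
    also have "\<dots> \<longleftrightarrow> (\<forall>j. x \<notin> from_nat_into \<D> j)"
      using c(1) h(2,3) by (metis less_irrefl mult_eq_0_iff order_le_less)
    also have "\<dots> \<longleftrightarrow> x \<in> C" using r D(4) by (metis ComplD ComplI UN_iff Union_iff rangeE rangeI)
    finally show "(\<Sum>j. c j * h j x) = 0 \<longleftrightarrow> x \<in> C" .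
  qed
qed

lemma ex_smooth_cutoff_zero_set:
  fixes C :: "real set"
  assumes "closed C" "C \<subseteq> {a..b}"
  obtains r :: "real \<Rightarrow> real" where "smooth_on r UNIV" "\<And>x. 0 \<le> r x" "\<And>x. r x \<le> 1"
    "\<And>x. r x = 0 \<longleftrightarrow> x \<in> C" "\<And>x. x \<notin> {a - 1..b + 1} \<Longrightarrow> r x = 1"
proof -
  obtain s :: "real \<Rightarrow> real" where s: "smooth_on s UNIV" "\<And>x. 0 \<le> s x" "\<And>x. s x = 0 \<longleftrightarrow> x \<in> C"
    using ex_smooth_zero_set[OF assms(1)] by metis
  obtain h :: "real \<Rightarrow> real" where h: "smooth_on h UNIV" "\<And>x. 0 \<le> h x" "\<And>x. 0 < h x \<longleftrightarrow> a - 1 < x \<and> x < b + 1"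
    using ex_smooth_bump[of "a - 1" "b + 1"] by metis
  have pos: "0 < s x + h x" for x
  proof (cases "x \<in> C")
    case True
    then have "0 < h x" using assms(2) h(3)[of x] by force
    then show ?thesis using s(2)[of x] by linarith
  next
    case False
    then show ?thesis using s(2,3)[of x] h(2)[of x] by linarith
  qed
  \<comment> \<open>The bump \<open>h\<close> is positive on \<open>C\<close>, where
    \<open>s\<close> vanishes, so the denominator has no zero; far out \<open>h\<close> vanishes and
    the quotient is exactly 1.\<close>
  have "smooth_on (\<lambda>x. s x / (s x + h x)) UNIV"
    by (rule smooth_on_divide[OF open_UNIV s(1) smooth_on_add[OF open_UNIV s(1) h(1)]])
       (use pos in \<open>simp add: less_imp_neq[symmetric]\<close>)
  then show ?thesis
  proof (rule that)
    fix x
    show "0 \<le> s x / (s x + h x)" "s x / (s x + h x) \<le> 1"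
      using pos[of x] s(2)[of x] h(2)[of x] by (simp_all add: divide_simps)
    show "s x / (s x + h x) = 0 \<longleftrightarrow> x \<in> C" using pos[of x] s(3)[of x] by (simp)
    assume "x \<notin> {a - 1..b + 1}"
    then have "h x = 0" using h(2,3)[of x] by (auto simp: order_le_less)
    then show "s x / (s x + h x) = 1" using pos[of x] by simp
  qed
qed

section \<open>A null set of full Hausdorff dimension\<close>

definition jump_fun :: "real \<Rightarrow> real" where
  "jump_fun u = (\<Sum>k. (1/2) ^ k / (real k + 1)\<^sup>2 * \<lfloor>2 ^ k * u\<rfloor>)"

lemma summable_inverse_squares: "summable (\<lambda>k. 1 / (real k + 1)\<^sup>2)"
proof -
  have "summable (\<lambda>k. inverse (real (Suc k) ^ 2))"
    using inverse_power_summable[of 2, where 'a=real] by (subst summable_Suc_iff) simp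
  then show ?thesis by (simp add: inverse_eq_divide add.commute)
qed

lemma jump_fun_summable:
  fixes u :: real
  assumes "0 \<le> u" "u < 1"
  shows "summable (\<lambda>k. (1/2) ^ k / (real k + 1)\<^sup>2 * \<lfloor>2 ^ k * u\<rfloor>)"
    "0 \<le> (1/2) ^ k / (real k + 1)\<^sup>2 * \<lfloor>2 ^ k * u\<rfloor>"
    "(1/2) ^ k / (real k + 1)\<^sup>2 * \<lfloor>2 ^ k * u\<rfloor> \<le> 1 / (real k + 1)\<^sup>2"
proof -
  have 0: "0 \<le> real_of_int \<lfloor>2 ^ k * u\<rfloor>" for k using assms by simp
  have 1: "(1/2) ^ k / (real k + 1)\<^sup>2 * \<lfloor>2 ^ k * u\<rfloor> \<le> 1 / (real k + 1)\<^sup>2" for k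
  proof -
    have "real_of_int \<lfloor>2 ^ k * u\<rfloor> \<le> 2 ^ k * u" by linarith
    also have "\<dots> \<le> 2 ^ k" using assms by simp
    finally have "(1/2) ^ k * real_of_int \<lfloor>2 ^ k * u\<rfloor> \<le> (1/2) ^ k * 2 ^ k"
      by (intro mult_left_mono) auto
    also have "\<dots> = 1" by (simp add: power_mult_distrib[symmetric])
    finally show ?thesis by (simp add: divide_right_mono)
  qed
  have 2: "0 \<le> (1/2) ^ k / (real k + 1)\<^sup>2 * \<lfloor>2 ^ k * u\<rfloor>" for k using 0[of k] by simp
  show "summable (\<lambda>k. (1/2) ^ k / (real k + 1)\<^sup>2 * \<lfloor>2 ^ k * u\<rfloor>)"
    by (rule summable_comparison_test[OF _ summable_inverse_squares])
       (use 1 2 in \<open>simp only: real_norm_def abs_of_nonneg, blast\<close>)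
  show "0 \<le> (1/2) ^ k / (real k + 1)\<^sup>2 * \<lfloor>2 ^ k * u\<rfloor>"
    "(1/2) ^ k / (real k + 1)\<^sup>2 * \<lfloor>2 ^ k * u\<rfloor> \<le> 1 / (real k + 1)\<^sup>2" using 1 2 by blast+
qed

lemma jump_fun_bounds:
  assumes "0 \<le> u" "u < 1"
  shows "0 \<le> jump_fun u" "jump_fun u \<le> (\<Sum>k. 1 / (real k + 1)\<^sup>2)"
  unfolding jump_fun_def
  by (rule suminf_nonneg[OF jump_fun_summable(1,2)[OF assms]],
      rule suminf_le[OF jump_fun_summable(3)[OF assms] jump_fun_summable(1)[OF assms] summable_inverse_squares])

text \<open>The witness is the first level k at which the points are at least one grid step 2^-k
  apart. The floor at that level grows by at least 1, and every other level contributes a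
  nonnegative amount.\<close>

lemma jump_fun_gap:
  assumes uv: "0 \<le> u" "u < v" "v < 1"
  obtains k where "v - u \<le> 2 * (1/2) ^ k" "(1/2) ^ k / (real k + 1)\<^sup>2 \<le> jump_fun v - jump_fun u"
proof -
  obtain n where "1 / (v - u) < 2 ^ n" using real_arch_pow[of 2 "1 / (v - u)"] by auto
  then have ex: "1 \<le> 2 ^ n * (v - u)" using uv by (simp add: field_simps)
  define k where "k = (LEAST k. 1 \<le> 2 ^ k * (v - u))"
  have k: "1 \<le> 2 ^ k * (v - u)" unfolding k_def by (rule LeastI[where P="\<lambda>k. 1 \<le> 2 ^ k * (v - u)", OF ex])
  \<comment> \<open>Since \<open>v - u < 1\<close>, level 0 is too coarse. So there is a preceding
    level, and its failure is the upper bound on \<open>v - u\<close>.\<close>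
  have "k \<noteq> 0" using k uv by (intro notI) simp
  then obtain j where j: "k = Suc j" using not0_implies_Suc by blast
  have "\<not> 1 \<le> 2 ^ j * (v - u)"
    using not_less_Least[of j "\<lambda>k. 1 \<le> 2 ^ k * (v - u)"] j unfolding k_def by simp
  then have near: "v - u \<le> 2 * (1/2) ^ k" by (simp add: j field_simps power_divide)
  let ?a = "\<lambda>u k. (1/2) ^ k / (real k + 1)\<^sup>2 * real_of_int \<lfloor>2 ^ k * u\<rfloor>"
  have s: "summable (?a u)" "summable (?a v)" using jump_fun_summable(1) uv by auto
  have "(1/2) ^ k / (real k + 1)\<^sup>2 * 1 \<le> (1/2) ^ k / (real k + 1)\<^sup>2 * (real_of_int \<lfloor>2 ^ k * v\<rfloor> - real_of_int \<lfloor>2 ^ k * u\<rfloor>)"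
  proof (rule mult_left_mono)
    have "2 ^ k * u + 1 \<le> 2 ^ k * v" using k by (simp add: algebra_simps)
    then have "\<lfloor>2 ^ k * u\<rfloor> + 1 \<le> \<lfloor>2 ^ k * v\<rfloor>" by linarith
    then show "1 \<le> real_of_int \<lfloor>2 ^ k * v\<rfloor> - real_of_int \<lfloor>2 ^ k * u\<rfloor>" by linarith
  qed simp
  also have "\<dots> = (\<Sum>i\<in>{k}. ?a v i - ?a u i)" by (simp add: algebra_simps)
  also have "\<dots> \<le> (\<Sum>i. ?a v i - ?a u i)"
  proof (rule sum_le_suminf[OF summable_diff[OF s(2,1)]])
    show "0 \<le> ?a v i - ?a u i" for i
    proof -
      have "real_of_int \<lfloor>2 ^ i * u\<rfloor> \<le> real_of_int \<lfloor>2 ^ i * v\<rfloor>" using uv by (simp add: floor_mono)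
      then have "?a u i \<le> ?a v i" by (rule mult_left_mono) simp
      then show ?thesis by simp
    qed
  qed simp
  also have "\<dots> = jump_fun v - jump_fun u"
    unfolding jump_fun_def by (rule suminf_diff[OF s(2,1), symmetric])
  finally show ?thesis using that near by simp
qed

lemma quadratic_times_geometric_bounded:
  fixes q :: real
  assumes "0 < q" "q < 1"
  obtains B where "0 < B" "\<And>k. (real k + 1)\<^sup>2 * q ^ k \<le> B"
proof -
  define L where "L = - ln q"
  have L: "0 < L" using assms by (simp add: L_def)
  have "filterlim (\<lambda>k. L * real k) at_top sequentially"
    using L by (intro filterlim_tendsto_pos_mult_at_top[OF tendsto_const] filterlim_real_sequentially) auto
  \<comment> \<open>At L k the linear polynomial \<open>[:1, 1 / L:]\<close> takes the value k + 1,
    and exp (- L k) is q^k.\<close>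
  then have "(\<lambda>k. poly ([:1, 1 / L:]\<^sup>2) (L * real k) * exp (- (L * real k))) \<longlonglongrightarrow> 0"
    by (rule filterlim_compose[OF poly_times_exp_neg_tendsto_0])
  moreover have "poly ([:1, 1 / L:]\<^sup>2) (L * real k) * exp (- (L * real k)) = (real k + 1)\<^sup>2 * q ^ k" for k
    using L assms by (simp add: L_def exp_of_nat_mult poly_power add.commute mult.commute[of "ln q"])
  ultimately have "Bseq (\<lambda>k. (real k + 1)\<^sup>2 * q ^ k)"
    by (metis (no_types, lifting) convergentI convergent_imp_Bseq ext)
  then obtain B where "0 < B" "\<And>k. norm ((real k + 1)\<^sup>2 * q ^ k) \<le> B" unfolding Bseq_def by blast
  then show ?thesis using that[of B] by (metis abs_le_D1 real_norm_def)
qed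

lemma jump_fun_expanding:
  assumes t: "1 < t"
  obtains c where "0 < c"
    "\<And>u v. 0 \<le> u \<Longrightarrow> u < 1 \<Longrightarrow> 0 \<le> v \<Longrightarrow> v < 1 \<Longrightarrow> c * \<bar>v - u\<bar> powr t \<le> \<bar>jump_fun v - jump_fun u\<bar>"
proof -
  \<comment> \<open>With this q one has (2 * 2^-k)^t = 2^t q^k 2^-k. Comparing with the gap 2^-k /
    (k+1)^2 asks for a bound B on (k+1)^2 q^k, available because t > 1 means q < 1; then c = 1 / (B
    2^t) works.\<close>
  define q where "q = 2 * (1/2) powr t"
  have "(1/2) powr t < (1/2) powr (1::real)" using t by (intro powr_less_mono') auto
  then have q: "0 < q" "q < 1" by (simp_all add: q_def)
  obtain B where B: "0 < B" "\<And>k. (real k + 1)\<^sup>2 * q ^ k \<le> B"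
    using quadratic_times_geometric_bounded[OF q] by blast
  define c where "c = 1 / (B * 2 powr t)"
  have c: "0 < c" using B by (simp add: c_def)
  have main: "c * (v - u) powr t \<le> jump_fun v - jump_fun u" if uv: "0 \<le> u" "u < v" "v < 1" for u v
  proof -
    obtain k where k: "v - u \<le> 2 * (1/2) ^ k" "(1/2) ^ k / (real k + 1)\<^sup>2 \<le> jump_fun v - jump_fun u"
      using jump_fun_gap[OF uv] by blast
    have "((1/2) ^ k :: real) powr t = ((1/2) powr t) ^ k"
      by (simp add: powr_realpow[symmetric] powr_powr mult.commute)
    then have "2 ^ k * ((1/2) ^ k) powr t = q ^ k" by (simp add: q_def power_mult_distrib)
    then have "(2 * (1/2) ^ k) powr t * 2 ^ k = 2 powr t * q ^ k"
      by (simp add: powr_mult mult.commute mult.left_commute)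
    have "c * (v - u) powr t \<le> c * (2 * (1/2) ^ k) powr t"
      using c k uv t by (intro mult_left_mono powr_mono2) auto
    also have "\<dots> = c * (2 powr t * q ^ k) * (1/2) ^ k"
      using \<open>(2 * (1/2) ^ k) powr t * 2 ^ k = 2 powr t * q ^ k\<close>[symmetric]
      by (simp add: power_mult_distrib[symmetric] mult.assoc)
    also have "\<dots> = q ^ k / B * (1/2) ^ k" by (simp add: c_def)
    also have "\<dots> \<le> 1 / (real k + 1)\<^sup>2 * (1/2) ^ k"
      using B(1) B(2)[of k] by (intro mult_right_mono) (simp_all add: field_simps)
    finally show ?thesis using k(2) by simp
  qed
  show ?thesis
  proof (rule that[OF c])
    fix u v :: real assume "0 \<le> u" "u < 1" "0 \<le> v" "v < 1"
    then show "c * \<bar>v - u\<bar> powr t \<le> \<bar>jump_fun v - jump_fun u\<bar>"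
      using main[of u v] main[of v u] c
      by (cases u v rule: linorder_cases) (fastforce simp: abs_if)+
  qed
qed

text \<open>The comparison point w is \<open>u\<close> rounded down to the grid of mesh 2^-m. Levels
  below m do not distinguish the two, since their floors are integer quotients of the floor at level
  m. At a level k + m the number 2^(k+m) w is an integer, so the floors differ by at most 2^(k+m) (u
  - w), hence by at most 2^k.\<close>

lemma jump_fun_oscillation:
  assumes u: "0 \<le> u" "u < 1"
  shows "jump_fun u \<in> {jump_fun (\<lfloor>2 ^ m * u\<rfloor> / 2 ^ m) ..
    jump_fun (\<lfloor>2 ^ m * u\<rfloor> / 2 ^ m) + (1/2) ^ m * (\<Sum>k. 1 / (real (k + m) + 1)\<^sup>2)}"
proof -
  define w :: real where "w = \<lfloor>2 ^ m * u\<rfloor> / 2 ^ m"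
  have w: "0 \<le> w" "w \<le> u" "u \<le> w + (1/2) ^ m"
  proof -
    show "0 \<le> w" using u by (simp add: w_def)
    have "real_of_int \<lfloor>2 ^ m * u\<rfloor> \<le> 2 ^ m * u" "2 ^ m * u \<le> real_of_int \<lfloor>2 ^ m * u\<rfloor> + 1" by linarith+
    then show "w \<le> u" "u \<le> w + (1/2) ^ m" by (simp_all add: w_def field_simps power_divide)
  qed
  let ?a = "\<lambda>u k. (1/2) ^ k / (real k + 1)\<^sup>2 * real_of_int \<lfloor>2 ^ k * u\<rfloor>"
  have s: "summable (?a u)" "summable (?a w)" using jump_fun_summable(1) u w by auto
  define d where "d k = ?a u k - ?a w k" for k
  have sd: "summable d" unfolding d_def by (rule summable_diff[OF s])
  have d0: "0 \<le> d k" for k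
  proof -
    have "real_of_int \<lfloor>2 ^ k * w\<rfloor> \<le> real_of_int \<lfloor>2 ^ k * u\<rfloor>" using w by (simp add: floor_mono)
    then have "?a w k \<le> ?a u k" by (rule mult_left_mono) simp
    then show ?thesis by (simp add: d_def)
  qed
  have low: "d k = 0" if "k < m" for k
  proof -
    have e: "2 ^ k * x = 2 ^ m * x / real_of_int (2 ^ (m - k))" for x :: real
    proof -
      have "(2::real) ^ m = 2 ^ k * 2 ^ (m - k)" using that by (simp add: power_add[symmetric])
      then show ?thesis by simp
    qed
    have f: "\<lfloor>2 ^ k * x\<rfloor> = \<lfloor>2 ^ m * x\<rfloor> div 2 ^ (m - k)" for x :: real
      unfolding e by (rule floor_divide_real_eq_div) simp
    have "\<lfloor>2 ^ m * w\<rfloor> = \<lfloor>2 ^ m * u\<rfloor>" by (simp add: w_def)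
    then have "\<lfloor>2 ^ k * u\<rfloor> = \<lfloor>2 ^ k * w\<rfloor>" unfolding f by simp
    then show ?thesis by (simp add: d_def)
  qed
  have high: "d (k + m) \<le> (1/2) ^ m * (1 / (real (k + m) + 1)\<^sup>2)" for k
  proof -
    have "2 ^ (k + m) * w = 2 ^ k * real_of_int \<lfloor>2 ^ m * u\<rfloor>" by (simp add: w_def power_add)
    also have "\<dots> = real_of_int (2 ^ k * \<lfloor>2 ^ m * u\<rfloor>)" by simp
    finally have e: "2 ^ (k + m) * w = real_of_int (2 ^ k * \<lfloor>2 ^ m * u\<rfloor>)" .
    have "real_of_int \<lfloor>2 ^ (k + m) * w\<rfloor> = 2 ^ (k + m) * w" unfolding e floor_of_int ..
    moreover have "real_of_int \<lfloor>2 ^ (k + m) * u\<rfloor> \<le> 2 ^ (k + m) * u" by (rule of_int_floor_le)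
    ultimately have "real_of_int \<lfloor>2 ^ (k + m) * u\<rfloor> - real_of_int \<lfloor>2 ^ (k + m) * w\<rfloor> \<le> 2 ^ (k + m) * (u - w)"
      unfolding right_diff_distrib by linarith
    also have "\<dots> \<le> 2 ^ (k + m) * (1/2) ^ m" using w by (intro mult_left_mono) auto
    finally have le: "real_of_int \<lfloor>2 ^ (k + m) * u\<rfloor> - real_of_int \<lfloor>2 ^ (k + m) * w\<rfloor> \<le> 2 ^ (k + m) * (1/2) ^ m" .
    have "d (k + m) = (1/2) ^ (k + m) / (real (k + m) + 1)\<^sup>2 *
        (real_of_int \<lfloor>2 ^ (k + m) * u\<rfloor> - real_of_int \<lfloor>2 ^ (k + m) * w\<rfloor>)"
      unfolding d_def by (simp add: right_diff_distrib)
    also have "\<dots> \<le> (1/2) ^ (k + m) / (real (k + m) + 1)\<^sup>2 * (2 ^ (k + m) * (1/2) ^ m)"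
      using le by (rule mult_left_mono) simp
    also have "\<dots> = ((1/2) ^ (k + m) * 2 ^ (k + m)) * ((1/2) ^ m * (1 / (real (k + m) + 1)\<^sup>2))" by simp
    also have "\<dots> = (1/2) ^ m * (1 / (real (k + m) + 1)\<^sup>2)"
      by (simp only: power_mult_distrib[symmetric]) simp
    finally show ?thesis .
  qed
  have sm: "summable (\<lambda>k. 1 / (real (k + m) + 1)\<^sup>2)"
    using summable_ignore_initial_segment[OF summable_inverse_squares, of m] by simp
  have eq: "jump_fun u - jump_fun w = (\<Sum>k. d k)"
    unfolding jump_fun_def d_def by (rule suminf_diff[OF s])
  have "(\<Sum>k. d k) = (\<Sum>k. d (k + m)) + (\<Sum>k<m. d k)" by (rule suminf_split_initial_segment[OF sd])
  also have "\<dots> = (\<Sum>k. d (k + m))" using low by simp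
  also have "\<dots> \<le> (\<Sum>k. (1/2) ^ m * (1 / (real (k + m) + 1)\<^sup>2))"
    by (rule suminf_le[OF high summable_ignore_initial_segment[OF sd] summable_mult[OF sm]])
  also have "\<dots> = (1/2) ^ m * (\<Sum>k. 1 / (real (k + m) + 1)\<^sup>2)" by (rule suminf_mult[OF sm])
  finally show ?thesis using eq suminf_nonneg[OF sd d0] by (simp add: w_def)
qed

text \<open>Each of the 2^m dyadic cells is mapped into a closed interval of length 2^-m
  \<open>\<tau> m\<close>. Their union is finite, hence closed, and so contains the closure as well;
  its measure is at most \<open>\<tau> m\<close>, the tail of a convergent series.\<close>

lemma closure_jump_fun_null: "emeasure lborel (closure (jump_fun ` {0..<1})) = 0"
proof -
  define \<tau> where "\<tau> m = (\<Sum>k. 1 / (real (k + m) + 1)\<^sup>2)" for m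
  have \<tau>0: "0 \<le> \<tau> m" for m unfolding \<tau>_def
    by (rule suminf_nonneg) (use summable_ignore_initial_segment[OF summable_inverse_squares, of m] in auto)
  have lim: "\<tau> \<longlonglongrightarrow> 0"
  proof -
    have "\<tau> m = (\<Sum>k. 1 / (real k + 1)\<^sup>2) - (\<Sum>k<m. 1 / (real k + 1)\<^sup>2)" for m
      unfolding \<tau>_def by (rule suminf_minus_initial_segment[OF summable_inverse_squares])
    then have "\<tau> = (\<lambda>m. (\<Sum>k. 1 / (real k + 1)\<^sup>2) - (\<Sum>k<m. 1 / (real k + 1)\<^sup>2))" by blast
    moreover have "(\<lambda>m. (\<Sum>k. 1 / (real k + 1)\<^sup>2) - (\<Sum>k<m. 1 / (real k + 1)\<^sup>2))
        \<longlonglongrightarrow> (\<Sum>k. 1 / (real k + 1)\<^sup>2) - (\<Sum>k. 1 / (real k + 1)\<^sup>2)"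
      by (intro tendsto_diff tendsto_const summable_LIMSEQ summable_inverse_squares)
    ultimately show ?thesis by simp
  qed
  have le: "emeasure lborel (closure (jump_fun ` {0..<1})) \<le> ennreal (\<tau> m)" for m
  proof -
    define I where "I j = {jump_fun (real j / 2 ^ m) .. jump_fun (real j / 2 ^ m) + (1/2) ^ m * \<tau> m}" for j :: nat
    have "jump_fun ` {0..<1} \<subseteq> (\<Union>j\<in>{..<2 ^ m}. I j)"
    proof (rule image_subsetI)
      fix u :: real assume "u \<in> {0..<1}"
      then have u: "0 \<le> u" "u < 1" by auto
      have j: "real (nat \<lfloor>2 ^ m * u\<rfloor>) = real_of_int \<lfloor>2 ^ m * u\<rfloor>" using u by simp
      have "real_of_int \<lfloor>2 ^ m * u\<rfloor> \<le> 2 ^ m * u" by linarith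
      also have "\<dots> < 2 ^ m" using u by simp
      finally have "real (nat \<lfloor>2 ^ m * u\<rfloor>) < real (2 ^ m)" unfolding j by simp
      then have "nat \<lfloor>2 ^ m * u\<rfloor> \<in> {..<2 ^ m}" unfolding of_nat_less_iff by simp
      moreover have "jump_fun u \<in> I (nat \<lfloor>2 ^ m * u\<rfloor>)"
        unfolding I_def j \<tau>_def by (rule jump_fun_oscillation[OF u])
      ultimately show "jump_fun u \<in> (\<Union>j\<in>{..<2 ^ m}. I j)" by blast
    qed
    then have "closure (jump_fun ` {0..<1}) \<subseteq> (\<Union>j\<in>{..<2 ^ m}. I j)"
      by (rule closure_minimal) (auto intro!: closed_UN simp: I_def)
    then have "emeasure lborel (closure (jump_fun ` {0..<1})) \<le> emeasure lborel (\<Union>j\<in>{..<2 ^ m}. I j)"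
      by (rule emeasure_mono) (auto simp: I_def)
    also have "\<dots> \<le> (\<Sum>j<2 ^ m. emeasure lborel (I j))"
      by (rule emeasure_subadditive_finite) (auto simp: I_def)
    also have "\<dots> = (\<Sum>j<(2::nat) ^ m. ennreal ((1/2) ^ m * \<tau> m))"
      using \<tau>0[of m] by (simp add: I_def)
    also have "\<dots> = ennreal (2 ^ m * ((1/2) ^ m * \<tau> m))"
      using \<tau>0[of m] by (simp add: ennreal_mult' ennreal_of_nat_eq_real_of_nat ennreal_power[symmetric])
    also have "2 ^ m * ((1/2) ^ m * \<tau> m) = \<tau> m" by (simp add: power_divide)
    finally show ?thesis .
  qed
  have "(\<lambda>m. ennreal (\<tau> m)) \<longlonglongrightarrow> ennreal 0" by (rule tendsto_ennrealI[OF lim])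
  then have "emeasure lborel (closure (jump_fun ` {0..<1})) \<le> ennreal 0"
    by (rule tendsto_lowerbound) (simp_all add: le)
  then show ?thesis by simp
qed

section \<open>Lower bounds for Hausdorff measure and dimension\<close>

text \<open>In a cover of \<open>K\<close>, the part of \<open>K\<close> in a piece of diameter D is
  sent by \<open>P\<close> into a ball of radius A D^(s/n), where n is the dimension of the target;
  its volume is a constant times D^s. So the sum for any cover at scale 1 is at least a fixed
  multiple of the Lebesgue measure of \<open>Q\<close>.\<close>

lemma hausdorff_measure_nonzero:
  fixes P :: "'a \<Rightarrow> 'b::euclidean_space"
  assumes s: "0 < s" and A: "0 < A"
    and holder: "\<And>x y. x \<in> K \<Longrightarrow> y \<in> K \<Longrightarrow> d x y < \<infinity> \<Longrightarrow>
      norm (P x - P y) \<le> A * enn2real (d x y) powr (s / DIM('b))"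
    and Q: "Q \<in> sets lborel" "Q \<subseteq> P ` K" "0 < emeasure lborel Q"
  shows "hausdorff_measure d s K \<noteq> 0"
proof
  assume 0: "hausdorff_measure d s K = 0"
  define c where "c = unit_ball_vol (real DIM('b)) * A ^ DIM('b)"
  have c: "0 < c" using A by (simp add: c_def unit_ball_vol_pos)
  have bound: "emeasure lborel Q \<le> ennreal c * (\<Sum>i. ennreal (enn2real (ediameter d (C i)) powr s))"
    if C: "K \<subseteq> (\<Union>i. C i)" "\<And>i. ediameter d (C i) \<le> ennreal 1" for C :: "nat \<Rightarrow> 'a set"
  proof -
    define D where "D i = enn2real (ediameter d (C i))" for i
    define p where "p i = (SOME x. x \<in> C i \<inter> K)" for i
    \<comment> \<open>The ball is centred at the image of a point of \<open>K\<close>. For pieces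
      that miss \<open>K\<close> the choice \<open>p i\<close> is meaningless, and the empty set is
      used.\<close>
    define B where "B i = (if C i \<inter> K = {} then {} else cball (P (p i)) (A * D i powr (s / DIM('b))))" for i
    have PB: "P x \<in> B i" if "x \<in> C i" "x \<in> K" for x i
    proof -
      have p: "p i \<in> C i \<inter> K" unfolding p_def by (rule someI[of _ x]) (use that in blast)
      have "(p i, x) \<in> C i \<times> C i" using p that by blast
      from SUP_upper[OF this, of "\<lambda>(x, y). d x y"] have le: "d (p i) x \<le> ediameter d (C i)"
        by (simp add: ediameter_def)
      \<comment> \<open>Finiteness matters because \<open>enn2real\<close> sends \<open>top\<close>
        to 0.\<close>
      have fin: "ediameter d (C i) < top" using C(2)[of i] ennreal_less_top le_less_trans by blast
      then have "d (p i) x < \<infinity>" using le by (simp add: le_less_trans)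
      then have "norm (P (p i) - P x) \<le> A * enn2real (d (p i) x) powr (s / DIM('b))"
        using p that by (intro holder) auto
      also have "\<dots> \<le> A * D i powr (s / DIM('b))"
        unfolding D_def using A s enn2real_mono[OF le fin] by (intro mult_left_mono powr_mono2) auto
      finally have "P x \<in> cball (P (p i)) (A * D i powr (s / DIM('b)))" by (simp add: dist_norm)
      then show ?thesis using that by (auto simp: B_def)
    qed
    have "Q \<subseteq> (\<Union>i. B i)"
    proof
      fix q assume "q \<in> Q"
      then obtain x where x: "x \<in> K" "q = P x" using Q(2) by auto
      obtain i where "x \<in> C i" using C(1) x(1) by auto
      then show "q \<in> (\<Union>i. B i)" using PB[OF _ x(1)] x(2) by auto
    qed
    then have "emeasure lborel Q \<le> emeasure lborel (\<Union>i. B i)"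
      by (rule emeasure_mono) (auto simp: B_def)
    also have "\<dots> \<le> (\<Sum>i. emeasure lborel (B i))"
      by (rule emeasure_subadditive_countably) (auto simp: B_def)
    also have "\<dots> \<le> (\<Sum>i. ennreal c * ennreal (D i powr s))"
    proof (rule suminf_le)
      fix i
      have "(D i powr (s / DIM('b))) ^ DIM('b) = D i powr s"
        using s by (cases "D i = 0") (simp_all add: powr_power)
      then have "unit_ball_vol (real DIM('b)) * (A * D i powr (s / DIM('b))) ^ DIM('b) = c * D i powr s"
        by (simp add: c_def power_mult_distrib)
      then show "emeasure lborel (B i) \<le> ennreal c * ennreal (D i powr s)"
        using A c by (simp add: B_def emeasure_cball ennreal_mult)
    qed auto
    also have "\<dots> = ennreal c * (\<Sum>i. ennreal (D i powr s))" by (rule ennreal_suminf_cmult)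
    finally show ?thesis by (simp add: D_def)
  qed
  \<comment> \<open>\<open>Q\<close> may have infinite measure; a finite positive lower bound is
    enough for the contradiction.\<close>
  obtain r where r: "0 < r" "ennreal r \<le> emeasure lborel Q"
  proof (cases "emeasure lborel Q")
    case (real r)
    then show ?thesis using that[of r] Q(3) by (auto simp: ennreal_less_zero_iff)
  next
    case top
    then show ?thesis using that[of 1] by simp
  qed
  have "hausdorff_premeasure d s 1 K \<le> hausdorff_measure d s K"
    unfolding hausdorff_measure_def by (rule SUP_upper) simp
  then have "hausdorff_premeasure d s 1 K < ennreal (r / c)" using 0 r c by simp
  then obtain C :: "nat \<Rightarrow> 'a set" where C: "K \<subseteq> (\<Union>i. C i)" "\<And>i. ediameter d (C i) \<le> ennreal 1"
    and less: "(\<Sum>i. ennreal (enn2real (ediameter d (C i)) powr s)) < ennreal (r / c)"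
    unfolding hausdorff_premeasure_def Inf_less_iff by blast
  have "ennreal c * (\<Sum>i. ennreal (enn2real (ediameter d (C i)) powr s)) < ennreal c * ennreal (r / c)"
    using less c by (intro ennreal_mult_strict_left_mono) auto
  also have "\<dots> = ennreal r" using c r by (simp add: ennreal_mult[symmetric])
  finally show False using bound[OF C] r(2) by (meson leD order_trans)
qed

lemma hausdorff_dim_not_less:
  assumes "\<And>s. 0 < s \<Longrightarrow> s < n \<Longrightarrow> hausdorff_measure d s K \<noteq> 0"
  shows "\<not> hausdorff_dim d K < ennreal n"
proof
  assume "hausdorff_dim d K < ennreal n"
  then obtain s where "0 < s" "hausdorff_measure d s K = 0" "ennreal s < ennreal n"
    unfolding hausdorff_dim_def Inf_less_iff by blast
  then show False using assms[of s] by (auto simp: ennreal_less_iff)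
qed

definition jump_vec :: "real ^ 'n \<Rightarrow> real ^ 'n" where
  "jump_vec w = (\<chi> i. jump_fun (w $ i))"

definition half_open_cube :: "(real ^ 'n) set" where
  "half_open_cube = {w. \<forall>i. 0 \<le> w $ i \<and> w $ i < 1}"

lemma half_open_cube_measure:
  "(half_open_cube :: (real ^ 'n) set) \<in> sets lborel" "0 < emeasure lborel (half_open_cube :: (real ^ 'n) set)"
proof -
  have "(half_open_cube :: (real ^ 'n) set) = (\<Inter>i. {w. 0 \<le> w $ i} \<inter> {w. w $ i < 1})"
    by (auto simp: half_open_cube_def)
  also have "\<dots> \<in> sets borel"
    by (intro sets.finite_INT sets.Int borel_closed borel_open closed_halfspace_component_ge_cart
        open_halfspace_component_lt_cart) auto
  finally show m: "(half_open_cube :: (real ^ 'n) set) \<in> sets lborel" by simp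
  have "(0 :: ennreal) < emeasure lborel (box 0 (1 :: real ^ 'n))"
    by (auto simp: emeasure_lborel_box_eq Basis_vec_def inner_axis prod_nonneg intro!: prod_pos)
  also have "\<dots> \<le> emeasure lborel (half_open_cube :: (real ^ 'n) set)"
    by (rule emeasure_mono[OF _ m]) (auto simp: half_open_cube_def mem_box_cart less_imp_le)
  finally show "0 < emeasure lborel (half_open_cube :: (real ^ 'n) set)" .
qed

lemma jump_vec_inverse_holder:
  fixes s :: real
  assumes s: "0 < s" "s < CARD('n)"
  obtains A where "0 < A"
    "\<And>v w :: real ^ 'n. v \<in> half_open_cube \<Longrightarrow> w \<in> half_open_cube \<Longrightarrow>
      norm (v - w) \<le> A * norm (jump_vec v - jump_vec w) powr (s / CARD('n))"
proof -
  \<comment> \<open>With this choice 1/t is the Hoelder exponent s/n, and s < n is the same as t >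
    1.\<close>
  define t where "t = CARD('n) / s"
  have t: "1 < t" "1 / t = s / CARD('n)" using s by (simp_all add: t_def)
  obtain c where c: "0 < c"
    "\<And>u v. 0 \<le> u \<Longrightarrow> u < 1 \<Longrightarrow> 0 \<le> v \<Longrightarrow> v < 1 \<Longrightarrow> c * \<bar>v - u\<bar> powr t \<le> \<bar>jump_fun v - jump_fun u\<bar>"
    using jump_fun_expanding[OF t(1)] by metis
  define A where "A = CARD('n) * (1 / c) powr (1 / t)"
  show ?thesis
  proof (rule that[of A])
    show "0 < A" using c by (simp add: A_def)
    fix v w :: "real ^ 'n" assume vw: "v \<in> half_open_cube" "w \<in> half_open_cube"
    let ?N = "norm (jump_vec v - jump_vec w)"
    have comp: "\<bar>(v - w) $ i\<bar> \<le> (1 / c) powr (1 / t) * ?N powr (1 / t)" for i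
    proof -
      have "c * \<bar>v $ i - w $ i\<bar> powr t \<le> \<bar>jump_fun (v $ i) - jump_fun (w $ i)\<bar>"
        using vw by (intro c(2)) (auto simp: half_open_cube_def)
      also have "\<dots> = \<bar>(jump_vec v - jump_vec w) $ i\<bar>" by (simp add: jump_vec_def)
      also have "\<dots> \<le> ?N" by (rule component_le_norm_cart)
      finally have "\<bar>v $ i - w $ i\<bar> powr t \<le> 1 / c * ?N" using c(1) by (simp add: field_simps)
      then have "(\<bar>v $ i - w $ i\<bar> powr t) powr (1 / t) \<le> (1 / c * ?N) powr (1 / t)"
        using t(1) by (intro powr_mono2) auto
      also have "(\<bar>v $ i - w $ i\<bar> powr t) powr (1 / t) = \<bar>v $ i - w $ i\<bar>"
        using t(1) by (simp add: powr_powr)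
      also have "(1 / c * ?N) powr (1 / t) = (1 / c) powr (1 / t) * ?N powr (1 / t)" by (rule powr_mult)
      finally show ?thesis by simp
    qed
    have "norm (v - w) \<le> (\<Sum>i\<in>UNIV. \<bar>(v - w) $ i\<bar>)" by (rule norm_le_l1_cart)
    also have "\<dots> \<le> (\<Sum>i\<in>(UNIV::'n set). (1 / c) powr (1 / t) * ?N powr (1 / t))" by (rule sum_mono[OF comp])
    also have "\<dots> = A * ?N powr (s / CARD('n))" by (simp add: A_def t(2))
    finally show "norm (v - w) \<le> A * ?N powr (s / CARD('n))" .
  qed
qed

section \<open>The sphere by stereographic projections\<close>

text \<open>The matrix of the inner product pulled back by \<open>T\<close>: the first fundamental
  form when \<open>T\<close> is the differential of an immersion.\<close>

definition gram :: "(real ^ 'n \<Rightarrow> 'a::euclidean_space) \<Rightarrow> real ^ 'n ^ 'n" where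
  "gram T = (\<chi> i j. T (axis i 1) \<bullet> T (axis j 1))"

lemma linear_axis_expansion:
  fixes T :: "real ^ 'n \<Rightarrow> 'a::real_vector"
  assumes "linear T"
  shows "T v = (\<Sum>i\<in>UNIV. v $ i *\<^sub>R T (axis i 1))"
proof -
  have "T v = T (\<Sum>i\<in>UNIV. v $ i *s axis i 1)" by (simp only: basis_expansion)
  also have "\<dots> = (\<Sum>i\<in>UNIV. v $ i *\<^sub>R T (axis i 1))"
    by (simp add: linear_sum[OF assms] linear_scale[OF assms] scalar_mult_eq_scaleR)
  finally show ?thesis .
qed

lemma inner_gram:
  assumes "linear T"
  shows "v \<bullet> (gram T *v w) = T v \<bullet> T w"
proof -
  have "T v \<bullet> T w = (\<Sum>i\<in>UNIV. v $ i *\<^sub>R T (axis i 1)) \<bullet> (\<Sum>j\<in>UNIV. w $ j *\<^sub>R T (axis j 1))"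
    by (subst linear_axis_expansion[OF assms, of v], subst linear_axis_expansion[OF assms, of w]) (rule refl)
  also have "\<dots> = (\<Sum>i\<in>UNIV. v $ i * (T (axis i 1) \<bullet> (\<Sum>j\<in>UNIV. w $ j *\<^sub>R T (axis j 1))))"
    unfolding inner_sum_left inner_scaleR_left ..
  also have "\<dots> = (\<Sum>i\<in>UNIV. v $ i * (\<Sum>j\<in>UNIV. (T (axis i 1) \<bullet> T (axis j 1)) * w $ j))"
    unfolding inner_sum_right inner_scaleR_right by (simp only: mult.commute)
  also have "\<dots> = v \<bullet> (gram T *v w)"
    by (simp add: gram_def inner_vec_def matrix_vector_mult_def)
  finally show ?thesis by simp
qed

text \<open>This becomes the transformation law of the induced metric. The matrices are compared
  through their bilinear forms.\<close>

lemma gram_compose: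
  fixes L :: "real ^ 'n \<Rightarrow> real ^ 'n"
  assumes "linear T" "linear L"
  shows "gram (\<lambda>v. T (L v)) = transpose (matrix L) ** gram T ** matrix L"
proof -
  have lin: "linear (\<lambda>v. T (L v))" using linear_compose[OF assms(2,1)] by (simp add: o_def)
  have "v \<bullet> (gram (\<lambda>v. T (L v)) *v w) = v \<bullet> ((transpose (matrix L) ** gram T ** matrix L) *v w)" for v w
  proof -
    have "v \<bullet> ((transpose (matrix L) ** gram T ** matrix L) *v w)
        = v \<bullet> (transpose (matrix L) *v (gram T *v (matrix L *v w)))"
      by (simp add: matrix_vector_mul_assoc[symmetric] matrix_mul_assoc)
    also have "\<dots> = (matrix L *v v) \<bullet> (gram T *v (matrix L *v w))"
      by (simp only: dot_lmul_matrix[symmetric] vector_transpose_matrix)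
    also have "\<dots> = T (L v) \<bullet> T (L w)" using inner_gram[OF assms(1)] assms(2) by (simp add: matrix_works)
    finally show ?thesis using inner_gram[OF lin] by simp
  qed
  then show ?thesis by (metis matrix_eq vector_eq_rdot inner_commute)
qed

text \<open>The matrix is written as a combination of the matrix units
  \<open>axis i (axis j 1)\<close>, so that the closure rules for sums and products apply.\<close>

lemma smooth_on_gram:
  fixes T :: "real ^ 'n \<Rightarrow> real ^ 'n \<Rightarrow> 'a::euclidean_space"
  assumes "open S" "\<And>v. smooth_on (\<lambda>p. T p v) S"
  shows "smooth_on (\<lambda>p. gram (T p)) S"
proof -
  have "smooth_on (\<lambda>p. \<Sum>i\<in>UNIV. \<Sum>j\<in>UNIV. (T p (axis i 1) \<bullet> T p (axis j 1)) *\<^sub>R axis i (axis j (1::real))) S"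
    by (intro smooth_on_sum smooth_on_scaleR smooth_on_inner smooth_on_const assms)
  moreover have "(\<Sum>i\<in>UNIV. \<Sum>j\<in>UNIV. (T p (axis i 1) \<bullet> T p (axis j 1)) *\<^sub>R axis i (axis j (1::real))) = gram (T p)" for p
  proof -
    have "(\<Sum>i\<in>UNIV. \<Sum>j\<in>UNIV. a i j *\<^sub>R axis i (axis j (1::real))) $ k $ l = a k l" for a :: "'n \<Rightarrow> 'n \<Rightarrow> real" and k l
    proof -
      have "(\<Sum>j\<in>UNIV. a i j * (axis i (axis j (1::real)) $ k $ l)) = (if i = k then a i l else 0)" for i
        by (cases "i = k") (simp_all add: axis_def if_distrib[of "(*) _"] cong: if_cong)
      then show ?thesis by simp
    qed
    then show ?thesis by (simp only: vec_eq_iff gram_def vec_lambda_beta) blast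
  qed
  ultimately show ?thesis by simp
qed

text \<open>\<open>J\<close> places R^n x R linearly into an ambient space and \<open>J'\<close> is
  a left inverse of it. \<open>J\<close> need not be an isometry: the embedded surface is in general
  an ellipsoid, and only the metric inherited from the ambient space is used. The sort
  \<open>wellorder\<close> is passed on from the change of variables theorem.\<close>

locale stereographic =
  fixes J :: "(real ^ 'n::{finite, wellorder}) \<times> real \<Rightarrow> 'a::euclidean_space"
    and J' :: "'a \<Rightarrow> (real ^ 'n::{finite, wellorder}) \<times> real"
  assumes bl_J: "bounded_linear J" and bl_J': "bounded_linear J'" and J'_J: "J' (J z) = z"
begin

definition sphere_set :: "'a set" where
  "sphere_set = J ` {(a, b). a \<bullet> a + b * b = 1}"

definition pole :: "real \<Rightarrow> 'a" where
  "pole s = J (0, s)"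

text \<open>Inverse of the stereographic projection from the pole \<open>s\<close>. The height
  (|u|^2 - 1) / (|u|^2 + 1) is written as 1 - 2 / (1 + |u|^2), so that one fraction governs both
  components.\<close>

definition param :: "real \<Rightarrow> (real, 'n) vec \<Rightarrow> 'a" where
  "param s u = J ((2 / (1 + u \<bullet> u)) *\<^sub>R u, s * (1 - 2 / (1 + u \<bullet> u)))"

definition coord :: "real \<Rightarrow> 'a \<Rightarrow> (real, 'n) vec" where
  "coord s z = (1 / (1 - s * snd (J' z))) *\<^sub>R fst (J' z)"

text \<open>An open set of the ambient space, not of the sphere: \<open>coord\<close> is smooth
  there in the ordinary sense, and smoothness between charts reduces to compositions of maps on open
  subsets of Euclidean spaces.\<close>

definition coord_dom :: "real \<Rightarrow> 'a set" where
  "coord_dom s = {z. s * snd (J' z) \<noteq> 1}"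

definition punctured :: "real \<Rightarrow> 'a set" where
  "punctured s = sphere_set - {pole s}"

definition sphere_top :: "'a topology" where
  "sphere_top = top_of_set sphere_set"

definition atlas :: "('a, 'n) chart set" where
  "atlas = (\<lambda>s. (punctured s, coord s)) ` {1, -1}"

definition metric :: "('a, 'n) metric_coeffs" where
  "metric c p = gram (frechet_derivative (inv_into (fst c) (snd c)) (at p))"

lemma topspace_sphere_top [simp]: "topspace sphere_top = sphere_set"
  by (simp add: sphere_top_def)

lemma sphere_set_iff: "z \<in> sphere_set \<longleftrightarrow> (\<exists>a b. z = J (a, b) \<and> a \<bullet> a + b * b = 1)"
  by (auto simp: sphere_set_def)

lemma sphere_setI: "a \<bullet> a + b * b = 1 \<Longrightarrow> J (a, b) \<in> sphere_set"
  by (auto simp: sphere_set_def)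

lemma compact_sphere_set: "compact sphere_set"
  unfolding sphere_set_def
proof (rule compact_continuous_image[OF linear_continuous_on[OF bl_J]])
  have "{(a :: (real, 'n) vec, b :: real). a \<bullet> a + b * b = 1} = sphere 0 1"
    by (auto simp: norm_Pair dot_square_norm power2_eq_square)
  then show "compact {(a :: (real, 'n) vec, b :: real). a \<bullet> a + b * b = 1}" by simp
qed

lemma pole_in: "s \<in> {1, -1} \<Longrightarrow> pole s \<in> sphere_set"
  unfolding sphere_set_iff pole_def by (intro exI[of _ 0] exI[of _ s]) auto

lemma one_plus_inner_pos: "0 < 1 + u \<bullet> (u :: (real, 'n) vec)"
  using inner_ge_zero[of u] by linarith

lemma param_in_sphere:
  assumes "s \<in> {1, -1}" shows "param s u \<in> sphere_set"
proof -
  define q where "q = u \<bullet> u"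
  have q: "0 < 1 + q" using one_plus_inner_pos by (simp add: q_def)
  define c where "c = 2 / (1 + q)"
  have "1 + q \<noteq> 0" using q by simp
  then have "c * (1 + q) = 2" unfolding c_def by (rule nonzero_eq_divide_eq[THEN iffD1, OF _ refl])
  moreover have "c * c * q + (1 - c) * (1 - c) = 1 - 2 * c + c * (c * (1 + q))" by (simp add: algebra_simps)
  ultimately have "c * c * q + (1 - c) * (1 - c) = 1" by simp
  moreover have "(c *\<^sub>R u) \<bullet> (c *\<^sub>R u) = c * c * q" by (simp add: q_def)
  moreover have "(s * (1 - c)) * (s * (1 - c)) = (1 - c) * (1 - c)" using assms by auto
  ultimately show ?thesis
    unfolding param_def q_def[symmetric] c_def[symmetric] by (intro sphere_setI) argo
qed

lemma punctured_eq: "s \<in> {1, -1} \<Longrightarrow> punctured s = sphere_set \<inter> coord_dom s"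
proof -
  assume s: "s \<in> {1, -1}"
  have "z = pole s \<longleftrightarrow> s * snd (J' z) = 1" if z: "z \<in> sphere_set" for z
  proof -
    obtain a b where ab: "z = J (a, b)" "a \<bullet> a + b * b = 1" using z sphere_set_iff by blast
    have "z = pole s \<longleftrightarrow> (a, b) = (0, s)" using ab J'_J by (metis pole_def)
    also have "\<dots> \<longleftrightarrow> s * b = 1"
    proof
      assume "s * b = 1"
      then have "b = s" using s by auto
      then have "a \<bullet> a = 0" using ab s by auto
      then show "(a, b) = (0, s)" using \<open>b = s\<close> by simp
    qed (use s in auto)
    finally show ?thesis using ab J'_J by simp
  qed
  then show ?thesis by (auto simp: punctured_def coord_dom_def)
qed

lemma open_coord_dom: "open (coord_dom s)"
proof -
  have "continuous_on UNIV (\<lambda>z. s * snd (J' z))"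
    by (intro continuous_intros linear_continuous_on bl_J')
  then have "open ((\<lambda>z. s * snd (J' z)) -` (-{1}))" by (rule open_vimage[rotated]) auto
  then show ?thesis by (simp add: coord_dom_def vimage_def)
qed

lemma coord_param: "s \<in> {1, -1} \<Longrightarrow> coord s (param s u) = u"
  using one_plus_inner_pos[of u] by (auto simp: coord_def param_def J'_J)

lemma param_in_punctured:
  assumes "s \<in> {1, -1}" shows "param s u \<in> punctured s"
proof -
  have "s * snd (J' (param s u)) = 1 - 2 / (1 + u \<bullet> u)" using assms by (auto simp: param_def J'_J)
  moreover have "2 / (1 + u \<bullet> u) \<noteq> 0" using one_plus_inner_pos[of u] by simp
  ultimately show ?thesis using param_in_sphere[OF assms] by (simp add: punctured_eq[OF assms] coord_dom_def)
qed

lemma param_coord: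
  assumes s: "s \<in> {1, -1}" and z: "z \<in> punctured s"
  shows "param s (coord s z) = z"
proof -
  obtain a b where ab: "z = J (a, b)" "a \<bullet> a + b * b = 1"
    using z punctured_def sphere_set_iff by auto
  define c where "c = s * b"
  have c: "c \<noteq> 1" using z ab by (auto simp: punctured_eq[OF s] coord_dom_def J'_J c_def)
  have bc: "b = s * c" "b * b = c * c" using s by (auto simp: c_def)
  have u: "coord s z = (1 / (1 - c)) *\<^sub>R a" by (simp add: coord_def ab J'_J c_def)
  have aa: "a \<bullet> a = (1 - c) * (1 + c)" using ab(2) unfolding bc(2) by (simp add: algebra_simps)
  have "coord s z \<bullet> coord s z = (1 + c) / (1 - c)"
    unfolding u inner_scaleR_left inner_scaleR_right aa using c by simp
  then have "1 + coord s z \<bullet> coord s z = 2 / (1 - c)"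
    using c by (simp add: field_simps)
  then have q: "2 / (1 + coord s z \<bullet> coord s z) = 1 - c" by simp
  have 1: "(1 - c) *\<^sub>R coord s z = a" using c by (simp add: u)
  have 2: "s * (1 - (1 - c)) = b" using bc by simp
  show ?thesis unfolding param_def q 1 2 by (rule ab(1)[symmetric])
qed

lemma coord_image:
  assumes "s \<in> {1, -1}" shows "coord s ` (punctured s \<inter> V) = {p. param s p \<in> V}"
proof (intro equalityI subsetI)
  show "p \<in> coord s ` (punctured s \<inter> V)" if "p \<in> {p. param s p \<in> V}" for p
    by (rule image_eqI[of _ _ "param s p"]) (use that coord_param[OF assms] param_in_punctured[OF assms] in auto)
qed (auto simp: param_coord[OF assms])

lemma inv_into_coord:
  assumes "s \<in> {1, -1}" shows "inv_into (punctured s) (coord s) = param s"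
proof
  fix p
  have "inj_on (coord s) (punctured s)" using param_coord[OF assms] by (metis inj_onI)
  then show "inv_into (punctured s) (coord s) p = param s p"
    by (rule inv_into_f_eq) (use param_in_punctured[OF assms] coord_param[OF assms] in auto)
qed

text \<open>The change of chart is the inversion in the unit sphere, which turns a neighbourhood of
  infinity into a neighbourhood of the origin.\<close>

lemma param_inversion:
  assumes "u \<noteq> 0" shows "param s u = param (-s) (inverse (u \<bullet> u) *\<^sub>R u)"
proof -
  define q where "q = u \<bullet> u"
  have q: "0 < q" using assms by (simp add: q_def)
  have i: "(inverse q *\<^sub>R u) \<bullet> (inverse q *\<^sub>R u) = inverse q" using q by (simp add: q_def[symmetric])
  have 1: "2 / (1 + inverse q) = 2 * q / (1 + q)" using q by (simp add: field_simps)
  have 2: "- s * (1 - 2 * q / (1 + q)) = s * (1 - 2 / (1 + q))" using q by (simp add: field_simps)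
  have 3: "(2 * q / (1 + q)) *\<^sub>R (inverse q *\<^sub>R u) = (2 / (1 + q)) *\<^sub>R u" using q by (simp add: divide_inverse)
  show ?thesis unfolding param_def q_def[symmetric] i 1 2 3 ..
qed

lemma param_0: "param s 0 = pole (-s)"
  by (simp add: param_def pole_def)

lemma smooth_on_param: "smooth_on (param s) UNIV"
proof -
  have d: "smooth_on (\<lambda>u :: (real, 'n) vec. 2 / (1 + u \<bullet> u)) UNIV"
    by (intro smooth_on_divide smooth_on_add smooth_on_inner smooth_on_id smooth_on_const open_UNIV)
       (metis one_plus_inner_pos less_irrefl)
  show ?thesis
    unfolding param_def
    by (intro smooth_on_linear_compose[OF bl_J] smooth_on_Pair smooth_on_scaleR smooth_on_mult smooth_on_diff
        smooth_on_id smooth_on_const d open_UNIV)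
qed

lemma smooth_on_coord: "smooth_on (coord s) (coord_dom s)"
proof -
  note o = open_coord_dom[of s]
  have l: "smooth_on (\<lambda>z. fst (J' z)) (coord_dom s)" "smooth_on (\<lambda>z. snd (J' z)) (coord_dom s)"
    by (intro smooth_on_linear o bounded_linear_compose[OF bounded_linear_fst bl_J']
        bounded_linear_compose[OF bounded_linear_snd bl_J'])+
  show ?thesis unfolding coord_def
    by (intro smooth_on_scaleR smooth_on_divide smooth_on_diff smooth_on_mult smooth_on_const o l)
       (simp add: coord_dom_def)
qed

lemma transition_eq:
  assumes "s \<in> {1, -1}"
  shows "transition (punctured s, coord s) (punctured t, coord t) = (\<lambda>p. coord t (param s p))"
  by (simp add: transition_def inv_into_coord[OF assms] o_def)

lemma open_param_preimage: "open {p. param s p \<in> coord_dom t}"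
  using open_vimage[OF open_coord_dom smooth_on_continuous[OF smooth_on_param]] by (simp add: vimage_def)

lemma param_in_punctured_iff:
  "s \<in> {1, -1} \<Longrightarrow> t \<in> {1, -1} \<Longrightarrow> param s p \<in> punctured t \<longleftrightarrow> param s p \<in> coord_dom t"
  using param_in_sphere by (simp add: punctured_eq)

lemma smooth_on_transition:
  "smooth_on (\<lambda>p. coord t (param s p)) {p. param s p \<in> coord_dom t}"
  by (rule smooth_on_compose[OF smooth_on_coord smooth_on_subset[OF smooth_on_param]])
     (use open_param_preimage in auto)

lemma atlas_cases:
  assumes "c \<in> atlas"
  obtains s where "s \<in> {1, -1}" "c = (punctured s, coord s)"
  using assms by (auto simp: atlas_def)

lemma is_chart_atlas:
  assumes s: "s \<in> {1, -1}" shows "is_chart sphere_top (punctured s, coord s)"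
proof -
  have im: "coord s ` punctured s = UNIV" using coord_image[OF s, of UNIV] by simp
  have op: "openin sphere_top (punctured s)"
    unfolding sphere_top_def punctured_eq[OF s] by (intro openin_open_Int open_coord_dom)
  have sub: "subtopology sphere_top (punctured s) = top_of_set (punctured s)"
    unfolding sphere_top_def punctured_def by (simp add: subtopology_subtopology Int_absorb1)
  have "continuous_on (punctured s) (coord s)"
    by (rule continuous_on_subset[OF smooth_on_continuous[OF smooth_on_coord]]) (simp add: punctured_eq[OF s])
  then have "homeomorphic_maps (top_of_set (punctured s)) euclidean (coord s) (param s)"
    unfolding homeomorphic_maps_def
    using smooth_on_continuous[OF smooth_on_param] coord_param[OF s] param_coord[OF s] param_in_punctured[OF s]
    by (auto simp: continuous_map_in_subtopology)
  then show ?thesis unfolding is_chart_def using op im sub by (auto simp: homeomorphic_map_maps)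
qed

lemma Union_punctured: "punctured 1 \<union> punctured (-1) = sphere_set"
proof -
  have "pole 1 \<noteq> pole (-1)" unfolding pole_def using J'_J by (metis one_neq_neg_one prod.inject)
  then show ?thesis by (auto simp: punctured_def)
qed

lemma smooth_manifold_sphere: "smooth_manifold sphere_top atlas"
proof -
  obtain B :: "'a set set" where "countable B" "topological_basis B" using ex_countable_basis by blast
  then have "second_countable (euclidean :: 'a topology)"
    unfolding second_countable_def open_openin[symmetric] by (metis topological_basis_open topological_basisE)
  then have "second_countable sphere_top" unfolding sphere_top_def by (rule second_countable_subtopology)
  moreover have "smooth_on (transition c c') (snd c ` (fst c \<inter> fst c'))" if c: "c \<in> atlas" "c' \<in> atlas" for c c'
  proof -
    obtain s where s: "s \<in> {1, -1}" "c = (punctured s, coord s)" using atlas_cases[OF c(1)] .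
    obtain t where t: "t \<in> {1, -1}" "c' = (punctured t, coord t)" using atlas_cases[OF c(2)] .
    show ?thesis unfolding s t fst_conv snd_conv transition_eq[OF s(1)] coord_image[OF s(1)]
      using smooth_on_transition param_in_punctured_iff[OF s(1) t(1)] by simp
  qed
  moreover have "(\<Union>c\<in>atlas. fst c) = sphere_set" using Union_punctured by (auto simp: atlas_def)
  ultimately show ?thesis unfolding smooth_manifold_def
    using is_chart_atlas
    by (auto elim: atlas_cases simp: sphere_top_def Hausdorff_space_subtopology)
qed

text \<open>Smoothness into the ambient space suffices, since the target chart is smooth on an open
  ambient set. Continuity of \<open>h\<close> follows too, because the two punctured spheres are
  open in the sphere and cover it.\<close>

lemma smooth_self_mapI:
  assumes M: "h ` sphere_set \<subseteq> sphere_set"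
    and sm: "\<And>s. s \<in> {1, -1} \<Longrightarrow> smooth_on (\<lambda>p. h (param s p)) UNIV"
  shows "smooth_self_map sphere_top atlas h"
proof -
  have cont: "continuous_on (punctured s) h" if s: "s \<in> {1, -1}" for s
  proof -
    have "continuous_on (punctured s) (\<lambda>z. h (param s (coord s z)))"
      by (rule continuous_on_compose2[OF smooth_on_continuous[OF sm[OF s]]
            continuous_on_subset[OF smooth_on_continuous[OF smooth_on_coord]]])
         (simp_all add: punctured_eq[OF s])
    then show ?thesis by (rule continuous_on_eq) (simp add: param_coord[OF s])
  qed
  have op: "openin (top_of_set (punctured 1 \<union> punctured (-1))) (punctured s)" if "s \<in> {1, -1}" for s
    unfolding Union_punctured punctured_eq[OF that] by (intro openin_open_Int open_coord_dom)
  have "continuous_on (punctured 1 \<union> punctured (-1)) h"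
    by (intro continuous_on_Un_local_open op cont) auto
  then have c: "continuous_map sphere_top sphere_top h"
    using M by (auto simp: sphere_top_def continuous_map_in_subtopology Union_punctured)
  moreover have "smooth_on (coord t \<circ> h \<circ> inv_into (punctured s) (coord s)) (coord s ` (punctured s \<inter> h -` punctured t))"
    if s: "s \<in> {1, -1}" and t: "t \<in> {1, -1}" for s t
  proof -
    have "{p. param s p \<in> h -` punctured t} = (\<lambda>p. h (param s p)) -` coord_dom t"
      using M param_in_sphere[OF s] by (auto simp: punctured_eq[OF t])
    moreover have "open \<dots>"
      by (rule open_vimage[OF open_coord_dom smooth_on_continuous[OF sm[OF s]]])
    moreover have "smooth_on (\<lambda>p. coord t (h (param s p))) ((\<lambda>p. h (param s p)) -` coord_dom t)"
      by (rule smooth_on_compose[OF smooth_on_coord smooth_on_subset[OF sm[OF s]]]) (use calculation in auto)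
    ultimately show ?thesis
      by (simp add: coord_image[OF s] inv_into_coord[OF s] o_def)
  qed
  ultimately show ?thesis unfolding smooth_self_map_def by (auto simp: atlas_def)
qed

lemma metric_eq:
  "s \<in> {1, -1} \<Longrightarrow> metric (punctured s, coord s) p = gram (frechet_derivative (param s) (at p))"
  by (simp add: metric_def inv_into_coord)

lemma param_has_derivative: "(param s has_derivative frechet_derivative (param s) (at p)) (at p)"
  by (rule smooth_on_has_derivative[OF smooth_on_param]) simp

lemma transition_has_derivative:
  assumes "param s p \<in> coord_dom t"
  shows "((\<lambda>p. coord t (param s p)) has_derivative frechet_derivative (\<lambda>p. coord t (param s p)) (at p)) (at p)"
  by (rule smooth_on_has_derivative[OF smooth_on_transition]) (use assms in simp)

lemma linear_frechet_param: "linear (frechet_derivative (param s) (at p))"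
  using has_derivative_linear[OF param_has_derivative] .

text \<open>Differentiating \<open>coord s (param s p) = p\<close> gives a left inverse of the
  differential. Injectivity yields positive definiteness of the metric.\<close>

lemma frechet_param_injective:
  assumes s: "s \<in> {1, -1}" and v: "frechet_derivative (param s) (at p) v = 0"
  shows "v = 0"
proof -
  have "param s p \<in> coord_dom s" using param_in_punctured[OF s] by (simp add: punctured_eq[OF s])
  then have "(coord s has_derivative frechet_derivative (coord s) (at (param s p))) (at (param s p))"
    by (rule smooth_on_has_derivative[OF smooth_on_coord])
  from diff_chain_at[OF param_has_derivative this]
  have "((\<lambda>p. p) has_derivative (\<lambda>v. frechet_derivative (coord s) (at (param s p)) (frechet_derivative (param s) (at p) v))) (at p)"
    by (simp add: o_def coord_param[OF s])
  then have "(\<lambda>v. v) = (\<lambda>v. frechet_derivative (coord s) (at (param s p)) (frechet_derivative (param s) (at p) v))"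
    using has_derivative_unique has_derivative_ident by blast
  then have "v = frechet_derivative (coord s) (at (param s p)) 0" using v by metis
  also have "\<dots> = 0"
    using linear_0[OF has_derivative_linear[OF smooth_on_has_derivative[OF smooth_on_coord]]]
      \<open>param s p \<in> coord_dom s\<close> by blast
  finally show ?thesis .
qed

lemma frechet_param_transition:
  assumes s: "s \<in> {1, -1}" and t: "t \<in> {1, -1}" and p: "param s p \<in> coord_dom t"
  shows "frechet_derivative (param s) (at p) =
    (\<lambda>v. frechet_derivative (param t) (at (coord t (param s p)))
      (frechet_derivative (\<lambda>p. coord t (param s p)) (at p) v))"
proof -
  let ?D = "\<lambda>v. frechet_derivative (param t) (at (coord t (param s p)))
      (frechet_derivative (\<lambda>p. coord t (param s p)) (at p) v)"
  have "((\<lambda>p. param t (coord t (param s p))) has_derivative ?D) (at p)"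
    using diff_chain_at[OF transition_has_derivative[OF p] param_has_derivative] by (simp add: o_def)
  then have "(param s has_derivative ?D) (at p)"
  proof (rule has_derivative_transform_within_open[OF _ open_param_preimage])
    show "p \<in> {p. param s p \<in> coord_dom t}" using p by simp
    show "param t (coord t (param s q)) = param s q" if "q \<in> {p. param s p \<in> coord_dom t}" for q
      by (rule param_coord[OF t]) (use that param_in_punctured_iff[OF s t] in simp)
  qed
  from frechet_derivative_at[OF this] show ?thesis by simp
qed

lemma metric_transform:
  assumes s: "s \<in> {1, -1}" and t: "t \<in> {1, -1}" and p: "param s p \<in> coord_dom t"
  shows "metric (punctured s, coord s) p =
    transpose (matrix (frechet_derivative (\<lambda>p. coord t (param s p)) (at p))) **
      metric (punctured t, coord t) (coord t (param s p)) **
      matrix (frechet_derivative (\<lambda>p. coord t (param s p)) (at p))"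
  unfolding metric_eq[OF s] metric_eq[OF t] frechet_param_transition[OF s t p]
  by (rule gram_compose[OF linear_frechet_param has_derivative_linear[OF transition_has_derivative[OF p]]])

lemma riemannian_metric_sphere: "riemannian_metric atlas metric"
  unfolding riemannian_metric_def
proof (intro conjI ballI)
  fix c assume "c \<in> atlas"
  then obtain s where s: "s \<in> {1, -1}" "c = (punctured s, coord s)" by (rule atlas_cases)
  have im: "snd c ` fst c = UNIV" using coord_image[OF s(1), of UNIV] s by simp
  have "smooth_on (\<lambda>p. gram (frechet_derivative (param s) (at p))) UNIV"
    by (intro smooth_on_gram smooth_on_frechet_derivative smooth_on_param open_UNIV)
  moreover have "metric c = (\<lambda>p. gram (frechet_derivative (param s) (at p)))"
    unfolding s(2) by (rule ext) (rule metric_eq[OF s(1)])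
  ultimately show "smooth_on (metric c) (snd c ` fst c)" by (simp only: im)
  fix p
  show "transpose (metric c p) = metric c p"
    unfolding s(2) metric_eq[OF s(1)] by (simp add: gram_def transpose_def inner_commute)
  show "\<forall>v. v \<noteq> 0 \<longrightarrow> 0 < v \<bullet> (metric c p *v v)"
    unfolding s(2) metric_eq[OF s(1)] inner_gram[OF linear_frechet_param]
    using frechet_param_injective[OF s(1)] by (metis inner_gt_zero_iff)
next
  fix c c' p assume c: "c \<in> atlas" "c' \<in> atlas" and p: "p \<in> snd c ` (fst c \<inter> fst c')"
  obtain s where s: "s \<in> {1, -1}" "c = (punctured s, coord s)" using atlas_cases[OF c(1)] .
  obtain t where t: "t \<in> {1, -1}" "c' = (punctured t, coord t)" using atlas_cases[OF c(2)] .
  have "param s p \<in> coord_dom t"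
    using p coord_image[OF s(1), of "punctured t"] param_in_punctured_iff[OF s(1) t(1)] by (simp add: s t)
  from metric_transform[OF s(1) t(1) this]
  show "metric c p = transpose (jacobian (transition c c') (at p)) ** metric c' (transition c c' p)
      ** jacobian (transition c c') (at p)"
    by (simp add: s(2) t(2) transition_eq[OF s(1)] jacobian_def)
qed

lemma compact_riemannian_manifold_sphere: "compact_riemannian_manifold sphere_top atlas metric"
  unfolding compact_riemannian_manifold_def
  using smooth_manifold_sphere riemannian_metric_sphere compact_sphere_set
  by (simp add: sphere_top_def compact_space_subtopology)

end

section \<open>Volume and distance on the sphere\<close>

text \<open>The change of variables theorem applied below is about vector-valued functions, so
  scalar ones are passed through \<open>real ^ 1\<close>.\<close>

lemma nn_integral_eq_integral_vec1:
  fixes f :: "'a::euclidean_space \<Rightarrow> real"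
  assumes "(\<lambda>x. vec (f x) :: real ^ 1) absolutely_integrable_on A" "\<And>x. x \<in> A \<Longrightarrow> 0 \<le> f x"
  shows "(\<integral>\<^sup>+x\<in>A. ennreal (f x) \<partial>lborel) = ennreal (integral A (\<lambda>x. vec (f x) :: real ^ 1) $ 1)"
proof -
  have i: "(\<lambda>x. vec (f x) :: real ^ 1) integrable_on A"
    using assms(1) by (rule set_lebesgue_integral_eq_integral(1))
  have "((\<lambda>x. (vec (f x) :: real ^ 1) $ 1) has_integral integral A (\<lambda>x. vec (f x) :: real ^ 1) $ 1) A"
    using has_integral_linear[OF integrable_integral[OF i] bounded_linear_vec_nth[of 1]] by (simp add: o_def)
  then show ?thesis using assms(2) by (intro nn_integral_has_integral_lebesgue') simp_all
qed

lemma absolutely_integrable_vec1: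
  fixes f :: "'a::euclidean_space \<Rightarrow> real"
  assumes "A \<in> sets borel" "(\<lambda>x. indicator A x * f x) \<in> borel_measurable borel" "\<And>x. x \<in> A \<Longrightarrow> 0 \<le> f x"
    and fin: "(\<integral>\<^sup>+x\<in>A. ennreal (f x) \<partial>lborel) < \<infinity>"
  shows "(\<lambda>x. vec (f x) :: real ^ 1) absolutely_integrable_on A"
proof -
  have eq: "indicator A x *\<^sub>R (vec (f x) :: real ^ 1) = (indicator A x * f x) *\<^sub>R vec 1" for x
    by (simp add: vec_eq_iff)
  have "(\<integral>\<^sup>+x. ennreal (norm (indicator A x * f x)) \<partial>lborel) = (\<integral>\<^sup>+x\<in>A. ennreal (f x) \<partial>lborel)"
    by (rule nn_integral_cong) (use assms(3) in \<open>auto simp: indicator_def\<close>)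
  then have "integrable lborel (\<lambda>x. indicator A x * f x)"
    using fin assms(2) by (simp add: integrable_iff_bounded)
  then have "integrable lebesgue (\<lambda>x. indicator A x * f x)" by (simp add: integrable_completion assms(2))
  then show ?thesis unfolding set_integrable_def eq by (rule integrable_scaleR_left)
qed

text \<open>The theorem for absolutely integrable functions includes an equivalence of
  integrability, so if one side is infinite, so is the other. The function \<open>h\<close> agrees
  with the Jacobian expression only on \<open>S\<close>; measurability is asked of \<open>h\<close>
  and not of \<open>g'\<close>.\<close>

lemma nn_integral_change_of_variables:
  fixes g :: "(real, 'n::{finite, wellorder}) vec \<Rightarrow> (real, 'n) vec" and f :: "(real, 'n) vec \<Rightarrow> real"
  assumes S: "S \<in> sets borel" and gS: "g ` S \<in> sets borel"
    and der: "\<And>x. x \<in> S \<Longrightarrow> (g has_derivative g' x) (at x)" and inj: "inj_on g S"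
    and nonneg: "\<And>y. 0 \<le> f y" and f: "f \<in> borel_measurable borel"
    and h: "h \<in> borel_measurable borel" "\<And>x. x \<in> S \<Longrightarrow> h x = \<bar>det (matrix (g' x))\<bar> * f (g x)"
  shows "(\<integral>\<^sup>+y\<in>g ` S. ennreal (f y) \<partial>lborel) = (\<integral>\<^sup>+x\<in>S. ennreal (h x) \<partial>lborel)"
proof -
  let ?F = "\<lambda>x. vec (f x) :: real ^ 1" and ?H = "\<lambda>x. vec (h x) :: real ^ 1"
  let ?G = "\<lambda>x. \<bar>det (matrix (g' x))\<bar> *\<^sub>R (vec (f (g x)) :: real ^ 1)"
  have h0: "0 \<le> h x" if "x \<in> S" for x using h(2)[OF that] nonneg by simp
  have GH: "?G x = ?H x" if "x \<in> S" for x using h(2)[OF that] by (simp add: vec_eq_iff)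
  have Sl: "S \<in> sets lebesgue" using S by auto
  have cv: "(?G absolutely_integrable_on S \<and> integral S ?G = b) \<longleftrightarrow>
      (?F absolutely_integrable_on (g ` S) \<and> integral (g ` S) ?F = b)" for b
    by (rule has_absolute_integral_change_of_variables[OF Sl has_derivative_at_withinI[OF der] inj])
  have "?G absolutely_integrable_on S \<longleftrightarrow> ?H absolutely_integrable_on S"
    by (rule set_integrable_cong) (use GH in auto)
  moreover have "integral S ?G = integral S ?H" by (rule integral_cong) (rule GH)
  ultimately have cv: "(?H absolutely_integrable_on S \<and> integral S ?H = b) \<longleftrightarrow>
      (?F absolutely_integrable_on (g ` S) \<and> integral (g ` S) ?F = b)" for b
    using cv by simp
  show ?thesis
  proof (cases "?H absolutely_integrable_on S")
    case True
    then have F: "?F absolutely_integrable_on (g ` S)" and eq: "integral (g ` S) ?F = integral S ?H" using cv by blast+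
    show ?thesis
      using nn_integral_eq_integral_vec1[OF True h0] nn_integral_eq_integral_vec1[OF F nonneg] eq by simp
  next
    case False
    then have "\<not> ?F absolutely_integrable_on (g ` S)" using cv by blast
    then have "\<not> (\<integral>\<^sup>+y\<in>g ` S. ennreal (f y) \<partial>lborel) < \<infinity>"
      using absolutely_integrable_vec1[OF gS _ nonneg] gS f by auto
    moreover have "\<not> (\<integral>\<^sup>+x\<in>S. ennreal (h x) \<partial>lborel) < \<infinity>"
      using absolutely_integrable_vec1[OF S _ h0] S h(1) False by auto
    ultimately show ?thesis by (simp add: not_less top_unique)
  qed
qed

lemma det_borel_measurable:
  fixes A :: "'b::topological_space \<Rightarrow> real ^ 'n ^ 'n"
  assumes "continuous_on UNIV A"
  shows "(\<lambda>x. det (A x)) \<in> borel_measurable borel"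
proof -
  have "continuous_on UNIV (\<lambda>x. det (A x))"
    unfolding det_def
    by (intro continuous_on_sum continuous_on_mult continuous_on_prod continuous_on_const continuous_on_component assms)
  then show ?thesis by (rule borel_measurable_continuous_onI)
qed

lemma space_borel_of_topology [simp]: "space (borel_of_topology X) = topspace X"
  by (simp add: borel_of_topology_def space_measure_of_conv)

lemma sets_borel_of_topology: "sets (borel_of_topology X) = sigma_sets (topspace X) {U. openin X U}"
  unfolding borel_of_topology_def by (rule sets_measure_of) (auto dest: openin_subset)

lemma openin_borel_of_topology: "openin X U \<Longrightarrow> U \<in> sets (borel_of_topology X)"
  by (simp add: sets_borel_of_topology sigma_sets.Basic)

lemma measurable_borel_of_topologyI:
  assumes "f \<in> space M \<rightarrow> topspace X" "\<And>U. openin X U \<Longrightarrow> f -` U \<inter> space M \<in> sets M"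
  shows "f \<in> M \<rightarrow>\<^sub>M borel_of_topology X"
  unfolding borel_of_topology_def
  by (rule measurable_measure_of) (use assms in \<open>auto dest: openin_subset[THEN subsetD]\<close>)

section \<open>Riemannian volume of the sphere\<close>

context stereographic
begin

text \<open>The maximum makes the density nonnegative without an argument about the sign of the
  determinant; \<open>ennreal\<close> cuts off negative values in the same way.\<close>

definition volume_density :: "real \<Rightarrow> (real, 'n) vec \<Rightarrow> real" where
  "volume_density s p = max 0 (sqrt (det (metric (punctured s, coord s) p)))"

text \<open>One chart suffices, because it misses only a single point, and a point has Riemannian
  volume zero.\<close>

definition volume :: "'a measure" where
  "volume = distr (density lborel (\<lambda>p. ennreal (volume_density 1 p))) (borel_of_topology sphere_top) (param 1)"

lemma volume_density_borel: "s \<in> {1, -1} \<Longrightarrow> volume_density s \<in> borel_measurable borel"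
proof -
  assume s: "s \<in> {1, -1}"
  have "continuous_on UNIV (\<lambda>p. gram (frechet_derivative (param s) (at p)))"
    by (intro smooth_on_continuous smooth_on_gram smooth_on_frechet_derivative smooth_on_param open_UNIV)
  from det_borel_measurable[OF this] show ?thesis
    unfolding volume_density_def metric_eq[OF s] by measurable
qed

lemma param_measurable:
  assumes s: "s \<in> {1, -1}"
  shows "param s \<in> lborel \<rightarrow>\<^sub>M borel_of_topology sphere_top"
proof (rule measurable_borel_of_topologyI)
  show "param s \<in> space lborel \<rightarrow> topspace sphere_top" using param_in_sphere[OF s] by simp
  fix U assume "openin sphere_top U"
  then obtain T where T: "open T" "U = sphere_set \<inter> T" by (auto simp: sphere_top_def openin_open)
  have "param s -` U = param s -` T" using T(2) param_in_sphere[OF s] by auto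
  then show "param s -` U \<inter> space lborel \<in> sets lborel"
    using open_vimage[OF T(1) smooth_on_continuous[OF smooth_on_param]] by simp
qed

lemma param_vimage_borel:
  "s \<in> {1, -1} \<Longrightarrow> E \<in> sets (borel_of_topology sphere_top) \<Longrightarrow> {p. param s p \<in> E} \<in> sets borel"
  using measurable_sets[OF param_measurable] by (simp add: vimage_def)

lemma emeasure_volume:
  assumes "E \<in> sets (borel_of_topology sphere_top)"
  shows "emeasure volume E = (\<integral>\<^sup>+p\<in>{p. param 1 p \<in> E}. ennreal (volume_density 1 p) \<partial>lborel)"
proof -
  have [measurable]: "volume_density 1 \<in> borel_measurable borel" by (rule volume_density_borel) simp
  have m: "param 1 \<in> density lborel (\<lambda>p. ennreal (volume_density 1 p)) \<rightarrow>\<^sub>M borel_of_topology sphere_top"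
    using param_measurable[of 1] by simp
  have "emeasure volume E = emeasure (density lborel (\<lambda>p. ennreal (volume_density 1 p))) {p. param 1 p \<in> E}"
    unfolding volume_def by (simp add: emeasure_distr[OF m assms] vimage_def)
  also have "\<dots> = (\<integral>\<^sup>+p\<in>{p. param 1 p \<in> E}. ennreal (volume_density 1 p) \<partial>lborel)"
    by (rule emeasure_density) (use param_vimage_borel[OF _ assms, of 1] in simp_all)
  finally show ?thesis .
qed

lemma volume_density_transition:
  assumes p: "param (-1) p \<in> coord_dom 1"
  shows "volume_density (-1) p =
    \<bar>det (matrix (frechet_derivative (\<lambda>p. coord 1 (param (-1) p)) (at p)))\<bar> *
      volume_density 1 (coord 1 (param (-1) p))"
proof -
  have s: "(-1::real) \<in> {1, -1}" "(1::real) \<in> {1, -1}" by simp_all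
  have "max 0 (sqrt (d * m * d)) = \<bar>d\<bar> * max 0 (sqrt m)" for d m :: real
  proof -
    have "d * m * d = (d * d) * m" by simp
    then have "sqrt (d * m * d) = sqrt (d * d) * sqrt m" by (simp only: real_sqrt_mult)
    then have "sqrt (d * m * d) = \<bar>d\<bar> * sqrt m" unfolding real_sqrt_abs2 .
    then show ?thesis by (simp add: max_mult_distrib_left)
  qed
  then show ?thesis
    unfolding volume_density_def metric_transform[OF s p] by (simp add: det_mul det_transpose)
qed

lemma volume_chart_minus:
  assumes E: "E \<in> sets (borel_of_topology sphere_top)" "E \<subseteq> punctured (-1)"
  shows "emeasure volume E = (\<integral>\<^sup>+p\<in>{p. param (-1) p \<in> E}. ennreal (volume_density (-1) p) \<partial>lborel)"
proof -
  have s: "(-1::real) \<in> {1, -1}" "(1::real) \<in> {1, -1}" by simp_all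
  let ?\<tau> = "\<lambda>p. coord 1 (param (-1) p)"
  \<comment> \<open>The origin is the coordinate of \<open>pole 1\<close> in the chart
    \<open>-1\<close>, the only point of that chart which the chart \<open>1\<close> misses. Without
    it the transition map is defined on all of \<open>B\<close>; at the end it is put back as a null
    set.\<close>
  define B where "B = {p. param (-1) p \<in> E} - {0}"
  have B: "B \<in> sets borel" unfolding B_def using param_vimage_borel[OF s(1) E(1)] by (intro sets.Diff) auto
  have ne: "param (-1) p \<in> punctured 1 \<longleftrightarrow> p \<noteq> 0" for p
  proof -
    have "param (-1) p = pole 1 \<longleftrightarrow> p = 0" using param_0[of "-1"] coord_param[OF s(1)] by (metis minus_minus)
    then show ?thesis using param_in_sphere[OF s(1)] by (simp add: punctured_def)
  qed
  have im: "?\<tau> ` B = {p. param 1 p \<in> E}"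
  proof (intro equalityI subsetI)
    fix p assume "p \<in> ?\<tau> ` B"
    then obtain q where "q \<in> B" "p = ?\<tau> q" by blast
    then show "p \<in> {p. param 1 p \<in> E}" using ne param_coord[OF s(2)] by (simp add: B_def)
  next
    fix p assume p: "p \<in> {p. param 1 p \<in> E}"
    define q where "q = coord (-1) (param 1 p)"
    have q: "param (-1) q = param 1 p" unfolding q_def using p E(2) by (intro param_coord[OF s(1)]) auto
    then have "q \<noteq> 0" using ne[of q] param_in_punctured[OF s(2), of p] by simp
    then have "q \<in> B" using p q by (simp add: B_def)
    moreover have "p = ?\<tau> q" unfolding q using coord_param[OF s(2)] by simp
    ultimately show "p \<in> ?\<tau> ` B" by blast
  qed
  have inj: "inj_on ?\<tau> B"
  proof (rule inj_onI)
    fix p q assume "p \<in> B" "q \<in> B" "?\<tau> p = ?\<tau> q"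
    then have "param (-1) p = param (-1) q" using ne param_coord[OF s(2)] by (metis B_def Diff_iff singletonI)
    then show "p = q" using coord_param[OF s(1)] by metis
  qed
  have dom: "param (-1) p \<in> coord_dom 1" if "p \<in> B" for p
    using ne[of p] that punctured_eq[OF s(2)] by (simp add: B_def)
  have "(\<integral>\<^sup>+p\<in>?\<tau> ` B. ennreal (volume_density 1 p) \<partial>lborel) = (\<integral>\<^sup>+p\<in>B. ennreal (volume_density (-1) p) \<partial>lborel)"
  proof (rule nn_integral_change_of_variables[OF B _ transition_has_derivative[OF dom] inj])
    show "?\<tau> ` B \<in> sets borel" unfolding im by (rule param_vimage_borel[OF s(2) E(1)])
    show "0 \<le> volume_density 1 y" for y by (simp add: volume_density_def)
  qed (use volume_density_borel volume_density_transition[OF dom] in auto)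
  also have "\<dots> = (\<integral>\<^sup>+p\<in>{p. param (-1) p \<in> E}. ennreal (volume_density (-1) p) \<partial>lborel)"
    by (rule nn_integral_cong_AE, rule AE_mp[OF AE_lborel_singleton[of 0]], rule AE_I2)
       (auto simp: B_def indicator_def)
  finally show ?thesis unfolding im emeasure_volume[OF E(1)] .
qed

lemma is_riemannian_volume_volume: "is_riemannian_volume sphere_top atlas metric volume"
  unfolding is_riemannian_volume_def
proof (intro conjI ballI impI)
  show "space volume = topspace sphere_top" "sets volume = sets (borel_of_topology sphere_top)"
    by (simp_all add: volume_def)
  fix c E assume c: "c \<in> atlas" and E: "E \<in> sets volume" "E \<subseteq> fst c"
  obtain s where s: "s \<in> {1, -1}" "c = (punctured s, coord s)" using atlas_cases[OF c] .
  have E': "E \<in> sets (borel_of_topology sphere_top)" using E(1) by (simp add: volume_def)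
  have im: "snd c ` E = {p. param s p \<in> E}"
    using coord_image[OF s(1), of E] E(2) s(2) by (simp add: Int_absorb1)
  have "emeasure volume E = (\<integral>\<^sup>+p\<in>{p. param s p \<in> E}. ennreal (volume_density s p) \<partial>lborel)"
    using s(1) emeasure_volume[OF E'] volume_chart_minus[OF E'] E(2) s(2) by auto
  then show "emeasure volume E = (\<integral>\<^sup>+p\<in>snd c ` E. ennreal (sqrt (det (metric c p))) \<partial>lborel)"
    unfolding im by (simp add: volume_density_def s(2) ennreal_max_0)
qed

lemma AE_volumeI:
  assumes "openin sphere_top G" "emeasure lborel {p. param 1 p \<notin> G} = 0" "\<And>z. z \<in> G \<Longrightarrow> P z"
  shows "AE z in volume. P z"
proof (rule AE_I)
  have sp: "space volume = sphere_set" "sets volume = sets (borel_of_topology sphere_top)" by (simp_all add: volume_def)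
  show m: "sphere_set - G \<in> sets volume"
    using openin_borel_of_topology[OF assms(1)] sets.compl_sets[of G volume] sp by simp
  show "{z \<in> space volume. \<not> P z} \<subseteq> sphere_set - G" using assms(3) sp by auto
  have eq: "{p. param 1 p \<in> sphere_set - G} = {p. param 1 p \<notin> G}" using param_in_sphere[of 1] by auto
  have "emeasure volume (sphere_set - G) = (\<integral>\<^sup>+p\<in>{p. param 1 p \<notin> G}. ennreal (volume_density 1 p) \<partial>lborel)"
    using emeasure_volume m sp(2) unfolding eq[symmetric] by simp
  also have "\<dots> = 0"
  proof (rule nn_integral_null_set)
    have "{p. param 1 p \<notin> G} \<in> sets borel"
      using param_vimage_borel[of 1 "sphere_set - G"] m sp(2) unfolding eq by simp
    then show "{p. param 1 p \<notin> G} \<in> null_sets lborel" using assms(2) by (simp add: null_sets_def)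
  qed
  finally show "emeasure volume (sphere_set - G) = 0" .
qed

section \<open>Lengths of curves and Riemannian distance\<close>

lemma C1_differentiable_on_Un_open:
  assumes "open S" "open T" "f C1_differentiable_on S" "f C1_differentiable_on T"
  shows "f C1_differentiable_on (S \<union> T)"
  using assms unfolding C1_differentiable_on_eq by (auto intro: continuous_on_open_Un)

lemma param_C1_compose:
  assumes \<eta>: "\<eta> C1_differentiable_on T"
  shows "(\<lambda>t. param s (\<eta> t)) C1_differentiable_on T"
proof -
  obtain D where D: "\<And>t. t \<in> T \<Longrightarrow> (\<eta> has_vector_derivative D t) (at t)" "continuous_on T D"
    using \<eta> unfolding C1_differentiable_on_def by blast
  have c\<eta>: "continuous_on T \<eta>"
    using has_vector_derivative_continuous[OF D(1)] by (intro continuous_at_imp_continuous_on) blast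
  have "((\<lambda>t. param s (\<eta> t)) has_vector_derivative frechet_derivative (param s) (at (\<eta> t)) (D t)) (at t)"
    if "t \<in> T" for t
    using vector_derivative_diff_chain_within[OF D(1)[OF that] has_derivative_at_withinI[OF param_has_derivative]]
    by (simp add: o_def)
  moreover have "continuous_on T (\<lambda>t. frechet_derivative (param s) (at (\<eta> t)) (D t))"
  proof -
    \<comment> \<open>The derivative varies with both the base point and the vector it is applied
      to; expanding along the axes separates the two dependences.\<close>
    have "continuous_on T (\<lambda>t. D t $ i *\<^sub>R frechet_derivative (param s) (at (\<eta> t)) (axis i 1))" for i
    proof (rule continuous_on_scaleR[OF continuous_on_component[OF D(2)]])
      have "continuous_on UNIV (\<lambda>p. frechet_derivative (param s) (at p) (axis i 1))"
        by (rule smooth_on_continuous[OF smooth_on_frechet_derivative[OF smooth_on_param]])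
      then show "continuous_on T (\<lambda>t. frechet_derivative (param s) (at (\<eta> t)) (axis i 1))"
        by (rule continuous_on_compose2[OF _ c\<eta>]) simp
    qed
    then have "continuous_on T (\<lambda>t. \<Sum>i\<in>UNIV. D t $ i *\<^sub>R frechet_derivative (param s) (at (\<eta> t)) (axis i 1))"
      by (rule continuous_on_sum)
    moreover have "frechet_derivative (param s) (at (\<eta> t)) (D t) =
        (\<Sum>i\<in>UNIV. D t $ i *\<^sub>R frechet_derivative (param s) (at (\<eta> t)) (axis i 1))" for t
      by (rule linear_axis_expansion[OF linear_frechet_param])
    ultimately show ?thesis by presburger
  qed
  ultimately show ?thesis
    unfolding C1_differentiable_on_def
    by (intro exI[of _ "\<lambda>t. frechet_derivative (param s) (at (\<eta> t)) (D t)"] conjI ballI)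
qed

text \<open>The definition speaks only about parameter intervals mapped into one chart. Every
  parameter has such a neighbourhood in [0, 1], and Bolzano's bisection principle glues finitely
  many of them.\<close>

lemma piecewise_C1_curve_imp_C1:
  assumes \<gamma>: "piecewise_C1_curve sphere_top atlas \<gamma>"
  obtains S where "finite S" "\<gamma> C1_differentiable_on ({0<..<1} - S)"
proof -
  have cont: "continuous_on {0..1} \<gamma>" and M: "\<And>t. 0 \<le> t \<Longrightarrow> t \<le> 1 \<Longrightarrow> \<gamma> t \<in> sphere_set"
    using \<gamma> by (auto simp: piecewise_C1_curve_def pathin_def sphere_top_def continuous_map_in_subtopology)
  have pw: "(\<lambda>t. coord s (\<gamma> t)) piecewise_C1_differentiable_on {a..b}"
    if "s \<in> {1, -1}" "0 \<le> a" "a \<le> b" "b \<le> 1" "\<gamma> ` {a..b} \<subseteq> punctured s" for s a b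
    using \<gamma> that unfolding piecewise_C1_curve_def atlas_def o_def by blast
  \<comment> \<open>The bounds 0 and 1 are part of the predicate because the local condition
    concerns all short intervals around a point, also those that leave [0, 1]. The intervals are
    open, so each gluing point joins the exceptional set.\<close>
  have "0 \<le> (0::real) \<and> (1::real) \<le> 1 \<longrightarrow> (\<exists>S. finite S \<and> \<gamma> C1_differentiable_on ({0<..<1} - S))"
  proof (rule Bolzano[where P="\<lambda>a b. 0 \<le> a \<and> b \<le> 1 \<longrightarrow> (\<exists>S. finite S \<and> \<gamma> C1_differentiable_on ({a<..<b} - S))"])
    show "(0::real) \<le> 1" by simp
  next
    fix a b c :: real
    assume ab: "0 \<le> a \<and> b \<le> 1 \<longrightarrow> (\<exists>S. finite S \<and> \<gamma> C1_differentiable_on ({a<..<b} - S))"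
      and bc: "0 \<le> b \<and> c \<le> 1 \<longrightarrow> (\<exists>S. finite S \<and> \<gamma> C1_differentiable_on ({b<..<c} - S))"
      and le: "a \<le> b" "b \<le> c"
    show "0 \<le> a \<and> c \<le> 1 \<longrightarrow> (\<exists>S. finite S \<and> \<gamma> C1_differentiable_on ({a<..<c} - S))"
    proof
      assume "0 \<le> a \<and> c \<le> 1"
      then have "0 \<le> a \<and> b \<le> 1" "0 \<le> b \<and> c \<le> 1" using le by auto
      then obtain S1 S2 where S: "finite S1" "\<gamma> C1_differentiable_on ({a<..<b} - S1)"
        "finite S2" "\<gamma> C1_differentiable_on ({b<..<c} - S2)" using ab bc by blast
      have "open ({a<..<b} - S1)" "open ({b<..<c} - S2)" using S by (auto intro!: open_Diff finite_imp_closed)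
      from C1_differentiable_on_Un_open[OF this S(2,4)]
      have "\<gamma> C1_differentiable_on ({a<..<c} - (S1 \<union> S2 \<union> {b}))"
        by (rule C1_differentiable_on_subset) auto
      then show "\<exists>S. finite S \<and> \<gamma> C1_differentiable_on ({a<..<c} - S)"
        using S by (intro exI[of _ "S1 \<union> S2 \<union> {b}"]) auto
    qed
  next
    fix x :: real assume x: "0 \<le> x" "x \<le> 1"
    then have "\<gamma> x \<in> punctured 1 \<union> punctured (-1)" using M Union_punctured by auto
    then obtain s where s: "s \<in> {1, -1}" "\<gamma> x \<in> punctured s" by auto
    then have "\<gamma> x \<in> coord_dom s" by (simp add: punctured_eq[OF s(1)])
    then obtain e where e: "0 < e" "ball (\<gamma> x) e \<subseteq> coord_dom s"
      using open_coord_dom open_contains_ball by blast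
    obtain d where d: "0 < d" "\<And>t. t \<in> {0..1} \<Longrightarrow> dist t x < d \<Longrightarrow> dist (\<gamma> t) (\<gamma> x) < e"
      using cont x e(1) unfolding continuous_on_iff by (meson atLeastAtMost_iff)
    have "\<exists>S. finite S \<and> \<gamma> C1_differentiable_on ({a<..<b} - S)"
      if ab: "a \<le> x" "x \<le> b" "b - a < d" "0 \<le> a" "b \<le> 1" for a b
    proof -
      have sub: "\<gamma> ` {a..b} \<subseteq> punctured s"
      proof (rule image_subsetI)
        fix t assume t: "t \<in> {a..b}"
        then have "dist (\<gamma> t) (\<gamma> x) < e" using ab by (intro d(2)) (auto simp: dist_real_def)
        then have "\<gamma> t \<in> coord_dom s" using e(2) by (auto simp: dist_commute)
        then show "\<gamma> t \<in> punctured s" using M[of t] t ab by (simp add: punctured_eq[OF s(1)])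
      qed
      have "a \<le> b" using ab by simp
      then obtain S where S: "finite S" "(\<lambda>t. coord s (\<gamma> t)) C1_differentiable_on ({a..b} - S)"
        using pw[OF s(1) ab(4) _ ab(5) sub] unfolding piecewise_C1_differentiable_on_def by blast
      from param_C1_compose[OF S(2)]
      have C: "(\<lambda>t. param s (coord s (\<gamma> t))) C1_differentiable_on ({a<..<b} - S)"
        by (rule C1_differentiable_on_subset) auto
      then obtain D where D: "\<And>t. t \<in> {a<..<b} - S \<Longrightarrow> ((\<lambda>t. param s (coord s (\<gamma> t))) has_vector_derivative D t) (at t)"
        "continuous_on ({a<..<b} - S) D" unfolding C1_differentiable_on_def by blast
      have "(\<gamma> has_vector_derivative D t) (at t)" if "t \<in> {a<..<b} - S" for t
        by (rule has_vector_derivative_transform_within_open[OF D(1)[OF that], of "{a<..<b}"])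
           (use that sub in \<open>auto intro!: param_coord[OF s(1)]\<close>)
      then have "\<gamma> C1_differentiable_on ({a<..<b} - S)" using D(2) unfolding C1_differentiable_on_def by blast
      then show ?thesis using S(1) by blast
    qed
    then show "\<exists>d>0. \<forall>a b. a \<le> x \<and> x \<le> b \<and> b - a < d \<longrightarrow>
        0 \<le> a \<and> b \<le> 1 \<longrightarrow> (\<exists>S. finite S \<and> \<gamma> C1_differentiable_on ({a<..<b} - S))"
      using d(1) by blast
  qed
  then show ?thesis using that by auto
qed

text \<open>In every chart the induced metric returns the norm of the ambient velocity, so the
  arbitrary chart picked by \<open>SOME\<close> does not matter.\<close>

lemma curve_speed_eq:
  assumes \<gamma>: "continuous_on {0..1} \<gamma>" "\<And>t. t \<in> {0..1} \<Longrightarrow> \<gamma> t \<in> sphere_set"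
    and t: "0 < t" "t < 1" and D: "(\<gamma> has_vector_derivative D) (at t)"
  shows "curve_speed atlas metric \<gamma> t = norm D"
proof -
  define c where "c = (SOME c. c \<in> atlas \<and> \<gamma> t \<in> fst c)"
  have "\<gamma> t \<in> punctured 1 \<union> punctured (-1)" using \<gamma>(2)[of t] t unfolding Union_punctured by simp
  then have "\<exists>c. c \<in> atlas \<and> \<gamma> t \<in> fst c" unfolding atlas_def by auto
  then have c: "c \<in> atlas" "\<gamma> t \<in> fst c" unfolding c_def by (rule someI2_ex, blast)+
  obtain s where s: "s \<in> {1, -1}" "c = (punctured s, coord s)" using atlas_cases[OF c(1)] .
  have dom: "\<gamma> t \<in> coord_dom s" using c(2) by (simp add: s punctured_eq[OF s(1)])
  define v where "v = frechet_derivative (coord s) (at (\<gamma> t)) D"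
  have dcoord: "((\<lambda>t. coord s (\<gamma> t)) has_vector_derivative v) (at t)"
    using vector_derivative_diff_chain_within[OF D has_derivative_at_withinI[OF smooth_on_has_derivative[OF smooth_on_coord dom]]]
    by (simp add: o_def v_def)
  have "((\<lambda>t. param s (coord s (\<gamma> t))) has_vector_derivative frechet_derivative (param s) (at (coord s (\<gamma> t))) v) (at t)"
    using vector_derivative_diff_chain_within[OF dcoord has_derivative_at_withinI[OF param_has_derivative]]
    by (simp add: o_def)
  moreover have "open {t \<in> {0<..<1}. \<gamma> t \<in> coord_dom s}"
    using continuous_open_preimage[OF continuous_on_subset[OF \<gamma>(1)] _ open_coord_dom, of "{0<..<1}" s]
    by (simp add: vimage_def Int_def greaterThanLessThan_subseteq_atLeastAtMost_iff)
  ultimately have "(\<gamma> has_vector_derivative frechet_derivative (param s) (at (coord s (\<gamma> t))) v) (at t)"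
  proof (rule has_vector_derivative_transform_within_open)
    show "t \<in> {t \<in> {0<..<1}. \<gamma> t \<in> coord_dom s}" using t dom by simp
    show "param s (coord s (\<gamma> u)) = \<gamma> u" if "u \<in> {t \<in> {0<..<1}. \<gamma> t \<in> coord_dom s}" for u
      by (rule param_coord[OF s(1)]) (use that \<gamma>(2)[of u] in \<open>simp add: punctured_eq[OF s(1)]\<close>)
  qed
  then have eq: "frechet_derivative (param s) (at (coord s (\<gamma> t))) v = D"
    using D vector_derivative_unique_at by blast
  have "curve_speed atlas metric \<gamma> t = sqrt (v \<bullet> (metric c (coord s (\<gamma> t)) *v v))"
    unfolding curve_speed_def c_def[symmetric] Let_def using vector_derivative_at[OF dcoord] s(2) by (simp add: o_def)
  also have "\<dots> = norm D"
    unfolding s(2) metric_eq[OF s(1)] inner_gram[OF linear_frechet_param] eq by (simp add: norm_eq_sqrt_inner)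
  finally show ?thesis .
qed

text \<open>The displacement is the integral of the velocity, by the fundamental theorem of calculus
  off finitely many points, and its norm is at most the integral of the speed.\<close>

lemma curve_length_ge_dist:
  assumes \<gamma>: "piecewise_C1_curve sphere_top atlas \<gamma>"
  shows "ennreal (norm (\<gamma> 1 - \<gamma> 0)) \<le> curve_length atlas metric \<gamma>"
proof -
  have cont: "continuous_on {0..1} \<gamma>" and M: "\<And>t. t \<in> {0..1} \<Longrightarrow> \<gamma> t \<in> sphere_set"
    using \<gamma> by (auto simp: piecewise_C1_curve_def pathin_def sphere_top_def continuous_map_in_subtopology)
  obtain S where S: "finite S" "\<gamma> C1_differentiable_on ({0<..<1} - S)"
    using piecewise_C1_curve_imp_C1[OF \<gamma>] .
  obtain D where D: "\<And>t. t \<in> {0<..<1} - S \<Longrightarrow> (\<gamma> has_vector_derivative D t) (at t)" "continuous_on ({0<..<1} - S) D"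
    using S(2) unfolding C1_differentiable_on_def by blast
  \<comment> \<open>The velocity is continued by 0 from the open set on which it is continuous,
    which makes it Borel measurable on the whole line.\<close>
  define f where "f t = indicator ({0<..<1} - S) t *\<^sub>R D t" for t
  have "({0<..<1} - S) \<in> sets borel" using S(1) by (intro sets.Diff) (auto intro: borel_closed finite_imp_closed)
  then have f: "f \<in> borel_measurable lborel"
    using borel_measurable_continuous_on_indicator[OF _ D(2)] unfolding f_def by simp
  have "(D has_integral \<gamma> 1 - \<gamma> 0) {0..1}"
    by (rule fundamental_theorem_of_calculus_interior_strong[OF S(1) _ D(1) cont]) auto
  then have "(f has_integral \<gamma> 1 - \<gamma> 0) {0..1}"
    by (rule has_integral_spike_finite[rotated 2, where S="S \<union> {0, 1}"]) (use S(1) in \<open>auto simp: f_def\<close>)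
  then have int: "(f has_integral \<gamma> 1 - \<gamma> 0) UNIV"
    by (rule has_integral_on_superset) (auto simp: f_def)
  \<comment> \<open>The gauge integral exists in any case. If the norm has infinite integral the
    bound is trivial; otherwise the gauge integral is the Lebesgue integral.\<close>
  have "ennreal (norm (\<gamma> 1 - \<gamma> 0)) \<le> (\<integral>\<^sup>+t. ennreal (norm (f t)) \<partial>lborel)"
  proof (cases "(\<integral>\<^sup>+t. ennreal (norm (f t)) \<partial>lborel) < \<infinity>")
    case True
    then have i: "integrable lborel f" using f by (simp add: integrable_iff_bounded)
    then have "integral\<^sup>L lborel f = \<gamma> 1 - \<gamma> 0"
      using has_integral_unique[OF has_integral_integral_lborel[OF i] int] by blast
    then show ?thesis using integral_norm_bound_ennreal[OF i] by simp
  next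
    case False
    then show ?thesis by (simp add: not_less top_unique)
  qed
  also have "\<dots> \<le> curve_length atlas metric \<gamma>"
    unfolding curve_length_def
  proof (rule nn_integral_mono)
    fix t
    show "ennreal (norm (f t)) \<le> ennreal (curve_speed atlas metric \<gamma> t) * indicator {0..1} t"
    proof (cases "t \<in> {0<..<1} - S")
      case True
      then show ?thesis using curve_speed_eq[OF cont M _ _ D(1)[OF True]] by (simp add: f_def)
    qed (simp add: f_def)
  qed
  finally show ?thesis .
qed

lemma riemannian_dist_ge: "ennreal (norm (x - y)) \<le> riemannian_dist sphere_top atlas metric x y"
  unfolding riemannian_dist_def
proof (rule Inf_greatest)
  fix l assume "l \<in> {curve_length atlas metric \<gamma> |\<gamma>. piecewise_C1_curve sphere_top atlas \<gamma> \<and> \<gamma> 0 = x \<and> \<gamma> 1 = y}"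
  then obtain \<gamma> where "l = curve_length atlas metric \<gamma>" "piecewise_C1_curve sphere_top atlas \<gamma>" "\<gamma> 0 = x" "\<gamma> 1 = y"
    by blast
  then show "ennreal (norm (x - y)) \<le> l" using curve_length_ge_dist[of \<gamma>] by (simp add: norm_minus_commute)
qed

end

section \<open>Dynamics fixing the point at infinity\<close>

text \<open>Used with c = 1/2, so that \<open>1 + D e\<close> cannot vanish; this makes the
  differential of the shear invertible.\<close>

lemma directional_derivative_bound:
  fixes h :: "'a::euclidean_space \<Rightarrow> real"
  assumes "(h has_derivative D) (at u)" "\<And>t. \<bar>h (u + t *\<^sub>R e) - h u\<bar> \<le> c * \<bar>t\<bar>"
  shows "\<bar>D e\<bar> \<le> c"
proof -
  have lin: "linear D" using has_derivative_linear[OF assms(1)] .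
  have "((\<lambda>t. u + t *\<^sub>R e) has_derivative (\<lambda>t. t *\<^sub>R e)) (at 0)"
    by (auto intro!: derivative_eq_intros)
  moreover have "(h has_derivative D) (at (u + 0 *\<^sub>R e))" using assms(1) by simp
  ultimately have "((\<lambda>t. h (u + t *\<^sub>R e)) has_derivative (\<lambda>t. D (t *\<^sub>R e))) (at 0)"
    using diff_chain_at[of "\<lambda>t. u + t *\<^sub>R e" "\<lambda>t. t *\<^sub>R e" 0 h D] by (simp add: o_def)
  moreover have "(\<lambda>t. D (t *\<^sub>R e)) = (*) (D e)"
    by (rule ext) (simp add: linear_scale[OF lin] mult.commute)
  ultimately have "((\<lambda>t. h (u + t *\<^sub>R e)) has_real_derivative D e) (at 0)"
    by (simp add: has_field_derivative_def)
  then have "((\<lambda>t. \<bar>(h (u + t *\<^sub>R e) - h u) / t\<bar>) \<longlongrightarrow> \<bar>D e\<bar>) (at 0)"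
    unfolding has_field_derivative_iff by (intro tendsto_rabs) simp
  then show ?thesis
  proof (rule tendsto_upperbound)
    show "\<forall>\<^sub>F t in at 0. \<bar>(h (u + t *\<^sub>R e) - h u) / t\<bar> \<le> c"
      unfolding eventually_at
      by (intro exI[of _ 1]) (use assms(2) in \<open>auto simp: field_simps abs_divide\<close>)
  qed simp
qed

text \<open>The differential of the shear is the identity plus a map of rank one, and
  \<open>H\<close> below is its inverse by the Sherman-Morrison formula. So the derivative of
  \<open>G\<close> is a smooth function composed with \<open>G\<close>, and each order of smoothness
  of \<open>G\<close> yields the next one.\<close>

lemma shear_smooth_inverse:
  fixes h :: "'a::euclidean_space \<Rightarrow> real"
  assumes h: "smooth_on h UNIV" and lip: "\<And>u t. \<bar>h (u + t *\<^sub>R e) - h u\<bar> \<le> 1/2 * \<bar>t\<bar>"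
    and FG: "\<And>y. G y + h (G y) *\<^sub>R e = y" and GF: "\<And>u. G (u + h u *\<^sub>R e) = u"
  shows "smooth_on G UNIV"
proof -
  let ?Dh = "\<lambda>x. frechet_derivative h (at x)"
  have dh: "(h has_derivative ?Dh x) (at x)" for x by (rule smooth_on_has_derivative[OF h]) simp
  have pos: "1 + ?Dh x e \<noteq> 0" for x
    using directional_derivative_bound[OF dh lip, of x] by linarith
  define H where "H w x = w - (?Dh x w / (1 + ?Dh x e)) *\<^sub>R e" for w x
  have der: "(G has_derivative (\<lambda>w. H w (G y))) (at y)" for y
  proof (rule has_derivative_inverse_strong_x[where S=UNIV and f="\<lambda>u. u + h u *\<^sub>R e"
        and f'="\<lambda>v. v + ?Dh (G y) v *\<^sub>R e"])
    show "continuous_on UNIV (\<lambda>u. u + h u *\<^sub>R e)"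
      by (intro continuous_intros smooth_on_continuous[OF h])
    show "((\<lambda>u. u + h u *\<^sub>R e) has_derivative (\<lambda>v. v + ?Dh (G y) v *\<^sub>R e)) (at (G y))"
      by (intro has_derivative_add has_derivative_ident has_derivative_scaleR_left dh)
    show "(\<lambda>v. v + ?Dh (G y) v *\<^sub>R e) \<circ> (\<lambda>w. H w (G y)) = id"
    proof
      fix w
      have lin: "linear (?Dh (G y))" using has_derivative_linear[OF dh] .
      define q where "q = ?Dh (G y) w / (1 + ?Dh (G y) e)"
      have "q * (1 + ?Dh (G y) e) = ?Dh (G y) w" using pos[of "G y"] by (simp add: q_def)
      then have 0: "- q + (?Dh (G y) w - q * ?Dh (G y) e) = 0" by (simp add: algebra_simps)
      have "H w (G y) + ?Dh (G y) (H w (G y)) *\<^sub>R e = w + (- q + (?Dh (G y) w - q * ?Dh (G y) e)) *\<^sub>R e"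
        unfolding H_def q_def[symmetric] linear_diff[OF lin] linear_scale[OF lin] by (simp add: algebra_simps)
      then show "((\<lambda>v. v + ?Dh (G y) v *\<^sub>R e) \<circ> (\<lambda>w. H w (G y))) w = id w" unfolding 0 by simp
    qed
  qed (use FG GF in auto)
  have H: "smooth_on (H w) UNIV" for w
    unfolding H_def
    by (intro smooth_on_diff smooth_on_scaleR smooth_on_divide smooth_on_add smooth_on_const
        smooth_on_frechet_derivative[OF h] open_UNIV pos)
  have "Ck_on k G UNIV" for k
  proof (induction k)
    case 0
    show ?case using has_derivative_continuous[OF der] by (auto intro: continuous_at_imp_continuous_on)
  next
    case (Suc k)
    show ?case
    proof (rule Ck_on_SucI[OF open_UNIV der])
      show "Ck_on k (\<lambda>y. H v (G y)) UNIV" for v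
        by (rule Ck_on_compose[OF open_UNIV subset_UNIV _ Suc]) (use H smooth_on_def in blast)
    qed
  qed
  then show ?thesis by (simp add: smooth_on_def)
qed

text \<open>Points with equal images differ by t e, where t is the difference of their values under
  \<open>h\<close>, and the constant 1/2 forces t = 0. A preimage of y is found on the line through
  y in direction \<open>e\<close>, by the intermediate value theorem on [-b, 0].\<close>

lemma shear_inverse:
  fixes h :: "'a::euclidean_space \<Rightarrow> real"
  assumes h: "continuous_on UNIV h" and lip: "\<And>u t. \<bar>h (u + t *\<^sub>R e) - h u\<bar> \<le> 1/2 * \<bar>t\<bar>"
    and bd: "\<And>u. 0 \<le> h u" "\<And>u. h u \<le> b"
  obtains G where "\<And>y. G y + h (G y) *\<^sub>R e = y" "\<And>u. G (u + h u *\<^sub>R e) = u"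
proof -
  have inj: "u = v" if "u + h u *\<^sub>R e = v + h v *\<^sub>R e" for u v
  proof -
    define t where "t = h u - h v"
    have v: "v = u + t *\<^sub>R e" using that by (simp add: t_def algebra_simps)
    have "h (u + t *\<^sub>R e) = h v" using v by simp
    then have "\<bar>t\<bar> \<le> 1/2 * \<bar>t\<bar>" using lip[of u t] by (simp add: t_def abs_minus_commute)
    then have "t = 0" by simp
    then show "u = v" using v by simp
  qed
  have "\<exists>u. u + h u *\<^sub>R e = y" for y
  proof -
    have "0 \<le> b" using bd[of 0] by linarith
    have c: "continuous_on {-b..0} (\<lambda>t. t + h (y + t *\<^sub>R e))"
      by (intro continuous_intros continuous_on_compose2[OF h]) auto
    have "\<exists>t\<ge>-b. t \<le> 0 \<and> t + h (y + t *\<^sub>R e) = 0"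
      by (rule IVT'[OF _ _ _ c]) (use bd \<open>0 \<le> b\<close> in auto)
    then obtain t where t: "t + h (y + t *\<^sub>R e) = 0" by blast
    have "(y + t *\<^sub>R e) + h (y + t *\<^sub>R e) *\<^sub>R e = y + (t + h (y + t *\<^sub>R e)) *\<^sub>R e" by (simp add: algebra_simps)
    then show ?thesis using t by (intro exI[of _ "y + t *\<^sub>R e"]) simp
  qed
  then obtain G where "\<And>y. G y + h (G y) *\<^sub>R e = y" by metis
  then show ?thesis using that[of G] inj by metis
qed

text \<open>The function \<open>1 - r\<close> vanishes off a compact interval, so its derivative is
  bounded; the bound is raised by 1 to be positive.\<close>

lemma smooth_cutoff_lipschitz:
  fixes r :: "real \<Rightarrow> real"
  assumes r: "smooth_on r UNIV" and one: "\<And>x. x \<notin> {a..b} \<Longrightarrow> r x = 1"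
  obtains L where "0 < L" "\<And>x y. \<bar>r x - r y\<bar> \<le> L * \<bar>x - y\<bar>"
proof -
  let ?g = "\<lambda>x. 1 - r x"
  have g: "smooth_on ?g UNIV" by (intro smooth_on_diff smooth_on_const r open_UNIV)
  have "\<exists>B. \<forall>x. \<bar>(deriv ^^ 1) ?g x\<bar> \<le> B"
    by (rule iterated_deriv_bounded[OF g, of a b]) (simp add: one)
  then obtain B where B: "\<And>x. \<bar>deriv ?g x\<bar> \<le> B" by auto
  then have "0 \<le> B" by (meson abs_ge_zero order_trans)
  have "norm (?g x - ?g y) \<le> B * norm (x - y)" for x y
    by (rule field_differentiable_bound[of UNIV ?g "deriv ?g"])
       (use smooth_on_real_deriv(1)[OF g] B in auto)
  then have "\<bar>r x - r y\<bar> \<le> (B + 1) * \<bar>x - y\<bar>" for x y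
    using abs_ge_zero[of "x - y"] by (simp add: abs_minus_commute distrib_right) (metis add_increasing2 abs_ge_zero)
  then show ?thesis using that[of "B + 1"] \<open>0 \<le> B\<close> by auto
qed

text \<open>Fubini for a product of indicators: the factor of axis \<open>i\<close> integrates to 0,
  and in \<open>ennreal\<close> this annihilates the infinite factors.\<close>

lemma negligible_cylinder:
  fixes C :: "real set"
  assumes "closed C" "emeasure lborel C = 0"
  shows "emeasure lborel {x :: real ^ 'n. x $ i \<in> C} = 0"
proof -
  have b: "axis i 1 \<in> (Basis :: (real ^ 'n) set)" by (auto simp: Basis_vec_def)
  define f where "f b = (indicator (if b = axis i 1 then C else UNIV) :: real \<Rightarrow> ennreal)" for b :: "real ^ 'n"
  have "closed {x :: real ^ 'n. x $ i \<in> C}"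
    using continuous_closed_vimage[OF assms(1), of "\<lambda>x :: real ^ 'n. x $ i"] by (simp add: vimage_def)
  then have "emeasure lborel {x :: real ^ 'n. x $ i \<in> C} = (\<integral>\<^sup>+x. indicator {x :: real ^ 'n. x $ i \<in> C} x \<partial>lborel)"
    by simp
  also have "\<dots> = (\<integral>\<^sup>+x. (\<Prod>b\<in>Basis. f b (x \<bullet> b)) \<partial>lborel)"
  proof (rule nn_integral_cong)
    fix x :: "real ^ 'n"
    have "(\<Prod>b\<in>Basis. f b (x \<bullet> b)) = f (axis i 1) (x \<bullet> axis i 1) * (\<Prod>b\<in>Basis - {axis i 1}. f b (x \<bullet> b))"
      by (rule prod.remove[OF finite_Basis b])
    also have "(\<Prod>b\<in>Basis - {axis i 1}. f b (x \<bullet> b)) = 1"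
      by (rule prod.neutral) (simp add: f_def)
    finally show "indicator {x :: real ^ 'n. x $ i \<in> C} x = (\<Prod>b\<in>Basis. f b (x \<bullet> b))"
      by (simp add: f_def inner_axis indicator_def)
  qed
  also have "\<dots> = (\<Prod>b\<in>Basis. (\<integral>\<^sup>+x. f b x \<partial>lborel))"
    by (rule nn_integral_lborel_prod) (use assms(1) in \<open>auto simp: f_def\<close>)
  also have "\<dots> = 0"
    by (rule prod_zero[OF finite_Basis]) (use b assms in \<open>auto intro!: bexI[of _ "axis i 1"] simp: f_def\<close>)
  finally show ?thesis .
qed

lemma cesaro_mean_tendsto:
  fixes a :: "nat \<Rightarrow> real"
  assumes "a \<longlonglongrightarrow> l"
  shows "(\<lambda>n. (1 / real n) * (\<Sum>k<n. a k)) \<longlonglongrightarrow> l"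
proof (rule LIMSEQ_I)
  fix e :: real assume e: "0 < e"
  obtain N where N: "\<And>k. k \<ge> N \<Longrightarrow> \<bar>a k - l\<bar> < e / 2"
    using LIMSEQ_D[OF assms, of "e / 2"] e by auto
  define S where "S = (\<Sum>k<N. \<bar>a k - l\<bar>)"
  have S: "0 \<le> S" unfolding S_def by (rule sum_nonneg) simp
  obtain N' :: nat where N': "2 * S / e < real N'" using reals_Archimedean2 by blast
  show "\<exists>no. \<forall>n\<ge>no. norm ((1 / real n) * (\<Sum>k<n. a k) - l) < e"
  proof (intro exI allI impI)
    fix n assume n: "n \<ge> max (max N N') 1"
    have "\<bar>\<Sum>k<n. (a k - l)\<bar> \<le> (\<Sum>k<n. \<bar>a k - l\<bar>)" by (rule sum_abs)
    also have "\<dots> = S + (\<Sum>k\<in>{N..<n}. \<bar>a k - l\<bar>)"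
      unfolding S_def using n by (simp add: lessThan_atLeast0 sum.atLeastLessThan_concat)
    also have "\<dots> \<le> S + (\<Sum>k\<in>{N..<n}. e / 2)"
      by (intro add_left_mono sum_mono) (use N in \<open>auto intro: less_imp_le\<close>)
    also have "\<dots> \<le> S + real n * (e / 2)" using e by (simp add: mult_right_mono)
    also have "\<dots> < real n * e"
    proof -
      have "2 * S < real N' * e" using N' e by (simp add: field_simps)
      also have "\<dots> \<le> real n * e" using n e by (intro mult_right_mono) auto
      finally show ?thesis by simp
    qed
    finally have lt: "\<bar>\<Sum>k<n. (a k - l)\<bar> < real n * e" .
    have "(1 / real n) * (\<Sum>k<n. a k) - l = (\<Sum>k<n. (a k - l)) / real n"
      using n by (simp add: sum_subtractf field_simps)
    then show "norm ((1 / real n) * (\<Sum>k<n. a k) - l) < e"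
      using lt n by (simp add: abs_divide pos_divide_less_eq mult.commute)
  qed
qed

lemma jump_vec_inner_bound:
  fixes w :: "real ^ 'n"
  assumes "w \<in> half_open_cube"
  shows "jump_vec w \<bullet> jump_vec w \<le> CARD('n) * (\<Sum>k. 1 / (real k + 1)\<^sup>2)\<^sup>2"
proof -
  define b where "b = (\<Sum>k. 1 / (real k + 1)\<^sup>2)"
  have "(jump_vec w $ i)\<^sup>2 \<le> b\<^sup>2" for i
    using jump_fun_bounds[of "w $ i"] assms
    by (intro power_mono) (auto simp: jump_vec_def half_open_cube_def b_def)
  then have "(\<Sum>i\<in>UNIV. (jump_vec w $ i)\<^sup>2) \<le> (\<Sum>i\<in>(UNIV :: 'n set). b\<^sup>2)" by (intro sum_mono)
  then show ?thesis by (simp add: inner_vec_def power2_eq_square b_def)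
qed

lemma hausdorff_measure_mono:
  assumes "K \<subseteq> L" shows "hausdorff_measure d s K \<le> hausdorff_measure d s L"
  unfolding hausdorff_measure_def hausdorff_premeasure_def
  by (intro SUP_mono' Inf_superset_mono) (use assms in blast)

lemma continuous_map_borel_of_topology:
  assumes "continuous_map X Y f"
  shows "f \<in> borel_of_topology X \<rightarrow>\<^sub>M borel_of_topology Y"
proof (rule measurable_borel_of_topologyI)
  show "f \<in> space (borel_of_topology X) \<rightarrow> topspace Y" using assms by (auto simp: continuous_map_def)
  fix U assume "openin Y U"
  then have "openin X {x \<in> topspace X. f x \<in> U}" using assms by (auto simp: continuous_map_def)
  moreover have "f -` U \<inter> space (borel_of_topology X) = {x \<in> topspace X. f x \<in> U}" by auto
  ultimately show "f -` U \<inter> space (borel_of_topology X) \<in> sets (borel_of_topology X)"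
    using openin_borel_of_topology by metis
qed

lemma continuous_map_real_borel_of_topology:
  assumes "continuous_map X euclideanreal \<phi>"
  shows "\<phi> \<in> borel_measurable (borel_of_topology X)"
proof (rule borel_measurableI)
  fix S :: "real set" assume "open S"
  then have "openin X {x \<in> topspace X. \<phi> x \<in> S}" using assms by (auto simp: continuous_map_def)
  moreover have "\<phi> -` S \<inter> space (borel_of_topology X) = {x \<in> topspace X. \<phi> x \<in> S}" by auto
  ultimately show "\<phi> -` S \<inter> space (borel_of_topology X) \<in> sets (borel_of_topology X)"
    using openin_borel_of_topology by metis
qed

section \<open>Extension of maps to the sphere and convergence to the pole\<close>

context stereographic
begin

definition extend :: "((real, 'n) vec \<Rightarrow> (real, 'n) vec) \<Rightarrow> 'a \<Rightarrow> 'a" where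
  "extend G z = (if z = pole 1 then pole 1 else param 1 (G (coord 1 z)))"

lemma param_1_neq_pole: "param 1 u \<noteq> pole 1"
  using param_in_punctured[of 1 u] by (simp add: punctured_def)

lemma extend_param: "extend G (param 1 u) = param 1 (G u)"
  using param_1_neq_pole coord_param[of 1] by (simp add: extend_def)

lemma extend_pole: "extend G (pole 1) = pole 1"
  by (simp add: extend_def)

lemma sphere_cases:
  assumes "z \<in> sphere_set"
  obtains "z = pole 1" | u where "z = param 1 u"
  using assms param_coord[of 1 z] unfolding punctured_def by (metis DiffI insertI1 singletonD)

lemma extend_in_sphere: "z \<in> sphere_set \<Longrightarrow> extend G z \<in> sphere_set"
  using pole_in[of 1] param_in_sphere[of 1] by (simp add: extend_def)

lemma param_inversion_minus:
  assumes "p \<noteq> 0" shows "param (-1) p = param 1 (inverse (p \<bullet> p) *\<^sub>R p)"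
  using param_inversion[OF assms, of "-1"] by simp

text \<open>The formula is \<open>u \<mapsto> u + c\<close> on \<open>\<real>\<^sup>n\<close> seen in the chart around infinity, with the
  denominators cleared.\<close>

lemma translation_near_pole:
  fixes c :: "(real, 'n) vec"
  defines "D \<equiv> \<lambda>p. p \<bullet> p + (1 + 2 * (p \<bullet> c) + (p \<bullet> p) * (c \<bullet> c))"
  shows "D p \<noteq> 0"
    and "p \<noteq> 0 \<Longrightarrow> param 1 (inverse (p \<bullet> p) *\<^sub>R p + c) =
      J ((2 / D p) *\<^sub>R (p + (p \<bullet> p) *\<^sub>R c), 1 - 2 * (p \<bullet> p) / D p)"
proof -
  define q where "q = p \<bullet> p"
  define w where "w = inverse q *\<^sub>R p + c"
  have w: "q * (1 + w \<bullet> w) = D p" if "p \<noteq> 0"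
  proof -
    have "0 < q" using that by (simp add: q_def)
    have "w \<bullet> w = inverse q * inverse q * q + 2 * inverse q * (p \<bullet> c) + c \<bullet> c"
      by (simp add: w_def inner_add_left inner_add_right inner_commute q_def algebra_simps)
    then have "q * (1 + w \<bullet> w) = q + (q * inverse q) * (q * inverse q) + 2 * (q * inverse q) * (p \<bullet> c) + q * (c \<bullet> c)"
      by (simp add: algebra_simps)
    then show ?thesis using \<open>0 < q\<close> by (simp add: D_def q_def[symmetric])
  qed
  have q0: "0 < q" if "p \<noteq> 0" using that by (simp add: q_def)
  show D0: "D p \<noteq> 0"
  proof (cases "p = 0")
    case False
    have "0 < q * (1 + w \<bullet> w)" using q0[OF False] one_plus_inner_pos by (intro mult_pos_pos)
    then show ?thesis using w[OF False] by simp
  qed (simp add: D_def)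
  show "param 1 (inverse (p \<bullet> p) *\<^sub>R p + c) =
      J ((2 / D p) *\<^sub>R (p + (p \<bullet> p) *\<^sub>R c), 1 - 2 * (p \<bullet> p) / D p)" if "p \<noteq> 0"
  proof -
    have 1: "2 / (1 + w \<bullet> w) = 2 * q / D p"
      using w[OF that] q0[OF that] by (metis mult.commute mult_divide_mult_cancel_left less_irrefl)
    have "(q * inverse q) *\<^sub>R p = p" using q0[OF that] by simp
    then have "q *\<^sub>R w = p + q *\<^sub>R c" by (simp add: w_def scaleR_add_right)
    then have 2: "(2 * q / D p) *\<^sub>R w = (2 / D p) *\<^sub>R (p + q *\<^sub>R c)"
      by (metis (no_types, opaque_lifting) scaleR_scaleR times_divide_eq_left)
    show ?thesis unfolding q_def[symmetric] w_def[symmetric] param_def 1 2 by simp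
  qed
qed

text \<open>Only the chart around infinity needs an argument. Away from its origin the inversion is
  smooth. On the ball of radius 1/R inverted points have norm above R, so the map is a translation
  there and is given by a rational formula that is smooth across the origin.\<close>

lemma smooth_on_extend_param:
  assumes G: "smooth_on G UNIV" and far: "\<And>u. R < norm u \<Longrightarrow> G u = u + c" and R: "0 < R"
    and s: "s \<in> {1, -1}"
  shows "smooth_on (\<lambda>p. extend G (param s p)) UNIV"
proof -
  have 1: "smooth_on (\<lambda>p. param 1 (G p)) UNIV"
    by (rule smooth_on_compose[OF smooth_on_param G]) auto
  have o: "open (- {0 :: (real, 'n) vec})" by auto
  have inv: "smooth_on (\<lambda>p :: (real, 'n) vec. (1 / (p \<bullet> p)) *\<^sub>R p) (- {0})"
    by (intro smooth_on_scaleR smooth_on_divide smooth_on_inner smooth_on_id smooth_on_const o) auto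
  have "smooth_on (\<lambda>p. param 1 (G ((1 / (p \<bullet> p)) *\<^sub>R p))) (- {0})"
    by (rule smooth_on_compose[OF 1 inv o]) simp
  then have a: "smooth_on (\<lambda>p. extend G (param (-1) p)) (- {0})"
    by (rule smooth_on_cong[OF _ o]) (simp add: param_inversion_minus extend_param inverse_eq_divide)
  let ?D = "\<lambda>p. p \<bullet> p + (1 + 2 * (p \<bullet> c) + (p \<bullet> p) * (c \<bullet> c))"
  let ?E = "\<lambda>p. J ((2 / ?D p) *\<^sub>R (p + (p \<bullet> p) *\<^sub>R c), 1 - 2 * (p \<bullet> p) / ?D p)"
  have ob: "open (ball (0 :: (real, 'n) vec) (1 / R))" by simp
  have "smooth_on ?E (ball 0 (1 / R))"
    by (intro smooth_on_linear_compose[OF bl_J] smooth_on_Pair smooth_on_scaleR smooth_on_divide smooth_on_diff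
        smooth_on_add smooth_on_mult smooth_on_inner smooth_on_id smooth_on_const ob translation_near_pole(1))
  then have b: "smooth_on (\<lambda>p. extend G (param (-1) p)) (ball 0 (1 / R))"
  proof (rule smooth_on_cong[OF _ ob])
    fix p :: "(real, 'n) vec" assume p: "p \<in> ball 0 (1 / R)"
    show "?E p = extend G (param (-1) p)"
    proof (cases "p = 0")
      case True
      then show ?thesis using param_0[of "-1"] extend_pole[of G] by (simp add: pole_def)
    next
      case False
      have "norm (inverse (p \<bullet> p) *\<^sub>R p) = 1 / norm p"
        using False by (simp add: dot_square_norm power2_eq_square inverse_eq_divide)
      also have "R < 1 / norm p" using p False R by (simp add: field_simps)
      finally have "G (inverse (p \<bullet> p) *\<^sub>R p) = inverse (p \<bullet> p) *\<^sub>R p + c" using far by blast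
      then show ?thesis
        unfolding param_inversion_minus[OF False] extend_param using translation_near_pole(2)[OF False, of c] by simp
    qed
  qed
  have "- {0 :: (real, 'n) vec} \<union> ball 0 (1 / R) = UNIV" using R by auto
  then have "smooth_on (\<lambda>p. extend G (param (-1) p)) UNIV" using smooth_on_Un[OF o ob a b] by simp
  moreover have "smooth_on (\<lambda>p. extend G (param 1 p)) UNIV" using 1 by (simp add: extend_param)
  ultimately show ?thesis using s by auto
qed

lemma smooth_diffeomorphism_extend:
  assumes F: "smooth_on F UNIV" "\<And>u. R < norm u \<Longrightarrow> F u = u + c"
    and G: "smooth_on G UNIV" "\<And>u. R < norm u \<Longrightarrow> G u = u - c" and R: "0 < R"
    and FG: "\<And>y. F (G y) = y" and GF: "\<And>u. G (F u) = u"
  shows "smooth_diffeomorphism sphere_top atlas (extend F)"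
proof -
  have inv: "extend F (extend G z) = z" "extend G (extend F z) = z" if "z \<in> sphere_set" for z
    using that by (auto elim!: sphere_cases simp: extend_pole extend_param FG GF)
  have bij: "bij_betw (extend F) sphere_set sphere_set"
    by (rule bij_betwI[where g="extend G"]) (use inv extend_in_sphere in auto)
  have inv_eq: "inv_into sphere_set (extend F) z = extend G z" if "z \<in> sphere_set" for z
    by (rule inv_into_f_eq) (use bij inv extend_in_sphere that in \<open>auto simp: bij_betw_def\<close>)
  have "smooth_self_map sphere_top atlas (extend F)"
    by (rule smooth_self_mapI) (use extend_in_sphere smooth_on_extend_param[OF F R] in auto)
  moreover have "smooth_self_map sphere_top atlas (inv_into sphere_set (extend F))"
  proof (rule smooth_self_mapI)
    show "inv_into sphere_set (extend F) ` sphere_set \<subseteq> sphere_set" using inv_eq extend_in_sphere by auto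
    fix s :: real assume s: "s \<in> {1, -1}"
    have "smooth_on (\<lambda>p. extend G (param s p)) UNIV"
      by (rule smooth_on_extend_param[where c="-c", OF G(1) _ R s]) (simp add: G(2))
    then show "smooth_on (\<lambda>p. inv_into sphere_set (extend F) (param s p)) UNIV"
      using inv_eq param_in_sphere[OF s] by simp
  qed
  ultimately show ?thesis using bij unfolding smooth_diffeomorphism_def by simp
qed

lemma extend_funpow_param: "(extend F ^^ n) (param 1 u) = param 1 ((F ^^ n) u)"
  by (induction n) (simp_all add: extend_param)

text \<open>In the opposite chart the pole is the origin, and the inversion turns divergence to
  infinity into convergence to 0.\<close>

lemma param_tendsto_pole:
  fixes w :: "nat \<Rightarrow> (real, 'n) vec"
  assumes "filterlim (\<lambda>n. norm (w n)) at_top sequentially"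
  shows "(\<lambda>n. param 1 (w n)) \<longlonglongrightarrow> pole 1"
proof -
  have "(\<lambda>n. inverse (norm (w n))) \<longlonglongrightarrow> 0"
    by (rule tendsto_inverse_0_at_top[OF assms])
  moreover have "norm (inverse (w n \<bullet> w n) *\<^sub>R w n) = inverse (norm (w n))" for n
    by (cases "w n = 0") (simp_all add: dot_square_norm power2_eq_square)
  ultimately have "(\<lambda>n. inverse (w n \<bullet> w n) *\<^sub>R w n) \<longlonglongrightarrow> 0"
    by (intro tendsto_norm_zero_cancel[where f="\<lambda>n. inverse (w n \<bullet> w n) *\<^sub>R w n"]) presburger
  moreover have "isCont (param (-1)) 0"
    using smooth_on_continuous[OF smooth_on_param] by (simp add: continuous_on_eq_continuous_at)
  ultimately have "(\<lambda>n. param (-1) (inverse (w n \<bullet> w n) *\<^sub>R w n)) \<longlonglongrightarrow> param (-1) 0"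
    by (rule isCont_tendsto_compose[rotated])
  moreover have "\<forall>\<^sub>F n in sequentially. param (-1) (inverse (w n \<bullet> w n) *\<^sub>R w n) = param 1 (w n)"
    using eventually_gt_at_top[of 0, THEN assms[unfolded filterlim_iff, rule_format]]
    by eventually_elim (use param_inversion[of _ 1] in auto)
  ultimately show ?thesis using param_0[of "-1"] by (simp add: tendsto_cong)
qed

text \<open>The height determines x = 2 / (1 + |u|^2), which is bounded below on a ball. With y the
  same quantity for v, one has u - v = ((x u - y v) + (y - x) v) / x, and \<open>J'\<close> recovers
  both differences from the points of the surface.\<close>

lemma param_inverse_lipschitz:
  obtains c where "0 < c"
    "\<And>u v. u \<bullet> u \<le> Q \<Longrightarrow> v \<bullet> v \<le> Q \<Longrightarrow> norm (u - v) \<le> c * norm (param 1 u - param 1 v)"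
proof -
  obtain K where K: "0 < K" "\<And>z. norm (J' z) \<le> norm z * K" using bounded_linear.pos_bounded[OF bl_J'] by blast
  \<comment> \<open>The factors bound, in this order, 1 / x, 1 + norm v, and the operator norm of
    \<open>J'\<close>.\<close>
  define c where "c = (1 + \<bar>Q\<bar>) / 2 * (2 + \<bar>Q\<bar>) * K"
  show ?thesis
  proof (rule that[of c])
    show "0 < c" using K by (simp add: c_def)
    fix u v :: "(real, 'n) vec" assume u: "u \<bullet> u \<le> Q" and v: "v \<bullet> v \<le> Q"
    define x where "x = 2 / (1 + u \<bullet> u)"
    define y where "y = 2 / (1 + v \<bullet> v)"
    have x: "0 < x" "1 / x \<le> (1 + \<bar>Q\<bar>) / 2" using one_plus_inner_pos[of u] u by (simp_all add: x_def)
    have nv: "norm v \<le> 1 + \<bar>Q\<bar>"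
    proof (rule power2_le_imp_le)
      have "(norm v)\<^sup>2 \<le> \<bar>Q\<bar>" using v by (simp add: power2_norm_eq_inner)
      also have "\<dots> \<le> (1 + \<bar>Q\<bar>)\<^sup>2" by (simp add: power2_eq_square algebra_simps)
      finally show "(norm v)\<^sup>2 \<le> (1 + \<bar>Q\<bar>)\<^sup>2" .
    qed simp
    define N where "N = norm (param 1 u - param 1 v)"
    have "J' (param 1 u - param 1 v) = (x *\<^sub>R u - y *\<^sub>R v, y - x)"
      unfolding linear_diff[OF bounded_linear.linear[OF bl_J']] by (simp add: param_def J'_J x_def y_def)
    then have "norm (x *\<^sub>R u - y *\<^sub>R v, y - x) \<le> N * K" using K(2) unfolding N_def by metis
    then have le: "norm (x *\<^sub>R u - y *\<^sub>R v) \<le> N * K" "\<bar>y - x\<bar> \<le> N * K"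
      using norm_fst_le[of "x *\<^sub>R u - y *\<^sub>R v" "y - x"] norm_snd_le[of "y - x" "x *\<^sub>R u - y *\<^sub>R v"] by auto
    have "u - v = (1 / x) *\<^sub>R ((x *\<^sub>R u - y *\<^sub>R v) + (y - x) *\<^sub>R v)" using x by (simp add: algebra_simps)
    then have "norm (u - v) = (1 / x) * norm ((x *\<^sub>R u - y *\<^sub>R v) + (y - x) *\<^sub>R v)" using x by simp
    also have "\<dots> \<le> (1 / x) * (N * K + (N * K) * (1 + \<bar>Q\<bar>))"
    proof (rule mult_left_mono)
      have "norm ((x *\<^sub>R u - y *\<^sub>R v) + (y - x) *\<^sub>R v) \<le> norm (x *\<^sub>R u - y *\<^sub>R v) + norm ((y - x) *\<^sub>R v)"
        by (rule norm_triangle_ineq)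
      also have "\<dots> \<le> N * K + (N * K) * (1 + \<bar>Q\<bar>)"
        unfolding norm_scaleR using le nv by (intro add_mono mult_mono) auto
      finally show "norm ((x *\<^sub>R u - y *\<^sub>R v) + (y - x) *\<^sub>R v) \<le> N * K + (N * K) * (1 + \<bar>Q\<bar>)" .
    qed (use x in simp)
    also have "\<dots> \<le> (1 + \<bar>Q\<bar>) / 2 * (N * K + (N * K) * (1 + \<bar>Q\<bar>))"
      using x K by (intro mult_right_mono) (auto simp: N_def)
    also have "N * K + (N * K) * (1 + \<bar>Q\<bar>) = (2 + \<bar>Q\<bar>) * K * N" by (simp add: algebra_simps)
    also have "(1 + \<bar>Q\<bar>) / 2 * ((2 + \<bar>Q\<bar>) * K * N) = c * norm (param 1 u - param 1 v)"
      unfolding c_def N_def by (simp only: mult.assoc)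
    finally show "norm (u - v) \<le> c * norm (param 1 u - param 1 v)" .
  qed
qed

lemma global_SRB_measure_pole:
  assumes cont: "continuous_map sphere_top sphere_top (extend F)"
    and C: "closed C" "emeasure lborel C = 0"
    and lim: "\<And>u. u $ i \<notin> C \<Longrightarrow> filterlim (\<lambda>n. norm ((F ^^ n) u)) at_top sequentially"
  shows "global_SRB_measure sphere_top volume (extend F) (return (borel_of_topology sphere_top) (pole 1))"
proof -
  let ?B = "borel_of_topology sphere_top" and ?f = "extend F"
  have p: "pole 1 \<in> space ?B" using pole_in[of 1] by simp
  have f: "?f \<in> ?B \<rightarrow>\<^sub>M ?B" by (rule continuous_map_borel_of_topology[OF cont])
  have "invariant_prob_measure sphere_top ?f (return ?B (pole 1))"
    unfolding invariant_prob_measure_def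
  proof (intro conjI)
    show "prob_space (return ?B (pole 1))" by (rule prob_space_return[OF p])
    show "distr (return ?B (pole 1)) (return ?B (pole 1)) ?f = return ?B (pole 1)"
      using distr_return[OF _ p, of ?f "return ?B (pole 1)"] f extend_pole[of F]
      by (simp add: return_sets_cong[OF sets_return] measurable_cong_sets[OF refl sets_return])
  qed (use f in simp_all)
  moreover have "AE z in volume. (\<lambda>n. time_average ?f \<phi> n z) \<longlonglongrightarrow> (LINT y|return ?B (pole 1). \<phi> y)"
    if \<phi>: "continuous_map sphere_top euclideanreal \<phi>" for \<phi>
  proof (rule AE_volumeI)
    \<comment> \<open>Seen in the chart, the complement of this open set is the cylinder over
      \<open>C\<close> in direction \<open>i\<close>; the pole, which the chart does not see, is
      left out as well.\<close>
    define T where "T = {z \<in> coord_dom 1. coord 1 z $ i \<in> - C}"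
    have "open T"
      unfolding T_def
      using continuous_open_preimage[OF continuous_on_component[OF smooth_on_continuous[OF smooth_on_coord]] open_coord_dom, of "-C" 1 i] C(1)
      by (simp add: vimage_def Int_def open_Compl)
    then show "openin sphere_top (sphere_set \<inter> T)" unfolding sphere_top_def by (rule openin_open_Int)
    have "{p. param 1 p \<notin> sphere_set \<inter> T} = {p. p $ i \<in> C}"
      using param_in_punctured[of 1] punctured_eq[of 1] coord_param[of 1] by (auto simp: T_def)
    then show "emeasure lborel {p. param 1 p \<notin> sphere_set \<inter> T} = 0" using negligible_cylinder[OF C] by simp
    fix z assume z: "z \<in> sphere_set \<inter> T"
    define u where "u = coord 1 z"
    have zu: "z = param 1 u" using z param_coord[of 1 z] punctured_eq[of 1] by (simp add: u_def T_def)
    have "u $ i \<notin> C" using z by (simp add: u_def T_def)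
    from param_tendsto_pole[OF lim[OF this]]
    have "(\<lambda>n. (?f ^^ n) z) \<longlonglongrightarrow> pole 1" unfolding zu extend_funpow_param .
    moreover have "continuous_on sphere_set \<phi>" using \<phi> by (simp add: sphere_top_def)
    ultimately have "(\<lambda>n. \<phi> ((?f ^^ n) z)) \<longlonglongrightarrow> \<phi> (pole 1)"
      using pole_in[of 1] param_in_sphere[of 1]
      by (intro continuous_on_tendsto_compose[of sphere_set \<phi>]) (auto simp: zu extend_funpow_param)
    then have "(\<lambda>n. time_average ?f \<phi> n z) \<longlonglongrightarrow> \<phi> (pole 1)"
      unfolding time_average_def by (rule cesaro_mean_tendsto)
    then show "(\<lambda>n. time_average ?f \<phi> n z) \<longlonglongrightarrow> (LINT y|return ?B (pole 1). \<phi> y)"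
      using integral_return[OF p continuous_map_real_borel_of_topology[OF \<phi>]] by simp
  qed
  ultimately show ?thesis unfolding global_SRB_measure_def by blast
qed

lemma fixed_point_nontypical:
  assumes p: "z \<in> sphere_set" "f z = z" and \<phi>: "(LINT y|\<mu>. \<phi> y) = 0" "\<alpha> < \<bar>\<phi> z\<bar>"
  shows "z \<in> nontypical_points sphere_top f \<mu> \<phi> \<alpha>"
proof -
  have fn: "(f ^^ n) z = z" for n by (induction n) (simp_all add: p)
  have "time_average f \<phi> n z = \<phi> z" if "0 < n" for n using that by (simp add: time_average_def fn)
  then have "\<forall>\<^sub>F n in sequentially. ereal \<bar>time_average f \<phi> n z - (LINT y|\<mu>. \<phi> y)\<bar> = ereal \<bar>\<phi> z\<bar>"
    using \<phi>(1) by (intro eventually_sequentiallyI[of 1]) simp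
  then have "limsup (\<lambda>n. ereal \<bar>time_average f \<phi> n z - (LINT y|\<mu>. \<phi> y)\<bar>) = ereal \<bar>\<phi> z\<bar>"
    by (intro lim_imp_Limsup tendsto_eventually) auto
  then show ?thesis using p \<phi> by (simp add: nontypical_points_def)
qed

text \<open>Going back from the sphere to the cube combines three estimates: the Riemannian distance
  dominates the ambient one, \<open>param 1\<close> has a Lipschitz inverse over bounded sets, and
  \<open>jump_vec\<close> has an inverse with Hoelder exponent s/n for each s < n. The cube has
  positive Lebesgue measure.\<close>

lemma hausdorff_dim_jump_set:
  assumes "param 1 ` jump_vec ` half_open_cube \<subseteq> K"
  shows "\<not> hausdorff_dim (riemannian_dist sphere_top atlas metric) K < ennreal CARD('n)"
proof (rule hausdorff_dim_not_less)
  fix s :: real assume s: "0 < s" "s < CARD('n)"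
  let ?d = "riemannian_dist sphere_top atlas metric"
  let ?q = "\<lambda>w. param 1 (jump_vec w)" and ?Q = "half_open_cube :: (real, 'n) vec set"
  obtain A where A: "0 < A" "\<And>v w. v \<in> ?Q \<Longrightarrow> w \<in> ?Q \<Longrightarrow>
      norm (v - w) \<le> A * norm (jump_vec v - jump_vec w) powr (s / CARD('n))"
    using jump_vec_inverse_holder[OF s] by blast
  define b where "b = (\<Sum>k. 1 / (real k + 1)\<^sup>2)"
  have bd: "jump_vec w \<bullet> jump_vec w \<le> CARD('n) * b\<^sup>2" if "w \<in> ?Q" for w
    unfolding b_def by (rule jump_vec_inner_bound[OF that])
  obtain c where c: "0 < c" "\<And>u v. u \<bullet> u \<le> CARD('n) * b\<^sup>2 \<Longrightarrow> v \<bullet> v \<le> CARD('n) * b\<^sup>2 \<Longrightarrow>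
      norm (u - v) \<le> c * norm (param 1 u - param 1 v)"
    using param_inverse_lipschitz by blast
  have inj: "v = w" if "v \<in> ?Q" "w \<in> ?Q" "?q v = ?q w" for v w
  proof -
    have "jump_vec v = jump_vec w" using that(3) coord_param[of 1] by (metis insertI1)
    then show ?thesis using A(2)[OF that(1,2)] by simp
  qed
  define P where "P = inv_into ?Q ?q"
  have P: "P (?q w) = w" if "w \<in> ?Q" for w
    unfolding P_def by (rule inv_into_f_eq) (use inj that in \<open>auto intro: inj_onI\<close>)
  have "hausdorff_measure ?d s (?q ` ?Q) \<noteq> 0"
  proof (rule hausdorff_measure_nonzero[where P=P and Q="?Q" and A="A * c powr (s / CARD('n))"])
    show "0 < s" "0 < A * c powr (s / CARD('n))" using s A c by auto
    show "?Q \<in> sets lborel" "0 < emeasure lborel ?Q" by (rule half_open_cube_measure)+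
    show "?Q \<subseteq> P ` ?q ` ?Q" using P by force
    fix x y assume xy: "x \<in> ?q ` ?Q" "y \<in> ?q ` ?Q" and fin: "?d x y < \<infinity>"
    obtain v w where vw: "v \<in> ?Q" "x = ?q v" "w \<in> ?Q" "y = ?q w" using xy by blast
    have "norm (x - y) \<le> enn2real (?d x y)"
      using enn2real_mono[OF riemannian_dist_ge[of x y]] fin by simp
    then have "norm (jump_vec v - jump_vec w) \<le> c * enn2real (?d x y)"
      using c(2)[OF bd[OF vw(1)] bd[OF vw(3)]] c(1) vw by (smt (verit) mult_left_mono)
    then have "norm (jump_vec v - jump_vec w) powr (s / CARD('n)) \<le> (c * enn2real (?d x y)) powr (s / CARD('n))"
      using s by (intro powr_mono2) auto
    then have "A * norm (jump_vec v - jump_vec w) powr (s / CARD('n)) \<le>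
        A * (c powr (s / CARD('n)) * enn2real (?d x y) powr (s / CARD('n)))"
      using A(1) by (simp add: powr_mult)
    then show "norm (P x - P y) \<le> A * c powr (s / CARD('n)) * enn2real (?d x y) powr (s / DIM((real, 'n) vec))"
      using A(2)[OF vw(1,3)] by (simp add: vw P mult.assoc)
  qed
  moreover have "hausdorff_measure ?d s (?q ` ?Q) \<le> hausdorff_measure ?d s K"
    by (rule hausdorff_measure_mono) (use assms in auto)
  ultimately show "hausdorff_measure ?d s K \<noteq> 0" by auto
qed

end

section \<open>The slowed translation\<close>

lemma ex_shear_diffeomorphism:
  fixes k :: "'n::finite" and C :: "real set"
  assumes C: "closed C" "C \<subseteq> {a..b}"
  obtains F G :: "real ^ 'n \<Rightarrow> real ^ 'n" and c R where "smooth_on F UNIV" "smooth_on G UNIV" "0 < R"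
    "\<And>y. F (G y) = y" "\<And>u. G (F u) = u"
    "\<And>u. R < norm u \<Longrightarrow> F u = u + c" "\<And>u. R < norm u \<Longrightarrow> G u = u - c"
    "\<And>u. (\<And>j. u $ j \<in> C) \<Longrightarrow> F u = u"
    "\<And>u i. i \<noteq> k \<Longrightarrow> u $ i \<notin> C \<Longrightarrow> filterlim (\<lambda>n. norm ((F ^^ n) u)) at_top sequentially"
proof -
  obtain r :: "real \<Rightarrow> real" where r: "smooth_on r UNIV" "\<And>x. 0 \<le> r x" "\<And>x. r x \<le> 1"
    "\<And>x. r x = 0 \<longleftrightarrow> x \<in> C" "\<And>x. x \<notin> {a - 1..b + 1} \<Longrightarrow> r x = 1"
    using ex_smooth_cutoff_zero_set[OF C] by blast
  obtain L where L: "0 < L" "\<And>x y. \<bar>r x - r y\<bar> \<le> L * \<bar>x - y\<bar>"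
    using smooth_cutoff_lipschitz[OF r(1,5)] by blast
  \<comment> \<open>This factor makes the displacement \<open>h\<close> Lipschitz with constant 1/2
    in direction \<open>e\<close>, as the invertibility of the shear requires.\<close>
  define \<epsilon> where "\<epsilon> = 1 / (2 * L)"
  have \<epsilon>: "0 < \<epsilon>" "\<epsilon> * L = 1/2" using L by (simp_all add: \<epsilon>_def)
  define e :: "real ^ 'n" where "e = axis k 1"
  have e: "norm e = 1" "e $ k = 1" "\<And>i. i \<noteq> k \<Longrightarrow> e $ i = 0" unfolding e_def by (rule norm_axis_1) (simp_all add: axis_def)
  \<comment> \<open>As \<open>r\<close> has values in [0, 1], this vanishes exactly when all
    \<open>r (u $ j)\<close> do, and it is 1 as soon as one of them is 1. So it is constant off a
    cube, which a sum of the \<open>r (u $ j)\<close> would not be. In \<open>rest i\<close> the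
    factor of coordinate \<open>i\<close> is omitted, so \<open>rest k\<close> does not change along
    \<open>e\<close>.\<close>
  define \<rho> where "\<rho> u = 1 - (\<Prod>j\<in>UNIV. 1 - r (u $ j))" for u :: "real ^ 'n"
  define rest where "rest i u = (\<Prod>j\<in>UNIV - {i}. 1 - r (u $ j))" for i and u :: "real ^ 'n"
  have rest: "0 \<le> rest i u" "rest i u \<le> 1" for i u
    unfolding rest_def using r(2,3) by (auto intro!: prod_nonneg prod_le_1)
  have split: "\<rho> u = 1 - (1 - r (u $ i)) * rest i u" for i u
    unfolding \<rho>_def rest_def by (subst prod.remove[of UNIV i]) simp_all
  have ge: "r (u $ i) \<le> \<rho> u" for i u
  proof -
    have "(1 - r (u $ i)) * rest i u \<le> (1 - r (u $ i)) * 1"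
      using rest r(3) by (intro mult_left_mono) auto
    then show ?thesis unfolding split[of u i] by simp
  qed
  have \<rho>: "0 \<le> \<rho> u" "\<rho> u \<le> 1" for u
  proof -
    show "0 \<le> \<rho> u" using ge[of u k] r(2) order_trans by blast
    show "\<rho> u \<le> 1" unfolding split[of u k] using rest[of k u] r(3) by simp
  qed
  define h where "h u = \<epsilon> * \<rho> u" for u
  have lip: "\<bar>h (u + t *\<^sub>R e) - h u\<bar> \<le> 1/2 * \<bar>t\<bar>" for u t
  proof -
    have "rest k (u + t *\<^sub>R e) = rest k u"
      unfolding rest_def by (rule prod.cong) (auto simp: e)
    then have "h (u + t *\<^sub>R e) - h u = \<epsilon> * ((r (u $ k + t) - r (u $ k)) * rest k u)"
      unfolding h_def split[of _ k] by (simp add: e algebra_simps)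
    then have "\<bar>h (u + t *\<^sub>R e) - h u\<bar> = \<epsilon> * (\<bar>r (u $ k + t) - r (u $ k)\<bar> * rest k u)"
      using \<epsilon> rest(1)[of k u] by (simp add: abs_mult)
    also have "\<dots> \<le> \<epsilon> * (\<bar>r (u $ k + t) - r (u $ k)\<bar> * 1)"
      using \<epsilon> rest by (intro mult_left_mono) auto
    also have "\<dots> \<le> \<epsilon> * (L * \<bar>t\<bar>)"
      using \<epsilon> L(2)[of "u $ k + t" "u $ k"] by (intro mult_left_mono) auto
    also have "\<dots> = 1/2 * \<bar>t\<bar>" using \<epsilon>(2) by (metis mult.assoc)
    finally show ?thesis .
  qed
  have h: "smooth_on h UNIV"
  proof -
    have comp: "smooth_on (\<lambda>u :: real ^ 'n. r (u $ j)) UNIV" for j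
      by (rule smooth_on_compose[OF r(1) smooth_on_linear[OF bounded_linear_vec_nth open_UNIV]]) auto
    show ?thesis unfolding h_def \<rho>_def
      by (intro smooth_on_mult smooth_on_diff smooth_on_prod smooth_on_const comp open_UNIV)
  qed
  have hb: "0 \<le> h u" "h u \<le> \<epsilon>" for u using \<epsilon> \<rho>[of u] by (simp_all add: h_def mult_left_le)
  obtain G where G: "\<And>y. G y + h (G y) *\<^sub>R e = y" "\<And>u. G (u + h u *\<^sub>R e) = u"
    using shear_inverse[OF smooth_on_continuous[OF h] lip hb] by blast
  define F where "F u = u + h u *\<^sub>R e" for u
  \<comment> \<open>If all coordinates lay in [a - 1, b + 1], the l1 norm, and with it the Euclidean
    norm, would be at most \<open>R0\<close>.\<close>
  define R0 where "R0 = CARD('n) * (\<bar>a\<bar> + \<bar>b\<bar> + 1)"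
  have far: "F u = u + \<epsilon> *\<^sub>R e" if u: "R0 < norm u" for u
  proof -
    have "\<exists>j. u $ j \<notin> {a - 1..b + 1}"
    proof (rule ccontr)
      assume "\<not> ?thesis"
      then have "\<bar>u $ j\<bar> \<le> \<bar>a\<bar> + \<bar>b\<bar> + 1" for j by (auto simp: abs_le_iff) (smt (verit))+
      then have "(\<Sum>j\<in>UNIV. \<bar>u $ j\<bar>) \<le> (\<Sum>j\<in>(UNIV :: 'n set). \<bar>a\<bar> + \<bar>b\<bar> + 1)" by (intro sum_mono)
      then show False using norm_le_l1_cart[of u] u by (simp add: R0_def)
    qed
    then obtain j where "r (u $ j) = 1" using r(5) by blast
    then have "\<rho> u = 1" unfolding split[of u j] by simp
    then show ?thesis by (simp add: F_def h_def)
  qed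
  \<comment> \<open>The margin \<epsilon> ensures that \<open>u - \<epsilon> *\<^sub>R e\<close>
    still has norm above \<open>R0\<close>, so that \<open>G\<close> is a translation off the same
    ball.\<close>
  define R where "R = \<bar>R0\<bar> + \<epsilon> + 1"
  have R: "0 < R" "R0 < R" using \<epsilon> by (simp_all add: R_def)
  show ?thesis
  proof (rule that[of F G R "\<epsilon> *\<^sub>R e"])
    show "smooth_on F UNIV"
      unfolding F_def by (intro smooth_on_add smooth_on_scaleR smooth_on_id smooth_on_const h open_UNIV)
    show "smooth_on G UNIV" by (rule shear_smooth_inverse[OF h lip G])
    show "0 < R" by (rule R(1))
    show FG: "F (G y) = y" and GF: "G (F y) = y" for y using G by (simp_all add: F_def)
    show "F u = u + \<epsilon> *\<^sub>R e" if "R < norm u" for u using far that R by simp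
    show "G u = u - \<epsilon> *\<^sub>R e" if u: "R < norm u" for u
    proof -
      have "norm u - norm (\<epsilon> *\<^sub>R e) \<le> norm (u - \<epsilon> *\<^sub>R e)" by (rule norm_triangle_ineq2)
      then have "R0 < norm (u - \<epsilon> *\<^sub>R e)" using u \<epsilon> e by (simp add: R_def)
      then have "F (u - \<epsilon> *\<^sub>R e) = u" using far by simp
      then show ?thesis using GF by metis
    qed
    show "F u = u" if "\<And>j. u $ j \<in> C" for u
    proof -
      have "r (u $ j) = 0" for j using r(4) that by blast
      then show ?thesis by (simp add: F_def h_def \<rho>_def)
    qed
    fix u :: "real ^ 'n" and i assume i: "i \<noteq> k" "u $ i \<notin> C"
    \<comment> \<open>The coordinate \<open>i\<close> is transversal to \<open>e\<close> and never
      changes, so \<rho> stays at least \<open>r (u $ i)\<close> along the whole orbit, and every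
      step advances coordinate \<open>k\<close> by at least this amount.\<close>
    define \<delta> where "\<delta> = \<epsilon> * r (u $ i)"
    have \<delta>: "0 < \<delta>" using i(2) r(2,4)[of "u $ i"] \<epsilon> by (simp add: \<delta>_def order_le_less)
    have it: "(F ^^ n) u $ i = u $ i \<and> u $ k + real n * \<delta> \<le> (F ^^ n) u $ k" for n
    proof (induction n)
      case (Suc n)
      let ?v = "(F ^^ n) u"
      have "\<delta> \<le> h ?v" using ge[of ?v i] Suc \<epsilon> by (simp add: \<delta>_def h_def)
      moreover have "(F ^^ Suc n) u = ?v + h ?v *\<^sub>R e" by (simp add: F_def[of ?v])
      ultimately show ?case using Suc i(1) by (simp add: e algebra_simps del: funpow.simps)
    qed simp
    have "filterlim (\<lambda>n. u $ k + real n * \<delta>) at_top sequentially"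
      using \<delta> by (intro filterlim_tendsto_add_at_top[OF tendsto_const]
          filterlim_at_top_mult_tendsto_pos[OF tendsto_const] filterlim_real_sequentially)
    then show "filterlim (\<lambda>n. norm ((F ^^ n) u)) at_top sequentially"
    proof (rule filterlim_at_top_mono)
      show "\<forall>\<^sub>F n in sequentially. u $ k + real n * \<delta> \<le> norm ((F ^^ n) u)"
        by (intro always_eventually allI
            order_trans[OF conjunct2[OF it] order_trans[OF abs_ge_self component_le_norm_cart]])
    qed
  qed
qed

context stereographic
begin

text \<open>The index \<open>k\<close> is the axis of the motion and \<open>i\<close> a coordinate
  transversal to it; that both exist means that the dimension is at least 2.\<close>

lemma special_ergodic_theorem_fails:
  assumes "k \<noteq> (i :: 'n)"
  obtains f \<mu> \<phi> \<alpha> where "smooth_diffeomorphism sphere_top atlas f" "global_SRB_measure sphere_top volume f \<mu>"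
    "continuous_map sphere_top euclideanreal \<phi>" "0 < \<alpha>"
    "\<not> hausdorff_dim (riemannian_dist sphere_top atlas metric) (nontypical_points sphere_top f \<mu> \<phi> \<alpha>)
      < ennreal CARD('n)"
proof -
  define C where "C = closure (jump_fun ` {0..<1})"
  define b where "b = (\<Sum>k. 1 / (real k + 1)\<^sup>2)"
  have C: "closed C" "C \<subseteq> {0..b}" "emeasure lborel C = 0"
  proof -
    show "closed C" unfolding C_def by (rule closed_closure)
    have "jump_fun ` {0..<1} \<subseteq> {0..b}" using jump_fun_bounds unfolding b_def by fastforce
    then show "C \<subseteq> {0..b}" unfolding C_def by (rule closure_minimal) simp
    show "emeasure lborel C = 0" unfolding C_def by (rule closure_jump_fun_null)
  qed
  show ?thesis
  proof (rule ex_shear_diffeomorphism[OF C(1,2), of k])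
    fix F G :: "(real, 'n) vec \<Rightarrow> (real, 'n) vec" and c R
    assume F: "smooth_on F UNIV" and G: "smooth_on G UNIV"
      and R: "0 < R" and inv: "\<And>y. F (G y) = y" "\<And>u. G (F u) = u"
      and far: "\<And>u. R < norm u \<Longrightarrow> F u = u + c" "\<And>u. R < norm u \<Longrightarrow> G u = u - c"
      and fixed_points: "\<And>u. (\<And>j. u $ j \<in> C) \<Longrightarrow> F u = u"
      and lim: "\<And>u i. i \<noteq> k \<Longrightarrow> u $ i \<notin> C \<Longrightarrow> filterlim (\<lambda>n. norm ((F ^^ n) u)) at_top sequentially"
    let ?B = "borel_of_topology sphere_top"
    have diffeo: "smooth_diffeomorphism sphere_top atlas (extend F)"
      by (rule smooth_diffeomorphism_extend[OF F far(1) G far(2) R inv])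
    then have cont: "continuous_map sphere_top sphere_top (extend F)"
      by (simp add: smooth_diffeomorphism_def smooth_self_map_def)
    have SRB: "global_SRB_measure sphere_top volume (extend F) (return ?B (pole 1))"
      by (rule global_SRB_measure_pole[OF cont C(1,3) lim]) (use assms in auto)
    \<comment> \<open>The height is 1 at the point at infinity, so the space average is 0, while the
      value at \<open>param 1 u\<close> is 2 / (1 + |u|^2), which is positive.\<close>
    define \<phi> where "\<phi> z = 1 - snd (J' z)" for z
    have \<phi>: "continuous_map sphere_top euclideanreal \<phi>"
      unfolding \<phi>_def sphere_top_def continuous_map_iff_continuous
      by (intro continuous_intros linear_continuous_on bl_J')
    have int: "(LINT y|return ?B (pole 1). \<phi> y) = 0"
      using integral_return[OF _ continuous_map_real_borel_of_topology[OF \<phi>], of "pole 1"] pole_in[of 1]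
      by (simp add: \<phi>_def pole_def J'_J)
    define Q where "Q = CARD('n) * b\<^sup>2"
    \<comment> \<open>On the jump set |u|^2 is at most \<open>Q\<close>, so \<open>\<phi>\<close> is
      at least 2 / (1 + Q) there; half of this leaves a strict inequality.\<close>
    define \<alpha> where "\<alpha> = 1 / (1 + Q)"
    have Q: "0 \<le> Q" by (simp add: Q_def)
    then have \<alpha>: "0 < \<alpha>" by (simp add: \<alpha>_def)
    have "param 1 ` jump_vec ` half_open_cube \<subseteq> nontypical_points sphere_top (extend F) (return ?B (pole 1)) \<phi> \<alpha>"
    proof clarify
      fix w :: "(real, 'n) vec" assume w: "w \<in> half_open_cube"
      have "jump_vec w $ j \<in> C" for j
        using w closure_subset[of "jump_fun ` {0..<1}"] by (auto simp: C_def jump_vec_def half_open_cube_def)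
      then have fixed: "extend F (param 1 (jump_vec w)) = param 1 (jump_vec w)" using fixed_points by (simp add: extend_param)
      have "jump_vec w \<bullet> jump_vec w \<le> Q" unfolding Q_def b_def by (rule jump_vec_inner_bound[OF w])
      then have "1 / (1 + Q) < 2 / (1 + jump_vec w \<bullet> jump_vec w)"
        using one_plus_inner_pos[of "jump_vec w"] Q by (simp add: divide_simps)
      also have "\<dots> = \<phi> (param 1 (jump_vec w))" by (simp add: \<phi>_def param_def J'_J)
      finally have "\<alpha> < \<bar>\<phi> (param 1 (jump_vec w))\<bar>" by (simp add: \<alpha>_def)
      then show "param 1 (jump_vec w) \<in> nontypical_points sphere_top (extend F) (return ?B (pole 1)) \<phi> \<alpha>"
        by (rule fixed_point_nontypical[rotated 3]) (simp_all add: fixed int param_in_sphere)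
    qed
    then have "\<not> hausdorff_dim (riemannian_dist sphere_top atlas metric)
        (nontypical_points sphere_top (extend F) (return ?B (pole 1)) \<phi> \<alpha>) < ennreal CARD('n)"
      by (rule hausdorff_dim_jump_set)
    then show ?thesis by (rule that[OF diffeo SRB \<phi> \<alpha>])
  qed
qed

end

section \<open>Realization in dimension 4\<close>

lemma ex_linear_embedding:
  assumes "DIM('a::euclidean_space) \<le> DIM('b::euclidean_space)"
  obtains J :: "'a::euclidean_space \<Rightarrow> 'b::euclidean_space" and J' where "bounded_linear J" "bounded_linear J'" "\<And>z. J' (J z) = z"
proof -
  have "dim (UNIV :: 'a set) \<le> dim (UNIV :: 'b set)" using assms by (simp add: dim_UNIV)
  then obtain J :: "'a \<Rightarrow> 'b" where J: "linear J" "\<And>x. norm (J x) = norm x"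
    using isometry_subset_subspace[OF subspace_UNIV subspace_UNIV] by (metis UNIV_I)
  have "inj J"
  proof (rule injI)
    fix x y assume "J x = J y"
    then have "J (x - y) = 0" using linear_diff[OF J(1)] by simp
    then show "x = y" using J(2)[of "x - y"] by simp
  qed
  then obtain J' where J': "linear J'" "J' \<circ> J = id" using linear_injective_left_inverse[OF J(1)] by blast
  then have "J' (J z) = z" for z by (metis comp_apply id_apply)
  then show ?thesis
    using J(1) J'(1) unfolding linear_conv_bounded_linear by (intro that[of J J'])
qed

theorem mainTheorem1:
  shows "\<exists>(X :: (real ^ 8) topology) (\<A> :: (real ^ 8, 4) chart set) g vol f \<mu>.
    compact_riemannian_manifold X \<A> g \<and>
    is_riemannian_volume X \<A> g vol \<and>
    smooth_diffeomorphism X \<A> f \<and>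
    global_SRB_measure X vol f \<mu> \<and>
    \<not> special_ergodic_theorem X \<A> g f \<mu> \<and>
    (\<exists>\<phi> \<alpha>. continuous_map X euclideanreal \<phi> \<and> 0 < \<alpha> \<and>
       \<not> hausdorff_dim (riemannian_dist X \<A> g) (nontypical_points X f \<mu> \<phi> \<alpha>) < 4)"
proof -
  \<comment> \<open>The 4-sphere needs five ambient dimensions, and \<open>real ^ 8\<close> offers
    more than enough.\<close>
  have "DIM((real ^ 4) \<times> real) \<le> DIM(real ^ 8)" by simp
  then obtain J :: "(real ^ 4) \<times> real \<Rightarrow> real ^ 8" and J'
    where J: "bounded_linear J" "bounded_linear J'" "\<And>z. J' (J z) = z"
    using ex_linear_embedding by blast
  interpret stereographic J J' by (rule stereographic.intro) (fact J)+
  \<comment> \<open>Coordinates are indexed by the type \<open>4\<close>; its elements 0 and 1 serve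
    as the axis of the motion and a transversal axis.\<close>
  have "(0 :: 4) \<noteq> 1" by simp
  then obtain f \<mu> \<phi> \<alpha> where f: "smooth_diffeomorphism sphere_top atlas f"
    "global_SRB_measure sphere_top volume f \<mu>" "continuous_map sphere_top euclideanreal \<phi>" "0 < \<alpha>"
    "\<not> hausdorff_dim (riemannian_dist sphere_top atlas metric) (nontypical_points sphere_top f \<mu> \<phi> \<alpha>)
      < ennreal CARD(4)"
    by (rule special_ergodic_theorem_fails)
  have not4: "\<not> hausdorff_dim (riemannian_dist sphere_top atlas metric) (nontypical_points sphere_top f \<mu> \<phi> \<alpha>) < 4"
    using f(5) by simp
  have not_special: "\<not> special_ergodic_theorem sphere_top atlas metric f \<mu>"
  proof
    assume "special_ergodic_theorem sphere_top atlas metric f \<mu>"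
    from this[unfolded special_ergodic_theorem_def, rule_format, of \<phi> \<alpha>] show False using f(3,4) not4 by simp
  qed
  show ?thesis
    by (rule exI[of _ sphere_top], rule exI[of _ atlas], rule exI[of _ metric], rule exI[of _ volume],
        rule exI[of _ f], rule exI[of _ \<mu>], intro conjI compact_riemannian_manifold_sphere
        is_riemannian_volume_volume f(1,2) not_special exI[of _ \<phi>] exI[of _ \<alpha>] f(3,4) not4)
qed

end
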